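(* Let $n\ge 2$, $n-1<p\le n$, let $D,D'\subset\mathbb R^n$ be domains, $x_0\in\partial D$, $x_0\neq\infty$, $\delta>0$, and let $Q:D\to[0,\infty]$ be a Lebesgue measurable function (extended by $0$ outside $D$). Let $D'$ be a bounded Ahlfors regular domain with the $(1;p)$-Poincaré inequality. Assume: 1) there is $r_0'=r_0'(x_0)>0$ such that $B(x_0,r)\cap D$ is connected for all $0<r<r_0'$; 2) there is a constant $0<C=C(x_0)<\infty$ such that $$\limsup_{\varepsilon\to0}\frac{1}{\Omega_n\varepsilon^n}\int_{B(x_0,\varepsilon)\cap D}Q(x)\,dm(x)\le C.$$ Then there exist $0<\varepsilon_0=\varepsilon_0(x_0,D',n,p,\delta)<1$ and $\widetilde C=\widetilde C(p,n,C,D')>0$ such that for all $x,y\in B(x_0,\varepsilon_0^2)\cap D$ and all $f\in\mathfrak R^{p,x_0}_{Q,\delta}(D,D')$ $$|f(x)-f(y)|\le\widetilde C\cdot\max\left\{\frac{1}{\log^{n-1}\frac{\varepsilon_0}{|x-x_0|}},\ \frac{1}{\log^{n-1}\frac{\varepsilon_0}{|y-x_0|}}\right\}.$$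
   Context: Notation: $B(x_0,r)=\{x\in\mathbb R^n:|x-x_0|<r\}$, $S(x_0,r)=\{x:|x-x_0|=r\}$, $m$ is Lebesgue measure in $\mathbb R^n$, $\Omega_n=m(B(0,1))$, $\log^{n-1}t=(\log t)^{n-1}$, $\operatorname{diam}$ is Euclidean diameter. $M_p(\Gamma)$ is the $p$-modulus of a family $\Gamma$ of curves in $\mathbb R^n$: the infimum of $\int_{\mathbb R^n}\rho^p\,dm$ over Borel $\rho:\mathbb R^n\to[0,\infty]$ with $\int_\gamma\rho\,|dx|\ge1$ for all locally rectifiable $\gamma\in\Gamma$. For $E,F\subset\overline{\mathbb R^n}=\mathbb R^n\cup\{\infty\}$, $\Gamma(E,F,D)$ is the family of all curves $\gamma:[a,b]\to\overline{\mathbb R^n}$ with $\gamma(a)\in E$, $\gamma(b)\in F$ and $\gamma(t)\in D$ for $t\in(a,b)$. $f(\Gamma)$ is the family of curves $f\circ\gamma$, $\gamma\in\Gamma$; if the endpoints of $\gamma$ lie in $\overline D$ but not in $D$, $f(\gamma)$ means $f(\gamma(t))$, $t\in(a,b)$. Ring $Q$-mapping at $x_0\in\overline D$, $x_0\ne\infty$, with respect to the $p$-modulus: for some $r_0=r(x_0)>0$ (depending on the point $x_0$; the same for all mappings in a family under consideration) and all $0<r_1<r_2<r_0$, $$M_p(f(\Gamma(S(x_0,r_1),S(x_0,r_2),D)))\le\int_{\{r_1<|x-x_0|<r_2\}}Q(x)\,\eta^p(|x-x_0|)\,dm(x)$$ for every Lebesgue measurable $\eta:(r_1,r_2)\to[0,\infty]$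 with $\int_{r_1}^{r_2}\eta(r)\,dr\ge1$. Boundaries are taken in $\overline{\mathbb R^n}$. A mapping $f$ of $D$ onto $D'$ is closed if $C(f,\partial D)\subset\partial D'$, where $C(f,\partial D)$ is the cluster set of $f$ on $\partial D$ (all limits of $f(x_k)$ along sequences $x_k\in D$ converging to a point of $\partial D$). It is open if images of open sets are open, and discrete if each fibre $f^{-1}(y)$ consists of isolated points. The chordal metric on $\overline{\mathbb R^n}$ is $h(x,y)=\frac{|x-y|}{\sqrt{1+|x|^2}\sqrt{1+|y|^2}}$ for $x\ne\infty\ne y$, $h(x,\infty)=\frac1{\sqrt{1+|x|^2}}$; for sets $h(E,F)=\inf_{x\in E,y\in F}h(x,y)$. $\mathfrak R^{p,x_0}_{Q,\delta}(D,D')$ is the family of all open, discrete and closed mappings $f$ of $D$ onto $D'$ that are ring $Q$-mappings at $x_0$ with respect to the $p$-modulus and for which there is a continuum $K_f\subset D'$ with $\operatorname{diam}K_f\ge\delta$ and $h(f^{-1}(K_f),\partial D)\ge\delta$. A domain $G\subset\mathbb R^n$ is Ahlfors regular if there is $C\ge1$ such that $\frac1CR^n\le m(B(x,R)\cap G)\le CR^n$ for all $x\in G$ and $0<R<\operatorname{diam}G$. A Borel function $\rho:G\to[0,\infty]$ is an upper gradient of $u:G\to\mathbb R$ if $|u(x)-u(y)|\le\int_\gamma\rho\,|dx|$ for every rectifiable curve $\gamma$ in $G$ joining $x,y\in G$. The $(1;p)$-Poincaré inequality holds in $G$ if there are $C\ge1$, $\tau>0$ such that for every ball $B$ of the metric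 space $G$ (i.e. $B=B(x,r)\cap G$, $x\in G$, with $\tau B=B(x,\tau r)\cap G$), every bounded continuous $u:G\to\mathbb R$ and every upper gradient $\rho$ of $u$, $$\frac1{m(B)}\int_B|u-u_B|\,dm\le C\,(\operatorname{diam}B)\Big(\frac1{m(\tau B)}\int_{\tau B}\rho^p\,dm\Big)^{1/p},\qquad u_B=\frac1{m(B)}\int_Bu\,dm.$$ The data $D,Q$ and the radius $r(x_0)$ are fixed; $\varepsilon_0$ may depend on them in addition to the listed parameters. *)

theory Defs
  imports "HOL-Analysis.Analysis"
begin

section \<open>The extended space and the chordal metric\<close>

text \<open>The space \<open>R^n\<close> is a type \<open>'a::euclidean_space\<close> with \<open>DIM('a) = n\<close>; its one-point
  compactification lives on \<open>'a option\<close>, with \<open>None\<close> as the point at infinity.\<close>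

abbreviation ext_space :: "'a::euclidean_space option topology" where
  "ext_space \<equiv> Alexandroff_compactification euclidean"

definition ext_boundary :: "'a::euclidean_space set \<Rightarrow> 'a option set" where
  "ext_boundary D = ext_space frontier_of (Some ` D)"

fun chordal_dist :: "'a::euclidean_space option \<Rightarrow> 'a option \<Rightarrow> real" where
  "chordal_dist (Some x) (Some y) =
     norm (x - y) / (sqrt (1 + (norm x)\<^sup>2) * sqrt (1 + (norm y)\<^sup>2))"
| "chordal_dist (Some x) None = 1 / sqrt (1 + (norm x)\<^sup>2)"
| "chordal_dist None (Some y) = 1 / sqrt (1 + (norm y)\<^sup>2)"
| "chordal_dist None None = 0"

text \<open>Meaningful for nonempty sets only.\<close>

definition chordal_setdist :: "'a::euclidean_space option set \<Rightarrow> 'a option set \<Rightarrow> real" where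
  "chordal_setdist E F = (INF (x, y)\<in>E \<times> F. chordal_dist x y)"

definition is_domain :: "'a::euclidean_space set \<Rightarrow> bool" where
  "is_domain D \<longleftrightarrow> open D \<and> connected D \<and> D \<noteq> {}"

text \<open>Powers of elements of \<open>[0,\<infinity>]\<close>, for exponents \<open>p > 0\<close>.\<close>

definition epowr :: "ennreal \<Rightarrow> real \<Rightarrow> ennreal" where
  "epowr x p = (if x = \<infinity> then \<infinity> else ennreal (enn2real x powr p))"


section \<open>Curves, curve integrals and the modulus\<close>

text \<open>A curve is a continuous map on an interval (closed, open or half-open) of the real line,
  represented by the interval together with the map.\<close>

type_synonym 'a curve = "real set \<times> (real \<Rightarrow> 'a)"

definition curve_length :: "real \<Rightarrow> real \<Rightarrow> (real \<Rightarrow> 'a::euclidean_space) \<Rightarrow> ennreal" where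
  "curve_length a b g =
     Sup {\<Sum>i<k. ennreal (dist (g (t i)) (g (t (Suc i)))) | (k::nat) t.
            t 0 = a \<and> t k = b \<and> (\<forall>i<k. t i \<le> t (Suc i))}"

text \<open>The arc length parametrization \<open>g0\<close> of \<open>g\<close> on \<open>[a,b]\<close>, characterized by
  \<open>g t = g0 (length of g on [a,t])\<close>. The value does not depend on the choice of \<open>t\<close>, as \<open>g\<close> is
  constant on an interval on which its length function is constant.\<close>

definition arclength_param ::
    "real \<Rightarrow> real \<Rightarrow> (real \<Rightarrow> 'a::euclidean_space) \<Rightarrow> real \<Rightarrow> 'a" where
  "arclength_param a b g s = g (SOME t. t \<in> {a..b} \<and> curve_length a t g = ennreal s)"

text \<open>Integral over a rectifiable curve defined on \<open>[a,b]\<close>.\<close>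

definition segment_integral ::
    "real \<Rightarrow> real \<Rightarrow> (real \<Rightarrow> 'a::euclidean_space) \<Rightarrow> ('a \<Rightarrow> ennreal) \<Rightarrow> ennreal" where
  "segment_integral a b g \<rho> =
     (\<integral>\<^sup>+ s\<in>{0..enn2real (curve_length a b g)}. \<rho> (arclength_param a b g s) \<partial>lborel)"

fun locally_rectifiable :: "'a::euclidean_space curve \<Rightarrow> bool" where
  "locally_rectifiable (I, g) \<longleftrightarrow>
     (\<forall>a b. a \<le> b \<and> {a..b} \<subseteq> I \<longrightarrow> curve_length a b g < \<infinity>)"

text \<open>Integral over a locally rectifiable curve: the supremum over its closed subcurves.\<close>

fun curve_integral :: "'a::euclidean_space curve \<Rightarrow> ('a \<Rightarrow> ennreal) \<Rightarrow> ennreal" where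
  "curve_integral (I, g) \<rho> =
     (SUP (a, b)\<in>{(a, b). a \<le> b \<and> {a..b} \<subseteq> I}. segment_integral a b g \<rho>)"

definition admissible :: "'a::euclidean_space curve set \<Rightarrow> ('a \<Rightarrow> ennreal) set" where
  "admissible \<Gamma> = {\<rho> \<in> borel_measurable borel.
     \<forall>\<gamma>\<in>\<Gamma>. locally_rectifiable \<gamma> \<longrightarrow> 1 \<le> curve_integral \<gamma> \<rho>}"

definition modulus :: "real \<Rightarrow> 'a::euclidean_space curve set \<Rightarrow> ennreal" where
  "modulus p \<Gamma> = (INF \<rho>\<in>admissible \<Gamma>. \<integral>\<^sup>+ x. epowr (\<rho> x) p \<partial>lborel)"

text \<open>The family \<open>\<Gamma>(E,F,D)\<close> for \<open>E\<close>, \<open>F\<close>, \<open>D\<close> contained in \<open>R^n\<close>; its curves never pass through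
  the point at infinity.\<close>

definition joining_curves ::
    "'a::euclidean_space set \<Rightarrow> 'a set \<Rightarrow> 'a set \<Rightarrow> 'a curve set" where
  "joining_curves E F D =
     {({a..b}, \<gamma>) | a b \<gamma>. a < b \<and> continuous_on {a..b} \<gamma> \<and>
        \<gamma> a \<in> E \<and> \<gamma> b \<in> F \<and> (\<forall>t\<in>{a<..<b}. \<gamma> t \<in> D)}"

text \<open>The image curve of a map defined on \<open>D\<close> only: an endpoint of \<open>\<gamma>\<close> outside \<open>D\<close> is dropped.\<close>

definition image_curves ::
    "'a::euclidean_space set \<Rightarrow> ('a \<Rightarrow> 'a) \<Rightarrow> 'a curve set \<Rightarrow> 'a curve set" where
  "image_curves D f \<Gamma> = (\<lambda>(I, \<gamma>). ({t \<in> I. \<gamma> t \<in> D}, f \<circ> \<gamma>)) ` \<Gamma>"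


section \<open>Ring Q-mappings and the family under consideration\<close>

text \<open>The function \<open>Q\<close> is assumed to be extended by zero outside \<open>D\<close>.\<close>

definition ring_Q_mapping ::
    "real \<Rightarrow> 'a::euclidean_space \<Rightarrow> real \<Rightarrow> ('a \<Rightarrow> ennreal) \<Rightarrow> 'a set \<Rightarrow> ('a \<Rightarrow> 'a) \<Rightarrow> bool" where
  "ring_Q_mapping p x0 r0 Q D f \<longleftrightarrow>
     (\<forall>r1 r2 \<eta>. 0 < r1 \<and> r1 < r2 \<and> r2 < r0 \<and>
        \<eta> \<in> borel_measurable (lebesgue_on {r1<..<r2}) \<and>
        1 \<le> (\<integral>\<^sup>+ r\<in>{r1<..<r2}. \<eta> r \<partial>lebesgue) \<longrightarrow>
        modulus p (image_curves D f (joining_curves (sphere x0 r1) (sphere x0 r2) D))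
          \<le> (\<integral>\<^sup>+ x\<in>{x. r1 < norm (x - x0) \<and> norm (x - x0) < r2}.
                Q x * epowr (\<eta> (norm (x - x0))) p \<partial>lebesgue))"

definition cluster_set ::
    "'a::euclidean_space set \<Rightarrow> ('a \<Rightarrow> 'a) \<Rightarrow> 'a option set \<Rightarrow> 'a option set" where
  "cluster_set D f A =
     {z. \<exists>w\<in>A. \<exists>X :: nat \<Rightarrow> 'a. (\<forall>k. X k \<in> D) \<and>
        limitin ext_space (\<lambda>k. Some (X k)) w sequentially \<and>
        limitin ext_space (\<lambda>k. Some (f (X k))) z sequentially}"

definition open_mapping_on :: "'a::euclidean_space set \<Rightarrow> ('a \<Rightarrow> 'a) \<Rightarrow> bool" where
  "open_mapping_on D f \<longleftrightarrow> (\<forall>U. open U \<and> U \<subseteq> D \<longrightarrow> open (f ` U))"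

definition discrete_mapping_on :: "'a::euclidean_space set \<Rightarrow> ('a \<Rightarrow> 'a) \<Rightarrow> bool" where
  "discrete_mapping_on D f \<longleftrightarrow> (\<forall>y. discrete {x \<in> D. f x = y})"

definition closed_mapping_on ::
    "'a::euclidean_space set \<Rightarrow> 'a set \<Rightarrow> ('a \<Rightarrow> 'a) \<Rightarrow> bool" where
  "closed_mapping_on D D' f \<longleftrightarrow> cluster_set D f (ext_boundary D) \<subseteq> ext_boundary D'"

text \<open>Mappings are continuous, as usual in this setting (otherwise \<open>f \<circ> \<gamma>\<close> would not be a curve).\<close>

definition ring_family ::
    "real \<Rightarrow> 'a::euclidean_space \<Rightarrow> real \<Rightarrow> ('a \<Rightarrow> ennreal) \<Rightarrow> real \<Rightarrow> 'a set \<Rightarrow> 'a set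
       \<Rightarrow> ('a \<Rightarrow> 'a) set" where
  "ring_family p x0 r0 Q \<delta> D D' =
     {f. continuous_on D f \<and> f ` D = D' \<and>
         open_mapping_on D f \<and> discrete_mapping_on D f \<and> closed_mapping_on D D' f \<and>
         ring_Q_mapping p x0 r0 Q D f \<and>
         (\<exists>K. compact K \<and> connected K \<and> K \<noteq> {} \<and> K \<subseteq> D' \<and> \<delta> \<le> diameter K \<and>
              \<delta> \<le> chordal_setdist (Some ` {x \<in> D. f x \<in> K}) (ext_boundary D))}"


section \<open>Ahlfors regularity and the Poincare inequality\<close>

text \<open>For unbounded \<open>G\<close> all \<open>R > 0\<close> are admitted, since then the diameter of \<open>G\<close> is infinite
  (the library's \<open>diameter\<close> is meaningful for bounded sets only).\<close>

definition Ahlfors_regular :: "'a::euclidean_space set \<Rightarrow> bool" where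
  "Ahlfors_regular G \<longleftrightarrow>
     (\<exists>C\<ge>1. \<forall>x\<in>G. \<forall>R>0. (bounded G \<longrightarrow> R < diameter G) \<longrightarrow>
        R ^ DIM('a) / C \<le> measure lebesgue (ball x R \<inter> G) \<and>
        measure lebesgue (ball x R \<inter> G) \<le> C * R ^ DIM('a))"

definition upper_gradient ::
    "'a::euclidean_space set \<Rightarrow> ('a \<Rightarrow> real) \<Rightarrow> ('a \<Rightarrow> ennreal) \<Rightarrow> bool" where
  "upper_gradient G u \<rho> \<longleftrightarrow>
     \<rho> \<in> borel_measurable (restrict_space borel G) \<and>
     (\<forall>a b \<gamma>. a \<le> b \<and> continuous_on {a..b} \<gamma> \<and> \<gamma> ` {a..b} \<subseteq> G \<and> curve_length a b \<gamma> < \<infinity> \<longrightarrow>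
        ennreal \<bar>u (\<gamma> a) - u (\<gamma> b)\<bar> \<le> curve_integral ({a..b}, \<gamma>) \<rho>)"

definition mean_value :: "'a::euclidean_space set \<Rightarrow> ('a \<Rightarrow> real) \<Rightarrow> real" where
  "mean_value B u = (LINT z:B|lebesgue. u z) / measure lebesgue B"

definition Poincare_inequality :: "real \<Rightarrow> 'a::euclidean_space set \<Rightarrow> bool" where
  "Poincare_inequality p G \<longleftrightarrow>
     (\<exists>C\<ge>1. \<exists>\<tau>>0. \<forall>x\<in>G. \<forall>r>0. \<forall>u \<rho>.
        continuous_on G u \<and> bounded (u ` G) \<and> upper_gradient G u \<rho> \<longrightarrow>
        (let B = ball x r \<inter> G; \<tau>B = ball x (\<tau> * r) \<inter> G in
          ennreal (mean_value B (\<lambda>z. \<bar>u z - mean_value B u\<bar>))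
            \<le> ennreal (C * diameter B) *
              epowr ((\<integral>\<^sup>+ z\<in>\<tau>B. epowr (\<rho> z) p \<partial>lebesgue) / emeasure lebesgue \<tau>B) (1 / p)))"

end

theory Submission
  imports Defs "HOL-Complex_Analysis.Great_Picard"
begin

text \<open>Let \<open>m\<close> be the larger one of the distances of \<open>x\<close> and \<open>y\<close> from \<open>x0\<close>. The points are joined by a path
  in \<open>B(x0,r) \<inter> D\<close>, where \<open>r\<close> is the geometric mean of \<open>m\<close> and \<open>\<epsilon>0\<close>; let \<open>E\<close> be its image, a continuum
  containing \<open>f x\<close> and \<open>f y\<close>, and let \<open>K\<close> be the continuum in \<open>D'\<close> whose preimage keeps away from the boundary
  of \<open>D\<close>. The modulus of the images of the curves crossing the ring between the spheres of radii \<open>r\<close> and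
  \<open>\<epsilon>0\<close> is estimated from both sides.

  From above, the ring condition with the density \<open>1 / (t * ln (\<epsilon>0 / r))\<close> and the bound for the means of
  \<open>Q\<close> give a constant multiple of \<open>1 / ln (\<epsilon>0 / r) ^ (n - 1)\<close>, by summation over dyadic rings
  (\<open>ring_integral_le_log\<close>).

  From below, an admissible density \<open>\<rho>\<close> has energy at least a constant multiple of the smaller one of the
  diameters of \<open>E\<close> and \<open>K\<close> (\<open>min_diameter_le_energy\<close>). Indeed a closed map is proper, so paths in
  \<open>D'\<close> lift (\<open>path_lifting\<close>); the lift of a curve that leads from the image of \<open>B(x0,r) \<inter> D\<close> to near \<open>K\<close>
  crosses the ring, whence \<open>\<rho>\<close> has integral at least \<open>1\<close> along every such curve
  (\<open>curve_integral_ge_1_by_lifting\<close>). These curves start in one open set and end in another, which leaves room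
  for averaging \<open>\<rho>\<close> over small displacements whose size tends to \<open>0\<close> at the boundary of \<open>D'\<close>. The smoothed
  density is locally bounded, its energy has grown by a constant factor only, and the truncated distance
  from \<open>E\<close> that it defines is a continuous function with the smoothed density as upper gradient, which
  vanishes on \<open>E\<close> and is at least \<open>2/3\<close> on \<open>K\<close>. For such a function the Poincare inequality yields, by telescoping
  over concentric balls about each point of \<open>E\<close> or about each point of \<open>K\<close>, a ball whose radius is bounded by the
  energy in it; here \<open>n - 1 < p\<close> enters. A Vitali covering by these balls bounds the diameter of the
  connected set by the total energy (\<open>capacity_lower_bound\<close>).

  For small \<open>\<epsilon>0\<close> the upper bound is so small that the smaller one of the diameters cannot be that of \<open>K\<close>; hence the
  diameter of \<open>E\<close>, and with it \<open>|f x - f y|\<close>, has the bound claimed.\<close>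

section \<open>Length and arc length parametrization of curves\<close>

abbreviation polygon_length :: "nat \<Rightarrow> (real \<Rightarrow> 'a::euclidean_space) \<Rightarrow> (nat \<Rightarrow> real) \<Rightarrow> ennreal" where
  "polygon_length k g t \<equiv> \<Sum>i<k. ennreal (dist (g (t i)) (g (t (Suc i))))"

lemma partition_mono:
  fixes t :: "nat \<Rightarrow> real"
  assumes "\<forall>i<k. t i \<le> t (Suc i)" "i \<le> j" "j \<le> k"
  shows "t i \<le> t j"
  using assms(2,3)
proof (induction j rule: dec_induct)
  case (step j)
  then have "t i \<le> t j" "t j \<le> t (Suc j)" using assms(1) by simp_all
  then show ?case by (rule order_trans)
qed simp

lemma curve_length_cong:
  assumes "\<And>t. a \<le> t \<Longrightarrow> t \<le> b \<Longrightarrow> g t = h t"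
  shows "curve_length a b g = curve_length a b h"
proof -
  have "polygon_length k g t
      = polygon_length k h t"
    if t: "t 0 = a" "t k = b" "\<forall>i<k. t i \<le> t (Suc i)" for k :: nat and t
  proof -
    have mono: "i \<le> j \<Longrightarrow> j \<le> k \<Longrightarrow> t i \<le> t j" for i j
      by (rule partition_mono[OF t(3)])
    have "g (t i) = h (t i)" if "i \<le> k" for i
      using assms mono[of 0 i] mono[of i k] that t by auto
    then show ?thesis by (intro sum.cong) auto
  qed
  then show ?thesis
    unfolding curve_length_def by (intro arg_cong[where f = Sup] Collect_cong ex_cong1) auto
qed

lemma dist_le_curve_length:
  assumes "a \<le> b" shows "ennreal (dist (g a) (g b)) \<le> curve_length a b g"
  unfolding curve_length_def
proof (rule Sup_upper, clarify, intro exI conjI)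
  show "ennreal (dist (g a) (g b)) = (\<Sum>i<1::nat. ennreal (dist (g ((\<lambda>i. if i = 0 then a else b) i))
     (g ((\<lambda>i. if i = 0 then a else b) (Suc i)))))"
    by simp
qed (use assms in auto)

text \<open>A partition of \<open>[a,b]\<close> is clamped to \<open>[a,c]\<close> and to \<open>[c,b]\<close>: this avoids having to insert
  \<open>c\<close> as a new partition point.\<close>

lemma curve_length_subadditive:
  assumes "a \<le> c" "c \<le> b"
  shows "curve_length a b g \<le> curve_length a c g + curve_length c b g"
  unfolding curve_length_def[of a b]
proof (rule Sup_least, clarify)
  fix k :: nat and t :: "nat \<Rightarrow> real"
  assume t: "b = t k" "a = t 0" "\<forall>i<k. t i \<le> t (Suc i)"
  let ?u = "\<lambda>i. min (t i) c" and ?v = "\<lambda>i. max (t i) c"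
  have "polygon_length k g t
     \<le> (\<Sum>i<k. ennreal (dist (g (?u i)) (g (?u (Suc i)))) + ennreal (dist (g (?v i)) (g (?v (Suc i)))))"
  proof (rule sum_mono)
    fix i assume "i \<in> {..<k}"
    then have "t i \<le> t (Suc i)" using t by auto
    moreover have "dist (g (t i)) (g (t (Suc i))) \<le> dist (g (t i)) (g c) + dist (g c) (g (t (Suc i)))"
      by (rule dist_triangle)
    ultimately have "dist (g (t i)) (g (t (Suc i)))
       \<le> dist (g (?u i)) (g (?u (Suc i))) + dist (g (?v i)) (g (?v (Suc i)))"
      by (simp add: min_def max_def)
    then show "ennreal (dist (g (t i)) (g (t (Suc i))))
       \<le> ennreal (dist (g (?u i)) (g (?u (Suc i)))) + ennreal (dist (g (?v i)) (g (?v (Suc i))))"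
      by (metis ennreal_leI ennreal_plus zero_le_dist)
  qed
  also have "\<dots> = polygon_length k g ?u
      + polygon_length k g ?v"
    by (simp add: sum.distrib)
  also have "\<dots> \<le> curve_length a c g + curve_length c b g"
  proof (rule add_mono)
    show "polygon_length k g ?u \<le> curve_length a c g"
      unfolding curve_length_def using t assms
      by (intro Sup_upper CollectI exI[of _ k] exI[of _ ?u]) (auto simp: min_def)
    show "polygon_length k g ?v \<le> curve_length c b g"
      unfolding curve_length_def using t assms
      by (intro Sup_upper CollectI exI[of _ k] exI[of _ ?v]) (auto simp: max_def)
  qed
  finally show "polygon_length k g t
     \<le> curve_length (t 0) c g + curve_length c (t k) g" using t by simp
qed

lemma curve_length_superadditive:
  assumes "a \<le> c" "c \<le> b"
  shows "curve_length a c g + curve_length c b g \<le> curve_length a b g"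
proof -
  define S where "S a b = {polygon_length k g t | (k::nat) t.
            t 0 = a \<and> t k = b \<and> (\<forall>i<k. t i \<le> t (Suc i))}" for a b
  have S: "curve_length a b g = Sup (S a b)" for a b
    by (simp add: curve_length_def S_def)
  have ne: "S a b \<noteq> {}" if "a \<le> b" for a b
    unfolding S_def using that
    by (auto intro!: exI[of _ 1] exI[of _ "\<lambda>i::nat. if i = 0 then a else b"])
  have *: "x + y \<in> S a b" if xy: "x \<in> S a c" "y \<in> S c b" for x y
  proof -
    obtain k t where x: "x = polygon_length k g t"
      and t: "t 0 = a" "t k = c" "\<forall>i<k. t i \<le> t (Suc i)" using xy(1) by (auto simp: S_def)
    obtain l s where y: "y = (\<Sum>i<l. ennreal (dist (g (s i)) (g (s (Suc i)))))"
      and s: "s 0 = c" "s l = b" "\<forall>i<l. s i \<le> s (Suc i)" using xy(2) by (auto simp: S_def)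
    define r where "r i = (if i < k then t i else s (i - k))" for i
    have r1: "r i = t i" if "i \<le> k" for i using that t s by (cases "i = k") (auto simp: r_def)
    have r2: "r (i + k) = s i" for i by (simp add: r_def)
    have "(\<Sum>i<k + l. ennreal (dist (g (r i)) (g (r (Suc i)))))
       = polygon_length k g r + (\<Sum>i=k..<k+l. ennreal (dist (g (r i)) (g (r (Suc i)))))"
      unfolding lessThan_atLeast0 by (rule sum.atLeastLessThan_concat[symmetric]) auto
    also have "(\<Sum>i=k..<k+l. ennreal (dist (g (r i)) (g (r (Suc i)))))
       = (\<Sum>i=0..<l. ennreal (dist (g (r (i + k))) (g (r (Suc (i + k))))))"
      using sum.shift_bounds_nat_ivl[of "\<lambda>i. ennreal (dist (g (r i)) (g (r (Suc i))))" 0 k l]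
      by (simp add: add.commute)
    also have "\<dots> = y"
      unfolding y lessThan_atLeast0 by (simp only: r2 add_Suc[symmetric])
    also have "polygon_length k g r = x"
      unfolding x by (intro sum.cong) (auto simp: r1)
    finally have "x + y = (\<Sum>i<k + l. ennreal (dist (g (r i)) (g (r (Suc i)))))" by simp
    moreover have "r 0 = a" "r (k + l) = b" using r1[of 0] t r2[of l] s by (auto simp: add.commute)
    moreover have "r i \<le> r (Suc i)" if "i < k + l" for i
    proof (cases "i < k")
      case True then show ?thesis using r1[of i] r1[of "Suc i"] t by auto
    next
      case False
      then show ?thesis using r2[of "i - k"] r2[of "Suc i - k"] s that
        by (auto simp: Suc_diff_le)
    qed
    ultimately show ?thesis unfolding S_def by blast
  qed
  have "Sup (S a c) + Sup (S c b) = (SUP x\<in>S a c. x + Sup (S c b))"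
    using ennreal_SUP_add_left[OF ne[OF assms(1)], of "\<lambda>x. x"] by simp
  also have "\<dots> \<le> Sup (S a b)"
  proof (rule SUP_least)
    fix x assume x: "x \<in> S a c"
    have "x + Sup (S c b) = (SUP y\<in>S c b. x + y)"
      using ennreal_SUP_add_right[OF ne[OF assms(2)], of x "\<lambda>y. y"] by simp
    also have "\<dots> \<le> Sup (S a b)" by (rule SUP_least) (use * x in \<open>auto intro: Sup_upper\<close>)
    finally show "x + Sup (S c b) \<le> Sup (S a b)" .
  qed
  finally show ?thesis by (simp add: S)
qed

lemma curve_length_additive:
  assumes "a \<le> c" "c \<le> b"
  shows "curve_length a b g = curve_length a c g + curve_length c b g"
  using curve_length_subadditive[OF assms] curve_length_superadditive[OF assms] by (rule antisym)

lemma curve_length_lipschitz: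
  assumes "M-lipschitz_on {a..b} g" "a \<le> b"
  shows "curve_length a b g \<le> ennreal (M * (b - a))"
  unfolding curve_length_def
proof (rule Sup_least, clarify)
  fix k :: nat and t :: "nat \<Rightarrow> real"
  assume t: "b = t k" "a = t 0" "\<forall>i<k. t i \<le> t (Suc i)"
  have mono: "i \<le> j \<Longrightarrow> j \<le> k \<Longrightarrow> t i \<le> t j" for i j
    by (rule partition_mono[OF t(3)])
  have "polygon_length k g t \<le> (\<Sum>i<k. ennreal (M * (t (Suc i) - t i)))"
  proof (intro sum_mono ennreal_leI)
    fix i assume "i \<in> {..<k}"
    then have "t i \<in> {a..b}" "t (Suc i) \<in> {a..b}" "t i \<le> t (Suc i)"
      using mono[of 0 i] mono[of i k] mono[of 0 "Suc i"] mono[of "Suc i" k] t by auto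
    then show "dist (g (t i)) (g (t (Suc i))) \<le> M * (t (Suc i) - t i)"
      using lipschitz_onD[OF assms(1), of "t i" "t (Suc i)"] by (auto simp: dist_real_def)
  qed
  also have "\<dots> = ennreal (\<Sum>i<k. M * (t (Suc i) - t i))"
    using t lipschitz_on_nonneg[OF assms(1)] by (intro sum_ennreal) auto
  also have "(\<Sum>i<k. M * (t (Suc i) - t i)) = M * (t k - t 0)"
    by (simp add: sum_distrib_left[symmetric] sum_lessThan_telescope)
  finally show "polygon_length k g t \<le> ennreal (M * (t k - t 0))" .
qed

lemma curve_length_self [simp]: "curve_length a a g = 0"
  using curve_length_lipschitz[of 0 a a g] by (simp add: lipschitz_on_def)

text \<open>Fix a partition whose sum is within \<open>e\<close> of the length. Clamped to a short interval \<open>[c,d]\<close>, its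
  sum consists of a fixed number of terms, each small by uniform continuity; the rest of the curve
  accounts for the remainder of the length up to \<open>e\<close>.\<close>

lemma curve_length_small:
  fixes g :: "real \<Rightarrow> 'a::euclidean_space"
  assumes cont: "continuous_on {a..b} g" and fin: "curve_length a b g < \<infinity>" and "0 < e"
  shows "\<exists>d>0. \<forall>s t. a \<le> s \<and> s \<le> t \<and> t \<le> b \<and> t - s < d \<longrightarrow> curve_length s t g \<le> ennreal (2 * e)"
proof (cases "a \<le> b")
  case ab: True
  let ?L = "curve_length a b g"
  have "\<exists>k t. t 0 = a \<and> t k = b \<and> (\<forall>i<k. t i \<le> t (Suc i)) \<and>
      ?L \<le> polygon_length k g t + ennreal e"
  proof (cases "?L = 0")
    case True
    then show ?thesis using ab by (intro exI[of _ 1] exI[of _ "\<lambda>i::nat. if i = 0 then a else b"]) auto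
  next
    case False
    then have "?L - ennreal e < ?L" using fin \<open>0 < e\<close>
      by (intro ennreal_between) (auto simp: zero_less_iff_neq_zero)
    then obtain x where x: "x \<in> {polygon_length k g t | (k::nat) t.
            t 0 = a \<and> t k = b \<and> (\<forall>i<k. t i \<le> t (Suc i))}" "?L - ennreal e < x"
      unfolding curve_length_def less_Sup_iff by blast
    have "?L \<le> x + ennreal e" using x(2)
      using ennreal_minus_le_iff[of ?L "ennreal e" x] by (auto simp: add.commute)
    then show ?thesis using x(1) by blast
  qed
  then obtain k t where t: "t 0 = a" "t k = b" "\<forall>i<k. t i \<le> t (Suc i)"
    and L: "?L \<le> polygon_length k g t + ennreal e" by blast
  have "uniformly_continuous_on {a..b} g"
    using cont by (intro compact_uniformly_continuous) auto
  then obtain \<eta> where \<eta>: "0 < \<eta>"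
    "\<And>x y. x \<in> {a..b} \<Longrightarrow> y \<in> {a..b} \<Longrightarrow> dist y x < \<eta> \<Longrightarrow> dist (g y) (g x) < e / (k + 1)"
    using \<open>0 < e\<close> unfolding uniformly_continuous_on_def
    by (elim allE[of _ "e / (k + 1)"]) auto
  have "curve_length c d g \<le> ennreal (2 * e)" if cd: "a \<le> c" "c \<le> d" "d \<le> b" "d - c < \<eta>" for c d
  proof -
    let ?P = "polygon_length k g"
    let ?u = "\<lambda>i. min (t i) c" and ?v = "\<lambda>i. min (max (t i) c) d" and ?w = "\<lambda>i. max (t i) d"
    have "?P t \<le> (\<Sum>i<k. ennreal (dist (g (?u i)) (g (?u (Suc i))))
        + ennreal (dist (g (?v i)) (g (?v (Suc i)))) + ennreal (dist (g (?w i)) (g (?w (Suc i)))))"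
    proof (rule sum_mono)
      fix i assume "i \<in> {..<k}"
      then have i: "t i \<le> t (Suc i)" using t by auto
      have "dist (g (t i)) (g (t (Suc i))) \<le> dist (g (t i)) (g c) + dist (g c) (g (t (Suc i)))"
        "dist (g (t i)) (g (t (Suc i))) \<le> dist (g (t i)) (g d) + dist (g d) (g (t (Suc i)))"
        "dist (g (t i)) (g d) \<le> dist (g (t i)) (g c) + dist (g c) (g d)"
        by (rule dist_triangle)+
      then have "dist (g (t i)) (g (t (Suc i))) \<le> dist (g (?u i)) (g (?u (Suc i)))
        + dist (g (?v i)) (g (?v (Suc i))) + dist (g (?w i)) (g (?w (Suc i)))"
        using i cd by (auto simp: min_def max_def)
      then show "ennreal (dist (g (t i)) (g (t (Suc i)))) \<le> ennreal (dist (g (?u i)) (g (?u (Suc i))))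
        + ennreal (dist (g (?v i)) (g (?v (Suc i)))) + ennreal (dist (g (?w i)) (g (?w (Suc i))))"
        by (metis add_nonneg_nonneg ennreal_leI ennreal_plus zero_le_dist)
    qed
    also have "\<dots> = ?P ?u + ?P ?v + ?P ?w" by (simp add: sum.distrib)
    also have "?P ?u \<le> curve_length a c g"
      unfolding curve_length_def using t cd
      by (intro Sup_upper CollectI exI[of _ k] exI[of _ ?u]) (auto simp: min_def)
    also have "?P ?w \<le> curve_length d b g"
      unfolding curve_length_def using t cd
      by (intro Sup_upper CollectI exI[of _ k] exI[of _ ?w]) (auto simp: max_def)
    also have "?P ?v \<le> (\<Sum>i<k. ennreal (e / (k + 1)))"
    proof (intro sum_mono ennreal_leI)
      fix i
      have "?v i \<in> {a..b}" "?v (Suc i) \<in> {a..b}" "dist (?v i) (?v (Suc i)) < \<eta>"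
        using cd by (auto simp: dist_real_def)
      then show "dist (g (?v i)) (g (?v (Suc i))) \<le> e / (k + 1)" using \<eta>(2) less_imp_le by blast
    qed
    also have "(\<Sum>i<k. ennreal (e / (k + 1))) = ennreal (k * (e / (k + 1)))"
      using \<open>0 < e\<close> by (subst sum_ennreal) auto
    also have "k * (e / (k + 1)) \<le> e" using \<open>0 < e\<close> by (simp add: field_simps)
    finally have P: "?P t \<le> curve_length a c g + ennreal e + curve_length d b g"
      by (simp add: add_mono ennreal_leI)
    have eq: "curve_length a c g + curve_length c d g + curve_length d b g = ?L"
      using cd curve_length_additive[of a c b g] curve_length_additive[of c d b g]
      by (simp add: add.assoc)
    have ennreal_2e: "ennreal (2 * e) = ennreal e + ennreal e"
      using \<open>0 < e\<close> by (simp flip: ennreal_plus)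
    note eq
    also have "?L \<le> curve_length a c g + ennreal e + curve_length d b g + ennreal e"
      using L P by (meson add_right_mono order_trans)
    finally have "curve_length c d g + (curve_length a c g + curve_length d b g)
       \<le> ennreal (2 * e) + (curve_length a c g + curve_length d b g)"
      unfolding ennreal_2e by (simp only: add_ac)
    moreover have "curve_length a c g + curve_length d b g < top"
    proof -
      have "?L = curve_length a c g + (curve_length c d g + curve_length d b g)"
        using cd curve_length_additive[of a c b g] curve_length_additive[of c d b g] by simp
      then show ?thesis using fin by (auto simp: less_top[symmetric])
    qed
    ultimately show ?thesis
      using ennreal_add_left_cancel_le[of "curve_length a c g + curve_length d b g"]
      by (auto simp: add.commute)
  qed
  then show ?thesis using \<open>0 < \<eta>\<close> by blast
next
  case False
  then show ?thesis by (intro exI[of _ 1]) auto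
qed

definition length_upto :: "real \<Rightarrow> (real \<Rightarrow> 'a::euclidean_space) \<Rightarrow> real \<Rightarrow> real" where
  "length_upto a g t = enn2real (curve_length a t g)"

context
  fixes a b :: real and g :: "real \<Rightarrow> 'a::euclidean_space"
  assumes ab: "a \<le> b" and cont: "continuous_on {a..b} g" and fin: "curve_length a b g < \<infinity>"
begin

lemma length_upto_ennreal: "t \<in> {a..b} \<Longrightarrow> ennreal (length_upto a g t) = curve_length a t g"
proof -
  assume "t \<in> {a..b}"
  then have "curve_length a b g = curve_length a t g + curve_length t b g"
    by (intro curve_length_additive) auto
  then have "curve_length a t g < top" using fin by (auto simp: less_top[symmetric])
  then show ?thesis by (simp add: length_upto_def)
qed

lemma length_upto_diff:
  assumes "s \<in> {a..b}" "t \<in> {a..b}" "s \<le> t"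
  shows "ennreal (length_upto a g t - length_upto a g s) = curve_length s t g"
    and "length_upto a g s \<le> length_upto a g t"
proof -
  have *: "ennreal (length_upto a g t) = ennreal (length_upto a g s) + curve_length s t g"
    using curve_length_additive[of a s t g] assms by (simp add: length_upto_ennreal)
  then obtain r where r: "curve_length s t g = ennreal r" "0 \<le> r"
    by (cases "curve_length s t g") auto
  have "length_upto a g t = length_upto a g s + r"
    using * r by (simp add: length_upto_def flip: ennreal_plus del: ennreal_plus)
  then show "ennreal (length_upto a g t - length_upto a g s) = curve_length s t g"
    and "length_upto a g s \<le> length_upto a g t" using r by auto
qed

lemma dist_le_length_upto_diff:
  assumes "s \<in> {a..b}" "t \<in> {a..b}" "s \<le> t"
  shows "dist (g s) (g t) \<le> length_upto a g t - length_upto a g s"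
  using dist_le_curve_length[OF assms(3), of g] length_upto_diff(2)[OF assms]
  unfolding length_upto_diff(1)[OF assms, symmetric] by simp

lemma continuous_on_length_upto: "continuous_on {a..b} (length_upto a g)"
proof (rule uniformly_continuous_imp_continuous, unfold uniformly_continuous_on_def, intro allI impI)
  fix e :: real assume "0 < e"
  obtain d where d: "d > 0"
    "\<And>s t. a \<le> s \<Longrightarrow> s \<le> t \<Longrightarrow> t \<le> b \<Longrightarrow> t - s < d \<Longrightarrow> curve_length s t g \<le> ennreal (2 * (e / 4))"
    using curve_length_small[OF cont fin, of "e/4"] \<open>0 < e\<close> by auto
  have *: "\<bar>length_upto a g t - length_upto a g s\<bar> < e"
    if "s \<in> {a..b}" "t \<in> {a..b}" "s \<le> t" "t - s < d" for s t
  proof -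
    have "ennreal (length_upto a g t - length_upto a g s) \<le> ennreal (2 * (e / 4))"
      using d(2)[of s t] that length_upto_diff(1)[of s t] by auto
    then show ?thesis using length_upto_diff(2)[of s t] that \<open>0 < e\<close> by auto
  qed
  have "dist (length_upto a g y) (length_upto a g x) < e"
    if "x \<in> {a..b}" "y \<in> {a..b}" "dist y x < d" for x y
    using *[of x y] *[of y x] that by (cases "x \<le> y") (auto simp: dist_real_def)
  with d(1) show "\<exists>d>0. \<forall>x\<in>{a..b}. \<forall>x'\<in>{a..b}. dist x' x < d \<longrightarrow>
      dist (length_upto a g x') (length_upto a g x) < e" by blast
qed

lemma length_upto_onto:
  assumes "0 \<le> s" "s \<le> length_upto a g b"
  shows "\<exists>t\<in>{a..b}. length_upto a g t = s"
proof -
  have "\<exists>t. a \<le> t \<and> t \<le> b \<and> length_upto a g t = s"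
    using assms ab continuous_on_length_upto
    by (intro IVT') (auto simp: length_upto_def)
  then show ?thesis by auto
qed

text \<open>Whatever parameter the choice operator selects, the curve has the same value there as at \<open>t\<close>:
  between two parameters with the same length function the curve is constant.\<close>

lemma arclength_param_length_upto:
  assumes "t \<in> {a..b}"
  shows "arclength_param a b g (length_upto a g t) = g t"
proof -
  let ?P = "\<lambda>t'. t' \<in> {a..b} \<and> curve_length a t' g = ennreal (length_upto a g t)"
  define t' where "t' = (SOME t'. ?P t')"
  have "?P t" using assms length_upto_ennreal by auto
  then have "?P t'" unfolding t'_def by (rule someI)
  then have t': "t' \<in> {a..b}" "length_upto a g t' = length_upto a g t"
    by (auto simp: length_upto_def)
  have "g t' = g t"
  proof (cases "t \<le> t'")
    case True
    from dist_le_length_upto_diff[OF assms t'(1) this] show ?thesis by (simp add: t'(2))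
  next
    case False
    then have "t' \<le> t" by simp
    from dist_le_length_upto_diff[OF t'(1) assms this] show ?thesis by (simp add: t'(2))
  qed
  then show ?thesis by (simp add: arclength_param_def t'_def)
qed

lemma arclength_param_lipschitz:
  "1-lipschitz_on {0..length_upto a g b} (arclength_param a b g)"
proof (rule lipschitz_onI)
  fix x y assume xy: "x \<in> {0..length_upto a g b}" "y \<in> {0..length_upto a g b}"
  obtain s where s: "s \<in> {a..b}" "length_upto a g s = x" using xy length_upto_onto[of x] by (auto simp: Bex_def)
  obtain t where t: "t \<in> {a..b}" "length_upto a g t = y" using xy length_upto_onto[of y] by (auto simp: Bex_def)
  have "dist (g s) (g t) \<le> \<bar>y - x\<bar>"
  proof (cases "s \<le> t")
    case True
    from dist_le_length_upto_diff[OF s(1) t(1) this] show ?thesis by (simp add: s(2) t(2))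
  next
    case False
    then have "t \<le> s" by simp
    from dist_le_length_upto_diff[OF t(1) s(1) this] show ?thesis
      by (simp add: s(2) t(2) dist_commute)
  qed
  moreover have "arclength_param a b g x = g s" "arclength_param a b g y = g t"
    using arclength_param_length_upto[OF s(1)] arclength_param_length_upto[OF t(1)]
    unfolding s(2) t(2) by simp_all
  ultimately show "dist (arclength_param a b g x) (arclength_param a b g y) \<le> 1 * dist x y"
    by (simp add: dist_real_def abs_minus_commute[of x y])
qed simp

lemma arclength_param_ends:
  "arclength_param a b g 0 = g a" "arclength_param a b g (length_upto a g b) = g b"
proof -
  have "length_upto a g a = 0" by (simp add: length_upto_def)
  then show "arclength_param a b g 0 = g a"
    using arclength_param_length_upto[of a] ab by simp
  show "arclength_param a b g (length_upto a g b) = g b"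
    using ab by (intro arclength_param_length_upto) simp
qed

lemma arclength_param_image:
  assumes "0 \<le> s" "s \<le> length_upto a g b"
  shows "arclength_param a b g s \<in> g ` {a..b}"
proof -
  obtain t where t: "t \<in> {a..b}" "length_upto a g t = s" using length_upto_onto[OF assms] by blast
  have "arclength_param a b g s = g t" using arclength_param_length_upto[OF t(1)] t(2) by simp
  then show ?thesis using t(1) by simp
qed

end

section \<open>Curve integrals along Lipschitz curves\<close>

lemma borel_measurable_along_curve:
  fixes g :: "real \<Rightarrow> 'a::euclidean_space" and \<rho> :: "'a \<Rightarrow> ennreal"
  assumes "continuous_on {a..b} g" "\<rho> \<in> borel_measurable borel"
  shows "(\<lambda>t. \<rho> (g t) * indicator {a..b} t) \<in> borel_measurable borel"
proof -
  have "g \<in> borel_measurable (restrict_space borel {a..b})"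
    using assms(1) by (rule borel_measurable_continuous_on_restrict)
  then have "(\<lambda>t. \<rho> (g t)) \<in> borel_measurable (restrict_space borel {a..b})"
    using assms(2) by (rule measurable_compose)
  then show ?thesis
    by (subst (asm) borel_measurable_restrict_space_iff_ennreal) auto
qed

text \<open>A monotone \<open>M\<close>-Lipschitz map of the line expands lengths by at most \<open>M\<close>. The preimage of \<open>A\<close> is
  covered efficiently by non-overlapping intervals, and the images of these intervals cover \<open>A\<close>.\<close>

lemma emeasure_le_preimage_lipschitz:
  fixes s :: "real \<Rightarrow> real"
  assumes lip: "M-lipschitz_on {a..b} s" and mono: "mono_on {a..b} s" and "a \<le> b"
    and A: "A \<in> sets borel" "A \<subseteq> s ` {a..b}"
  shows "emeasure lborel A \<le> ennreal M * emeasure lborel {t\<in>{a..b}. s t \<in> A}"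
proof -
  have M: "0 \<le> M" using lip by (rule lipschitz_on_nonneg)
  have cont: "continuous_on {a..b} s" using lip by (rule lipschitz_on_continuous_on)
  let ?B = "{t\<in>{a..b}. s t \<in> A}"
  have B: "?B \<in> sets borel"
  proof -
    have "s \<in> borel_measurable (restrict_space borel {a..b})"
      using cont by (rule borel_measurable_continuous_on_restrict)
    then have "s -` A \<inter> space (restrict_space borel {a..b}) \<in> sets (restrict_space borel {a..b})"
      using A(1) by (rule measurable_sets)
    moreover have "s -` A \<inter> space (restrict_space borel {a..b}) = ?B"
      by (auto simp: space_restrict_space)
    ultimately show ?thesis by (simp add: sets_restrict_space_iff)
  qed
  have Bsub: "?B \<subseteq> cbox a b" by auto
  have Blm: "?B \<in> lmeasurable"
    using B Bsub by (intro bounded_set_imp_lmeasurable) (auto intro: bounded_subset[OF bounded_cbox[of a b]])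
  have *: "emeasure lborel A \<le> ennreal M * (emeasure lborel ?B + ennreal e)" if "e > 0" for e
  proof -
    obtain \<D> where \<D>: "countable \<D>"
        "\<And>K. K \<in> \<D> \<Longrightarrow> K \<subseteq> cbox a b \<and> K \<noteq> {} \<and> (\<exists>c d. K = cbox c d)"
        "pairwise (\<lambda>A B. interior A \<inter> interior B = {}) \<D>"
        "?B \<subseteq> \<Union>\<D>" "\<Union>\<D> \<in> lmeasurable" "measure lebesgue (\<Union>\<D>) \<le> measure lebesgue ?B + e"
      by (rule measurable_outer_intervals_bounded[OF Blm Bsub \<open>e > 0\<close>]) auto
    define c where "c n = (if n \<in> to_nat_on \<D> ` \<D> then from_nat_into \<D> n else {})" for n
    have c: "c n = {} \<or> c n \<in> \<D>" for n
      using \<D>(1) by (auto simp: c_def)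
    have cU: "(\<Union>n. c n) = \<Union>\<D>"
    proof
      show "(\<Union>n. c n) \<subseteq> \<Union>\<D>" using c by fastforce
      show "\<Union>\<D> \<subseteq> (\<Union>n. c n)"
      proof
        fix x assume "x \<in> \<Union>\<D>"
        then obtain K where "K \<in> \<D>" "x \<in> K" by auto
        then have "x \<in> c (to_nat_on \<D> K)" using \<D>(1) by (simp add: c_def)
        then show "x \<in> (\<Union>n. c n)" by blast
      qed
    qed
    have disj: "disjoint_family (\<lambda>n. interior (c n))"
    proof (unfold disjoint_family_on_def, intro ballI impI)
      fix m n :: nat assume "m \<noteq> n"
      show "interior (c m) \<inter> interior (c n) = {}"
      proof (cases "m \<in> to_nat_on \<D> ` \<D> \<and> n \<in> to_nat_on \<D> ` \<D>")
        case True
        then obtain K L where KL: "K \<in> \<D>" "L \<in> \<D>" "m = to_nat_on \<D> K" "n = to_nat_on \<D> L" by auto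
        then have "c m = K" "c n = L" "K \<noteq> L" using \<D>(1) \<open>m \<noteq> n\<close> by (auto simp: c_def)
        then show ?thesis using \<D>(3) KL by (auto simp: pairwise_def)
      qed (auto simp: c_def)
    qed
    have 1: "s ` c n \<in> sets borel \<and> emeasure lborel (s ` c n) \<le> ennreal M * emeasure lborel (interior (c n))" for n
    proof (cases "c n = {}")
      case False
      then have cD: "c n \<in> \<D>" using c by blast
      then obtain u v where uv: "c n = {u..v}" using \<D>(2)[OF cD] by auto
      have sub: "{u..v} \<subseteq> {a..b}" "u \<le> v" using \<D>(2)[OF cD] uv by auto
      have "compact (s ` {u..v})"
        using sub cont by (intro compact_continuous_image) (auto intro: continuous_on_subset)
      then have meas: "s ` c n \<in> sets borel" unfolding uv by (simp add: borel_compact)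
      have "s ` {u..v} \<subseteq> {s u..s v}"
        using mono sub by (auto simp: mono_on_def)
      then have "emeasure lborel (s ` {u..v}) \<le> emeasure lborel {s u..s v}"
        by (intro emeasure_mono) auto
      also have "\<dots> = ennreal (s v - s u)"
        using mono sub by (intro emeasure_lborel_Icc) (auto simp: mono_on_def)
      also have "s v - s u \<le> M * (v - u)"
        using lipschitz_onD[OF lip, of u v] sub by (auto simp: dist_real_def)
      also have "ennreal (M * (v - u)) = ennreal M * emeasure lborel {u<..<v}"
        using sub M by (simp add: ennreal_mult)
      also have "{u<..<v} = interior (c n)" using uv by (simp add: interior_atLeastAtMost_real)
      finally show ?thesis using meas uv by (simp add: ennreal_leI)
    qed auto
    have "A \<subseteq> (\<Union>n. s ` c n)"
    proof
      fix y assume "y \<in> A"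
      then obtain t where "t \<in> {a..b}" "y = s t" using A by auto
      then have "t \<in> \<Union>\<D>" using \<D>(4) \<open>y \<in> A\<close> by auto
      then obtain n where "t \<in> c n" unfolding cU[symmetric] by blast
      then show "y \<in> (\<Union>n. s ` c n)" using \<open>y = s t\<close> by blast
    qed
    then have "emeasure lborel A \<le> emeasure lborel (\<Union>n. s ` c n)"
      using 1 by (intro emeasure_mono) auto
    also have "\<dots> \<le> (\<Sum>n. emeasure lborel (s ` c n))"
      using 1 by (intro emeasure_subadditive_countably) auto
    also have "\<dots> \<le> (\<Sum>n. ennreal M * emeasure lborel (interior (c n)))"
      using 1 by (intro suminf_le) auto
    also have "\<dots> = ennreal M * (\<Sum>n. emeasure lborel (interior (c n)))"
      by (rule ennreal_suminf_cmult)
    also have "(\<Sum>n. emeasure lborel (interior (c n))) = emeasure lborel (\<Union>n. interior (c n))"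
      using disj by (intro suminf_emeasure) auto
    also have "\<dots> = emeasure lebesgue (\<Union>n. interior (c n))" by (simp add: main_part_sets)
    also have "\<dots> \<le> emeasure lebesgue (\<Union>\<D>)"
      using \<D>(5) interior_subset unfolding cU[symmetric]
      by (intro emeasure_mono) (auto simp: fmeasurable_def)
    also have "\<dots> = ennreal (measure lebesgue (\<Union>\<D>))"
      using \<D>(5) by (simp add: emeasure_eq_measure2)
    also have "\<dots> \<le> ennreal (measure lebesgue ?B + e)" using \<D>(6) by (rule ennreal_leI)
    also have "\<dots> = emeasure lebesgue ?B + ennreal e"
      using Blm that by (simp add: emeasure_eq_measure2)
    also have "emeasure lebesgue ?B = emeasure lborel ?B" using B by simp
    finally show ?thesis by (simp add: mult_left_mono)
  qed
  have fin: "emeasure lborel ?B < top"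
    using Blm B by (simp add: fmeasurable_def)
  have "emeasure lborel A \<le> ennreal M * emeasure lborel ?B + ennreal e" if "e > 0" for e
  proof -
    have "emeasure lborel A \<le> ennreal M * (emeasure lborel ?B + ennreal (e / (M + 1)))"
      using that M by (intro *) auto
    also have "\<dots> = ennreal M * emeasure lborel ?B + ennreal (M * (e / (M + 1)))"
    proof -
      have "ennreal (M * (e / (M + 1))) = ennreal M * ennreal (e / (M + 1))"
        using M that by (intro ennreal_mult) auto
      then show ?thesis by (simp only: distrib_left)
    qed
    also have "M * (e / (M + 1)) \<le> e" using M that by (simp add: field_simps)
    finally show ?thesis by (simp add: add_left_mono ennreal_leI)
  qed
  then show ?thesis by (rule ennreal_le_epsilon)
qed

text \<open>The inequality between measures of sets says that one measure lies below another, which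
  carries over to integrals.\<close>

lemma nn_integral_le_lipschitz_reparam:
  fixes s :: "real \<Rightarrow> real" and h :: "real \<Rightarrow> ennreal"
  assumes lip: "M-lipschitz_on {a..b} s" and mono: "mono_on {a..b} s" and "a \<le> b"
    and im: "s ` {a..b} = {0..L}" and h: "h \<in> borel_measurable borel"
  shows "(\<integral>\<^sup>+y\<in>{0..L}. h y \<partial>lborel) \<le> ennreal M * (\<integral>\<^sup>+t\<in>{a..b}. h (s t) \<partial>lborel)"
proof -
  define N1 where "N1 = density lborel (indicator {0..L})"
  define N2 where "N2 = scale_measure (ennreal M) (distr (restrict_space lborel {a..b}) borel s)"
  have cont: "continuous_on {a..b} s" using lip by (rule lipschitz_on_continuous_on)
  have "s \<in> borel_measurable (restrict_space borel {a..b})"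
    using cont by (rule borel_measurable_continuous_on_restrict)
  then have sm: "s \<in> measurable (restrict_space lborel {a..b}) borel"
    by (simp add: measurable_def sets_restrict_space space_restrict_space)
  have sets: "sets N1 = sets N2" by (simp add: N1_def N2_def)
  have "emeasure N1 A \<le> emeasure N2 A" if A: "A \<in> sets borel" for A
  proof -
    have "emeasure N1 A = emeasure lborel (A \<inter> {0..L})"
      using A by (simp add: N1_def emeasure_density nn_integral_set_ennreal
          indicator_inter_arith[symmetric] Int_commute)
    also have "\<dots> \<le> ennreal M * emeasure lborel {t\<in>{a..b}. s t \<in> A \<inter> {0..L}}"
      using A im by (intro emeasure_le_preimage_lipschitz[OF lip mono \<open>a \<le> b\<close>]) auto
    also have "{t\<in>{a..b}. s t \<in> A \<inter> {0..L}} = s -` A \<inter> {a..b}" using im by auto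
    also have "ennreal M * emeasure lborel \<dots> = emeasure N2 A"
      unfolding N2_def using A sm
      by (simp add: emeasure_distr space_restrict_space emeasure_restrict_space)
    finally show ?thesis .
  qed
  then have "emeasure N1 \<le> emeasure N2"
    using sets by (auto simp: le_fun_def N1_def) (metis N1_def emeasure_notin_sets order_refl sets_density sets_lborel)
  then have "N1 \<le> N2"
    using sets by (auto simp: le_measure_iff dest: sets_eq_imp_space_eq)
  then have "nn_integral N1 h \<le> nn_integral N2 h"
    using sets by (rule nn_integral_mono_measure[rotated])
  moreover have "nn_integral N1 h = (\<integral>\<^sup>+y\<in>{0..L}. h y \<partial>lborel)"
    unfolding N1_def using h by (simp add: nn_integral_density mult.commute)
  moreover have "nn_integral N2 h = ennreal M * (\<integral>\<^sup>+t\<in>{a..b}. h (s t) \<partial>lborel)"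
    unfolding N2_def using h sm
    by (simp add: nn_integral_scale_measure nn_integral_distr nn_integral_restrict_space)
  ultimately show ?thesis by simp
qed

text \<open>The length function of an \<open>M\<close>-Lipschitz curve is itself \<open>M\<close>-Lipschitz, so passing from the arc
  length parameter to the given one costs at most a factor \<open>M\<close>.\<close>

lemma segment_integral_le_lipschitz:
  fixes g :: "real \<Rightarrow> 'a::euclidean_space"
  assumes lip: "M-lipschitz_on {a..b} g" and "a \<le> b" and \<rho>: "\<rho> \<in> borel_measurable borel"
  shows "segment_integral a b g \<rho> \<le> ennreal M * (\<integral>\<^sup>+t\<in>{a..b}. \<rho> (g t) \<partial>lborel)"
proof -
  have M: "0 \<le> M" using lip by (rule lipschitz_on_nonneg)
  have cont: "continuous_on {a..b} g" using lip by (rule lipschitz_on_continuous_on)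
  have fin: "curve_length a b g < \<infinity>"
    using curve_length_lipschitz[OF lip \<open>a \<le> b\<close>] by (auto intro: le_less_trans)
  note facts = \<open>a \<le> b\<close> cont fin
  let ?s = "length_upto a g" and ?\<sigma> = "arclength_param a b g"
  let ?L = "?s b"
  have slip: "M-lipschitz_on {a..b} ?s"
  proof (rule lipschitz_on_leI)
    fix x y assume xy: "x \<in> {a..b}" "y \<in> {a..b}" "x \<le> y"
    have "ennreal (?s y - ?s x) = curve_length x y g" by (rule length_upto_diff(1)[OF facts xy])
    also have "\<dots> \<le> ennreal (M * (y - x))"
      using xy by (intro curve_length_lipschitz lipschitz_on_subset[OF lip]) auto
    finally have "?s y - ?s x \<le> M * (y - x)"
      using xy M by (subst (asm) ennreal_le_iff) auto
    then show "dist (?s x) (?s y) \<le> M * dist x y"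
      using length_upto_diff(2)[OF facts xy] xy by (simp add: dist_real_def)
  qed (rule M)
  have smono: "mono_on {a..b} ?s"
    by (rule mono_onI) (rule length_upto_diff(2)[OF facts])
  have s0: "?s a = 0" by (simp add: length_upto_def)
  have im: "?s ` {a..b} = {0..?L}"
  proof
    show "?s ` {a..b} \<subseteq> {0..?L}"
    proof
      fix y assume "y \<in> ?s ` {a..b}"
      then obtain t where t: "t \<in> {a..b}" "y = ?s t" by auto
      have "?s a \<le> ?s t" "?s t \<le> ?s b"
        using t(1) \<open>a \<le> b\<close> by (intro length_upto_diff(2)[OF facts]; simp)+
      then show "y \<in> {0..?L}" using s0 t by simp
    qed
    show "{0..?L} \<subseteq> ?s ` {a..b}"
    proof
      fix y assume "y \<in> {0..?L}"
      then have "\<exists>t\<in>{a..b}. ?s t = y" by (intro length_upto_onto[OF facts]) auto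
      then show "y \<in> ?s ` {a..b}" by blast
    qed
  qed
  define h where "h y = \<rho> (?\<sigma> y) * indicator {0..?L} y" for y
  have hm: "h \<in> borel_measurable borel"
    unfolding h_def using lipschitz_on_continuous_on[OF arclength_param_lipschitz[OF facts]] \<rho>
    by (rule borel_measurable_along_curve)
  have "segment_integral a b g \<rho> = (\<integral>\<^sup>+y\<in>{0..?L}. h y \<partial>lborel)"
    unfolding segment_integral_def h_def length_upto_def[symmetric]
    by (intro nn_integral_cong) (auto split: split_indicator)
  also have "\<dots> \<le> ennreal M * (\<integral>\<^sup>+t\<in>{a..b}. h (?s t) \<partial>lborel)"
    by (rule nn_integral_le_lipschitz_reparam[OF slip smono \<open>a \<le> b\<close> im hm])
  also have "(\<integral>\<^sup>+t\<in>{a..b}. h (?s t) \<partial>lborel) = (\<integral>\<^sup>+t\<in>{a..b}. \<rho> (g t) \<partial>lborel)"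
  proof (rule nn_integral_cong)
    fix t :: real
    show "h (?s t) * indicator {a..b} t = \<rho> (g t) * indicator {a..b} t"
    proof (cases "t \<in> {a..b}")
      case True
      then have "?s t \<in> {0..?L}" using im by blast
      then show ?thesis
        using arclength_param_length_upto[OF facts True] by (simp add: h_def)
    qed simp
  qed
  finally show ?thesis .
qed

lemma curve_integral_le_lipschitz:
  fixes g :: "real \<Rightarrow> 'a::euclidean_space"
  assumes lip: "M-lipschitz_on {a..b} g" and \<rho>: "\<rho> \<in> borel_measurable borel"
  shows "curve_integral ({a..b}, g) \<rho> \<le> ennreal M * (\<integral>\<^sup>+t\<in>{a..b}. \<rho> (g t) \<partial>lborel)"
  unfolding curve_integral.simps
proof (rule SUP_least, clarify)
  fix c d :: real assume cd: "c \<le> d" "{c..d} \<subseteq> {a..b}"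
  have "segment_integral c d g \<rho> \<le> ennreal M * (\<integral>\<^sup>+t\<in>{c..d}. \<rho> (g t) \<partial>lborel)"
    using cd \<rho> by (intro segment_integral_le_lipschitz lipschitz_on_subset[OF lip])
  also have "\<dots> \<le> ennreal M * (\<integral>\<^sup>+t\<in>{a..b}. \<rho> (g t) \<partial>lborel)"
    using cd(2) by (intro mult_left_mono nn_integral_mono) (auto split: split_indicator)
  finally show "segment_integral c d g \<rho> \<le> ennreal M * (\<integral>\<^sup>+t\<in>{a..b}. \<rho> (g t) \<partial>lborel)" .
qed

lemma segment_integral_le_curve_integral:
  "a \<le> b \<Longrightarrow> {a..b} \<subseteq> I \<Longrightarrow> segment_integral a b g \<rho> \<le> curve_integral (I, g) \<rho>"
  unfolding curve_integral.simps by (rule SUP_upper2[of "(a, b)"]) auto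

text \<open>Rectifiability matters: for a length function with jumps the arc length parametrization
  may take values of the curve outside \<open>[a,b]\<close>, on which nothing is known.\<close>

lemma segment_integral_cong:
  fixes g h :: "real \<Rightarrow> 'a::euclidean_space"
  assumes "a \<le> b" "continuous_on {a..b} g" "curve_length a b g < \<infinity>"
    and eq: "\<And>t. a \<le> t \<Longrightarrow> t \<le> b \<Longrightarrow> g t = h t"
  shows "segment_integral a b g \<rho> = segment_integral a b h \<rho>"
proof -
  have len: "curve_length a t g = curve_length a t h" if "t \<in> {a..b}" for t
    using that by (intro curve_length_cong eq) auto
  have "arclength_param a b g s = arclength_param a b h s" if s: "s \<in> {0..length_upto a g b}" for s
  proof -
    let ?P = "\<lambda>g t. t \<in> {a..b} \<and> curve_length a t g = ennreal s"
    have P: "?P h = ?P g" using len by auto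
    obtain t where t: "t \<in> {a..b}" "length_upto a g t = s"
      using length_upto_onto[OF assms(1-3), of s] s by auto
    have "?P g t" using t length_upto_ennreal[OF assms(1-3) t(1)] by simp
    then have "?P g (SOME t. ?P g t)" by (rule someI)
    then have "g (SOME t. ?P g t) = h (SOME t. ?P g t)" by (intro eq) auto
    then show ?thesis unfolding arclength_param_def P .
  qed
  then show ?thesis
    unfolding segment_integral_def length_upto_def[symmetric]
    using len[of b] \<open>a \<le> b\<close>
    by (intro nn_integral_cong) (auto simp: length_upto_def split: split_indicator)
qed

section \<open>Lifting paths under proper open discrete maps\<close>

text \<open>The space \<open>X\<close> models the pullback of an open discrete proper map along a path: over a
  parameter \<open>t\<close> lie the preimages of the point at \<open>t\<close>. A lift of the path is a section of the projection
  of \<open>X\<close> to the parameter interval.\<close>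

locale light_open_over_interval =
  fixes X :: "(real \<times> 'a::euclidean_space) set"
  assumes compact: "compact X"
    and over: "fst ` X \<subseteq> {0..1}"
    and light: "\<And>t. finite {x. (t, x) \<in> X}"
    and open_projection: "\<And>t x W. (t, x) \<in> X \<Longrightarrow> open W \<Longrightarrow> x \<in> W \<Longrightarrow>
       \<exists>\<eta>>0. \<forall>s\<in>{0..1}. \<bar>s - t\<bar> < \<eta> \<longrightarrow> (\<exists>y\<in>W. (s, y) \<in> X)"
begin

definition slice :: "real \<Rightarrow> real \<Rightarrow> (real \<times> 'a) set" where
  "slice s t = {z \<in> X. s \<le> fst z \<and> fst z \<le> t}"

lemma compact_slice: "compact (slice s t)"
proof -
  have "slice s t = X \<inter> ({s..t} \<times> UNIV)" by (auto simp: slice_def)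
  then show ?thesis using compact by (auto intro!: compact_Int_closed closed_Times)
qed

text \<open>A component over \<open>[fst z, t]\<close> that stays below \<open>t\<close> would lie in a compact, relatively open
  subset below \<open>t\<close>, whose highest point contradicts openness of the projection.\<close>

lemma component_reaches_end:
  assumes z: "z \<in> X" and "fst z \<le> t" "t \<le> 1"
  shows "\<exists>w. fst w = t \<and> connected_component (slice (fst z) t) z w"
proof (rule ccontr)
  assume no: "\<not> ?thesis"
  let ?S = "slice (fst z) t"
  let ?C = "connected_component_set ?S z"
  have zS: "z \<in> ?S" using assms by (auto simp: slice_def)
  have comp: "?C \<in> components ?S" using zS by (auto simp: components_def)
  have "compact ?C" using comp compact_slice compact_components by blast
  have sub: "?C \<subseteq> {..<t} \<times> UNIV"
  proof
    fix w assume w: "w \<in> ?C"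
    then have "w \<in> ?S" using connected_component_in by force
    then have "fst w \<le> t" by (auto simp: slice_def)
    moreover have "fst w \<noteq> t" using no w by blast
    ultimately show "w \<in> {..<t} \<times> UNIV" by (simp add: mem_Times_iff)
  qed
  have "locally compact ?S" using compact_slice by (intro closed_imp_locally_compact compact_imp_closed)
  then obtain K where K: "openin (top_of_set ?S) K" "compact K" "?C \<subseteq> K" "K \<subseteq> {..<t} \<times> UNIV"
    using Sura_Bura_clopen_subset[OF _ comp \<open>compact ?C\<close> _ sub] by (metis open_Times open_UNIV open_lessThan)
  have "z \<in> K" using K zS by (auto simp: connected_component_refl_eq)
  obtain w where w: "w \<in> K" "\<And>v. v \<in> K \<Longrightarrow> fst v \<le> fst w"
  proof -
    have "\<exists>w\<in>K. \<forall>v\<in>K. fst v \<le> fst w"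
      using \<open>compact K\<close> \<open>z \<in> K\<close> by (intro continuous_attains_sup continuous_intros) auto
    then show ?thesis using that by blast
  qed
  have wt: "fst w < t" using K w by auto
  have wS: "w \<in> ?S" using K(1) w(1) openin_imp_subset by blast
  obtain T where T: "open T" "K = ?S \<inter> T" using K(1) openin_open by metis
  obtain A B where AB: "open A" "open B" "w \<in> A \<times> B" "A \<times> B \<subseteq> T"
    using open_prod_elim[OF T(1)] w(1) T(2) by blast
  obtain e where e: "e > 0" "ball (fst w) e \<subseteq> A" using AB by (metis mem_Times_iff open_contains_ball)
  have "(fst w, snd w) \<in> X" using wS by (simp add: slice_def)
  then obtain \<eta> where \<eta>: "\<eta> > 0" "\<forall>s\<in>{0..1}. \<bar>s - fst w\<bar> < \<eta> \<longrightarrow> (\<exists>y\<in>B. (s, y) \<in> X)"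
    using open_projection AB by (metis mem_Times_iff)
  define d where "d = min (min e \<eta>) (t - fst w) / 2"
  have d: "d > 0" "d < e" "d < \<eta>" "d < t - fst w" using e \<eta> wt by (auto simp: d_def)
  have "0 \<le> fst w" using over wS by (auto simp: slice_def)
  then obtain y where y: "y \<in> B" "(fst w + d, y) \<in> X"
    using \<eta>(2) d \<open>t \<le> 1\<close> by (auto dest!: bspec[of _ _ "fst w + d"])
  have "fst w + d \<in> A" using d e by (auto simp: dist_real_def)
  then have "(fst w + d, y) \<in> T" using AB y by blast
  moreover have "(fst w + d, y) \<in> ?S" using y d wS by (auto simp: slice_def)
  ultimately show False using w(2)[of "(fst w + d, y)"] T d by auto
qed

text \<open>A fibre is finite, hence near it \<open>X\<close> splits into small separate clusters; compactness of the
  parameter interval makes the estimate uniform.\<close>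

lemma small_components:
  assumes "e > 0"
  shows "\<exists>d>0. \<forall>s t z w. t - s < d \<longrightarrow> connected_component (slice s t) z w \<longrightarrow> dist (snd z) (snd w) < e"
proof -
  have local: "\<exists>\<eta>>0. \<forall>C. connected C \<longrightarrow> C \<subseteq> X \<longrightarrow> fst ` C \<subseteq> ball t \<eta> \<longrightarrow>
      (\<forall>z\<in>C. \<forall>w\<in>C. dist (snd z) (snd w) < e)" for t
  proof -
    define F where "F = {x. (t, x) \<in> X}"
    have "uniform_discrete F" using light[of t] uniform_discrete_finite_iff[of F] by (simp add: F_def)
    then obtain r0 where r0: "r0 > 0" "\<And>x y. x \<in> F \<Longrightarrow> y \<in> F \<Longrightarrow> dist x y < r0 \<Longrightarrow> x = y"
      unfolding uniform_discrete_def by blast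
    define r where "r = min r0 e / 2"
    have r: "r > 0" "2 * r \<le> e" "2 * r \<le> r0" using r0 assms by (auto simp: r_def)
    have disj: "ball x r \<inter> ball y r = {}" if "x \<in> F" "y \<in> F" "x \<noteq> y" for x y
    proof (rule ccontr)
      assume "ball x r \<inter> ball y r \<noteq> {}"
      then obtain v where "dist x v < r" "dist y v < r" by auto
      then have "dist x y < r0" using r dist_triangle2[of x y v] by linarith
      then show False using r0 that by blast
    qed
    let ?N = "UNIV \<times> (\<Union>x\<in>F. ball x r) :: (real \<times> 'a) set"
    have "closed (fst ` (X - ?N))"
      by (intro compact_imp_closed compact_continuous_image compact_diff[OF compact] open_Times open_UN)
        (auto intro: continuous_intros)
    moreover have "t \<notin> fst ` (X - ?N)" using r by (auto simp: F_def)
    ultimately obtain \<eta> where \<eta>: "\<eta> > 0" "ball t \<eta> \<subseteq> - fst ` (X - ?N)"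
      by (metis ComplI open_Compl open_contains_ball)
    have "dist (snd z) (snd w) < e"
      if C: "connected C" "C \<subseteq> X" "fst ` C \<subseteq> ball t \<eta>" "z \<in> C" "w \<in> C" for C z w
    proof -
      have CN: "C \<subseteq> ?N" using C \<eta>(2) by blast
      then obtain x where x: "x \<in> F" "snd z \<in> ball x r" using C(4) by (auto simp: mem_Times_iff)
      let ?A = "UNIV \<times> ball x r :: (real \<times> 'a) set"
      let ?B = "UNIV \<times> (\<Union>y\<in>F - {x}. ball y r) :: (real \<times> 'a) set"
      have "?B \<inter> C = {}"
      proof (rule ccontr)
        assume "?B \<inter> C \<noteq> {}"
        moreover have "?A \<inter> C \<noteq> {}" using x C(4) by (auto simp: mem_Times_iff)
        moreover have "open ?A" "open ?B" by (auto intro!: open_Times)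
        moreover have "C \<subseteq> ?A \<union> ?B" using CN by auto
        moreover have "?A \<inter> ?B \<inter> C = {}" using disj[of x] x(1) by auto
        ultimately show False using C(1) unfolding connected_def by blast
      qed
      then have "w \<in> ?A" using CN C(5) by auto
      then have "dist x (snd w) < r" "dist x (snd z) < r" using x by (auto simp: mem_Times_iff)
      then show ?thesis using r dist_triangle3[of "snd z" "snd w" x] by linarith
    qed
    then show ?thesis using \<eta>(1) by blast
  qed
  define \<G> where "\<G> = {ball t \<eta> | t \<eta>. \<eta> > 0 \<and> (\<forall>C. connected C \<longrightarrow> C \<subseteq> X \<longrightarrow> fst ` C \<subseteq> ball t \<eta> \<longrightarrow>
      (\<forall>z\<in>C. \<forall>w\<in>C. dist (snd z) (snd w) < e))}"
  have "{0..1} \<subseteq> \<Union>\<G>"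
  proof
    fix t :: real assume "t \<in> {0..1}"
    from local[of t] obtain \<eta> where "\<eta> > 0" "ball t \<eta> \<in> \<G>" unfolding \<G>_def by blast
    then show "t \<in> \<Union>\<G>" by (meson UnionI centre_in_ball)
  qed
  moreover have "\<And>G. G \<in> \<G> \<Longrightarrow> open G" by (auto simp: \<G>_def)
  ultimately have "\<exists>d>0. \<forall>x\<in>{0..1}. \<exists>G\<in>\<G>. ball x d \<subseteq> G"
    by (metis Heine_Borel_lemma compact_Icc)
  then obtain d where d: "d > 0" "\<And>x. x \<in> {0..1} \<Longrightarrow> \<exists>G\<in>\<G>. ball x d \<subseteq> G" by blast
  have "dist (snd z) (snd w) < e" if st: "t - s < d" "connected_component (slice s t) z w" for s t z w
  proof -
    obtain C where C: "connected C" "C \<subseteq> slice s t" "z \<in> C" "w \<in> C"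
      using st(2) by (auto simp: connected_component_def)
    then have "z \<in> slice s t" by blast
    then have z: "fst z \<in> {0..1}" "s \<le> fst z" "fst z \<le> t" using over by (auto simp: slice_def)
    then obtain G where G: "G \<in> \<G>" "ball (fst z) d \<subseteq> G" using d by blast
    have "fst ` C \<subseteq> ball (fst z) d"
      using C(2) z st(1) by (auto simp: slice_def dist_real_def)
    moreover have "C \<subseteq> X" using C by (auto simp: slice_def)
    ultimately show ?thesis using G C unfolding \<G>_def by blast
  qed
  then show ?thesis using d(1) by blast
qed

lemma chain_of_components:
  assumes "(0, x0) \<in> X"
  shows "\<exists>g :: nat \<Rightarrow> real \<times> 'a. g 0 = (0, x0) \<and> (\<forall>i\<le>2^k. fst (g i) = i / 2^k \<and> g i \<in> X) \<and>
     (\<forall>i j. i \<le> j \<and> j \<le> 2^k \<longrightarrow> connected_component (slice (i / 2^k) (j / 2^k)) (g i) (g j))"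
proof -
  let ?P = "\<lambda>i z. (i = 0 \<longrightarrow> z = (0, x0)) \<and> (i \<le> 2^k \<longrightarrow> fst z = real i / 2^k \<and> z \<in> X)"
  let ?Q = "\<lambda>i z w. Suc i \<le> 2^k \<longrightarrow> connected_component (slice (real i / 2^k) (real (Suc i) / 2^k)) z w"
  have "\<exists>g. \<forall>i. ?P i (g i) \<and> ?Q i (g i) (g (Suc i))"
  proof (rule dependent_nat_choice)
    show "\<exists>z. ?P 0 z" using assms by (intro exI[of _ "(0, x0)"]) simp
    fix z i assume P: "?P i z"
    show "\<exists>w. ?P (Suc i) w \<and> ?Q i z w"
    proof (cases "Suc i \<le> 2^k")
      case True
      then have z: "fst z = real i / 2^k" "z \<in> X" using P by auto
      have "real (Suc i) \<le> 2^k" using True by (metis of_nat_le_iff of_nat_numeral of_nat_power)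
      then have "fst z \<le> real (Suc i) / 2^k" "real (Suc i) / 2^k \<le> 1" using z by (auto simp: field_simps)
      then obtain w where w: "fst w = real (Suc i) / 2^k"
        "connected_component (slice (fst z) (real (Suc i) / 2^k)) z w"
        using component_reaches_end[OF z(2)] by blast
      then have "w \<in> X" using connected_component_in by (fastforce simp: slice_def)
      then show ?thesis using w z by (intro exI[of _ w]) simp
    qed simp
  qed
  then obtain g where g: "\<And>i. ?P i (g i)" "\<And>i. ?Q i (g i) (g (Suc i))" by blast
  have "connected_component (slice (i / 2^k) (j / 2^k)) (g i) (g j)" if "i \<le> j" "j \<le> 2^k" for i j
    using that
  proof (induction j rule: dec_induct)
    case base
    then show ?case using g(1)[of i] by (simp add: connected_component_refl_eq slice_def)
  next
    case (step j)
    then have "connected_component (slice (i / 2^k) (j / 2^k)) (g i) (g j)" by simp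
    then have "connected_component (slice (i / 2^k) (Suc j / 2^k)) (g i) (g j)"
      by (rule connected_component_of_subset) (auto simp: slice_def divide_right_mono intro: order_trans)
    moreover have "connected_component (slice (j / 2^k) (Suc j / 2^k)) (g j) (g (Suc j))"
      using g(2)[of j] step by simp
    then have "connected_component (slice (i / 2^k) (Suc j / 2^k)) (g j) (g (Suc j))"
      by (rule connected_component_of_subset)
        (use step(1) in \<open>auto simp: slice_def divide_right_mono intro: order_trans[of _ "real j / 2^k"]\<close>)
    ultimately show ?case by (rule connected_component_trans)
  qed
  then show ?thesis using g(1) by (intro exI[of _ g]) auto
qed

text \<open>Chains of components over finer and finer dyadic partitions give approximate sections. As the
  components over neighbouring intervals hang together, points of a chain over \<open>s\<close> and \<open>t\<close> lie in one component
  over \<open>[s,t]\<close>, so smallness of components yields equicontinuity, and a subsequence converges.\<close>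

theorem section_through_point:
  assumes x0: "(0, x0) \<in> X"
  shows "\<exists>\<gamma>. continuous_on {0..1} \<gamma> \<and> \<gamma> 0 = x0 \<and> (\<forall>t\<in>{0..1}. (t, \<gamma> t) \<in> X)"
proof -
  have "\<forall>k. \<exists>g :: nat \<Rightarrow> real \<times> 'a. g 0 = (0, x0) \<and> (\<forall>i\<le>2^k. fst (g i) = i / 2^k \<and> g i \<in> X) \<and>
     (\<forall>i j. i \<le> j \<and> j \<le> 2^k \<longrightarrow> connected_component (slice (i / 2^k) (j / 2^k)) (g i) (g j))"
    using chain_of_components[OF x0] by blast
  from choice[OF this] obtain g :: "nat \<Rightarrow> nat \<Rightarrow> real \<times> 'a"
    where g: "\<And>k. g k 0 = (0, x0)" "\<And>k i. i \<le> 2^k \<Longrightarrow> fst (g k i) = real i / 2^k \<and> g k i \<in> X"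
    "\<And>k i j. i \<le> j \<Longrightarrow> j \<le> 2^k \<Longrightarrow>
       connected_component (slice (real i / 2^k) (real j / 2^k)) (g k i) (g k j)"
    by blast
  \<comment> \<open>\<open>G k\<close> is the \<open>k\<close>-th approximate section; it lies exactly over \<open>q\<close> once \<open>q\<close> is a multiple of \<open>1 / 2^k\<close>.\<close>
  define G where "G k q = g k (nat \<lfloor>q * 2^k\<rfloor>)" for k and q :: real
  define S where "S = (\<Union>m. (\<lambda>i::nat. real i / 2^m) ` {..2^m})"
  have S01: "S \<subseteq> {0..1}"
  proof -
    have "real i \<le> 2^m" if "i \<le> 2^m" for i m :: nat
      using that by (metis of_nat_le_iff of_nat_numeral of_nat_power)
    then show ?thesis by (auto simp: S_def field_simps)
  qed
  have idx: "nat \<lfloor>q * 2^k\<rfloor> \<le> 2^k" if "q \<in> {0..1}" for q :: real and k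
  proof -
    have "q * 2^k \<le> 2^k" using that by (simp add: mult_left_le_one_le)
    then have "q * 2^k < 2^k + 1" by linarith
    then have "\<lfloor>q * 2^k\<rfloor> \<le> 2^k" by (simp only: floor_le_iff of_int_power of_int_numeral)
    then show ?thesis by (simp add: nat_le_iff)
  qed
  have exact: "real (nat \<lfloor>q * 2^k\<rfloor>) / 2^k = q" if q: "q = real i / 2^m" and "m \<le> k" for q i k m
  proof -
    have "(2::real)^k = 2^m * 2^(k - m)" using \<open>m \<le> k\<close> by (simp flip: power_add)
    then have "q * 2^k = real (i * 2^(k - m))" by (simp add: q)
    then have "\<lfloor>q * 2^k\<rfloor> = int (i * 2^(k - m))" by (metis floor_of_nat)
    then have "real (nat \<lfloor>q * 2^k\<rfloor>) = q * 2^k" using \<open>q * 2^k = real (i * 2^(k - m))\<close> by simp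
    then show ?thesis by simp
  qed
  have eventually_exact: "\<exists>m. \<forall>k\<ge>m. real (nat \<lfloor>q * 2^k\<rfloor>) / 2^k = q" if "q \<in> S" for q
    using that exact unfolding S_def by blast
  have GX: "G k q \<in> X" if "q \<in> {0..1}" for k q using g(2)[OF idx[OF that]] by (simp add: G_def)
  have "bounded (snd ` X)"
    using compact by (intro compact_imp_bounded compact_continuous_image continuous_intros)
  then obtain M where "\<And>x. x \<in> snd ` X \<Longrightarrow> norm x \<le> M" by (auto simp: bounded_iff)
  then have M: "norm (snd (G k q)) \<le> M" if "q \<in> S" for k q using GX S01 that by blast
  have "countable S" by (auto simp: S_def)
  then obtain \<kappa> where \<kappa>: "strict_mono (\<kappa>::nat\<Rightarrow>nat)"
      "\<And>q. q \<in> S \<Longrightarrow> \<exists>l. (\<lambda>n. snd (G (\<kappa> n) q)) \<longlonglongrightarrow> l"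
    using function_convergent_subsequence[of S "\<lambda>k q. snd (G k q)" M] M by blast
  then obtain l where l: "\<And>q. q \<in> S \<Longrightarrow> (\<lambda>n. snd (G (\<kappa> n) q)) \<longlonglongrightarrow> l q" by metis
  have \<kappa>_large: "\<forall>\<^sub>F n in sequentially. m \<le> \<kappa> n" for m
    using filterlim_subseq[OF \<kappa>(1)] by (simp add: filterlim_at_top)
  have lX: "(q, l q) \<in> X" if "q \<in> S" for q
  proof -
    obtain m where m: "\<forall>k\<ge>m. real (nat \<lfloor>q * 2^k\<rfloor>) / 2^k = q" using eventually_exact[OF \<open>q \<in> S\<close>] by blast
    have "\<forall>\<^sub>F n in sequentially. G (\<kappa> n) q = (q, snd (G (\<kappa> n) q))"
      using \<kappa>_large[of m]
    proof eventually_elim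
      case (elim n)
      then have "fst (G (\<kappa> n) q) = q" using m g(2)[OF idx, of q "\<kappa> n"] S01 that by (auto simp: G_def)
      then show ?case by (metis prod.collapse)
    qed
    then have ev: "\<forall>\<^sub>F n in sequentially. (q, snd (G (\<kappa> n) q)) \<in> X"
      by eventually_elim (metis GX S01 that subsetD)
    have "(\<lambda>n. (q, snd (G (\<kappa> n) q))) \<longlonglongrightarrow> (q, l q)"
      by (intro tendsto_intros l that)
    then show ?thesis
      using ev compact_imp_closed[OF compact] by (intro Lim_in_closed_set[of X]) auto
  qed
  have close: "dist (l q) (l q') \<le> e"
    if d: "\<forall>s t z w. t - s < d \<longrightarrow> connected_component (slice s t) z w \<longrightarrow> dist (snd z) (snd w) < e"
      and q: "q \<in> S" "q' \<in> S" "q \<le> q'" "q' - q < d" for d e q q'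
  proof -
    obtain m where m: "\<forall>k\<ge>m. real (nat \<lfloor>q * 2^k\<rfloor>) / 2^k = q" using eventually_exact[OF q(1)] by blast
    obtain m' where m': "\<forall>k\<ge>m'. real (nat \<lfloor>q' * 2^k\<rfloor>) / 2^k = q'" using eventually_exact[OF q(2)] by blast
    have "\<forall>\<^sub>F n in sequentially. dist (snd (G (\<kappa> n) q)) (snd (G (\<kappa> n) q')) \<le> e"
      using \<kappa>_large[of m] \<kappa>_large[of m']
    proof eventually_elim
      case (elim n)
      have "nat \<lfloor>q * 2 ^ \<kappa> n\<rfloor> \<le> nat \<lfloor>q' * 2 ^ \<kappa> n\<rfloor>"
        using q(3) by (intro nat_mono floor_mono) simp
      moreover have "nat \<lfloor>q' * 2 ^ \<kappa> n\<rfloor> \<le> 2 ^ \<kappa> n" using idx q(2) S01 by blast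
      ultimately have "connected_component (slice q q') (G (\<kappa> n) q) (G (\<kappa> n) q')"
        using g(3)[of "nat \<lfloor>q * 2 ^ \<kappa> n\<rfloor>" "nat \<lfloor>q' * 2 ^ \<kappa> n\<rfloor>" "\<kappa> n"] m m' elim by (simp add: G_def)
      then show ?case using d q(4) by (meson less_imp_le)
    qed
    moreover have "(\<lambda>n. dist (snd (G (\<kappa> n) q)) (snd (G (\<kappa> n) q'))) \<longlonglongrightarrow> dist (l q) (l q')"
      by (intro tendsto_intros l q)
    ultimately show ?thesis by (intro tendsto_upperbound[of _ "dist (l q) (l q')"]) auto
  qed
  have "uniformly_continuous_on S l"
    unfolding uniformly_continuous_on_def
  proof (intro allI impI)
    fix e :: real assume "e > 0"
    then obtain d where d: "d > 0" "\<forall>s t z w. t - s < d \<longrightarrow> connected_component (slice s t) z w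
        \<longrightarrow> dist (snd z) (snd w) < e / 2"
      using small_components[of "e / 2"] by auto
    have "dist (l q') (l q) < e" if "q \<in> S" "q' \<in> S" "dist q' q < d" for q q'
    proof (cases "q \<le> q'")
      case True
      then have "dist (l q) (l q') \<le> e / 2" using that by (intro close[OF d(2)]) (auto simp: dist_real_def)
      then show ?thesis using \<open>e > 0\<close> by (simp add: dist_commute)
    next
      case False
      then have "dist (l q') (l q) \<le> e / 2" using that by (intro close[OF d(2)]) (auto simp: dist_real_def)
      then show ?thesis using \<open>e > 0\<close> by simp
    qed
    then show "\<exists>d>0. \<forall>x\<in>S. \<forall>x'\<in>S. dist x' x < d \<longrightarrow> dist (l x') (l x) < e" using d(1) by blast
  qed
  then obtain \<gamma> where \<gamma>: "uniformly_continuous_on (closure S) \<gamma>" "\<And>x. x \<in> S \<Longrightarrow> l x = \<gamma> x"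
    using uniformly_continuous_on_extension_on_closure by metis
  have clS: "{0..1} \<subseteq> closure S"
  proof
    fix t :: real assume t: "t \<in> {0..1}"
    show "t \<in> closure S"
      unfolding closure_approachable
    proof (intro allI impI)
      fix e :: real assume "e > 0"
      then obtain m where m: "(1/2::real) ^ m < e" using real_arch_pow_inv[of e "1/2"] by auto
      let ?i = "nat \<lfloor>t * 2^m\<rfloor>"
      have "real ?i = of_int \<lfloor>t * 2^m\<rfloor>" using t by simp
      then have "real ?i \<le> t * 2^m" "t * 2^m < real ?i + 1" by linarith+
      then have "real ?i / 2^m \<le> t" "t < real ?i / 2^m + (1/2)^m"
        by (auto simp: field_simps power_divide)
      then have "dist (real ?i / 2^m) t < e" using m by (simp add: dist_real_def)
      moreover have "real ?i / 2^m \<in> S" using idx[OF t, of m] unfolding S_def by blast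
      ultimately show "\<exists>y\<in>S. dist y t < e" by blast
    qed
  qed
  have cont: "continuous_on (closure S) \<gamma>" using \<gamma>(1) by (rule uniformly_continuous_imp_continuous)
  have "(\<lambda>t. (t, \<gamma> t)) ` closure S \<subseteq> X"
  proof (rule image_closure_subset)
    show "continuous_on (closure S) (\<lambda>t. (t, \<gamma> t))" by (intro continuous_intros cont)
    show "closed X" using compact by (rule compact_imp_closed)
    show "(\<lambda>t. (t, \<gamma> t)) ` S \<subseteq> X" using lX \<gamma>(2) by auto
  qed
  moreover have "\<gamma> 0 = x0"
  proof -
    have "0 \<in> S" unfolding S_def by (auto intro!: exI[of _ 0] image_eqI[of _ _ 0])
    moreover have "(\<lambda>n. snd (G (\<kappa> n) 0)) = (\<lambda>n. x0)" by (simp add: G_def g(1))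
    ultimately have "(\<lambda>n. x0) \<longlonglongrightarrow> l 0" using l[of 0] by simp
    then have "l 0 = x0" by (simp add: LIMSEQ_const_iff)
    then show ?thesis using \<gamma>(2) \<open>0 \<in> S\<close> by simp
  qed
  ultimately show ?thesis
    using clS continuous_on_subset[OF cont clS] by (intro exI[of _ \<gamma>]) auto
qed

end

text \<open>Openness of the projection of the pullback is inherited from \<open>f\<close>, compactness from properness,
  and discrete compact fibres are finite.\<close>

theorem path_lifting:
  fixes f :: "'a::euclidean_space \<Rightarrow> 'a" and \<beta> :: "real \<Rightarrow> 'a"
  assumes "open D" and contf: "continuous_on D f" and opf: "open_mapping_on D f"
    and disc: "discrete_mapping_on D f"
    and proper: "\<And>K. compact K \<Longrightarrow> K \<subseteq> f ` D \<Longrightarrow> compact {x \<in> D. f x \<in> K}"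
    and "a < b" and cont\<beta>: "continuous_on {a..b} \<beta>" and im\<beta>: "\<beta> ` {a..b} \<subseteq> f ` D"
    and x0: "x0 \<in> D" "f x0 = \<beta> a"
  obtains \<gamma> where "continuous_on {a..b} \<gamma>" "\<gamma> a = x0" "\<gamma> ` {a..b} \<subseteq> D"
    "\<And>t. t \<in> {a..b} \<Longrightarrow> f (\<gamma> t) = \<beta> t"
proof -
  define \<alpha> where "\<alpha> t = \<beta> (a + t * (b - a))" for t
  have map: "a + t * (b - a) \<in> {a..b}" if "t \<in> {0..1}" for t
  proof -
    have "0 \<le> t * (b - a)" "t * (b - a) \<le> 1 * (b - a)"
      using that \<open>a < b\<close> by (auto intro: mult_right_mono)
    then show ?thesis by simp
  qed
  have cont\<alpha>: "continuous_on {0..1} \<alpha>"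
    unfolding \<alpha>_def using map by (intro continuous_on_compose2[OF cont\<beta>] continuous_intros) auto
  have im\<alpha>: "\<alpha> ` {0..1} \<subseteq> f ` D" using map im\<beta> by (auto simp: \<alpha>_def)
  define P where "P = {x \<in> D. f x \<in> \<alpha> ` {0..1}}"
  have "compact P" unfolding P_def using cont\<alpha> im\<alpha> by (intro proper compact_continuous_image) auto
  have "P \<subseteq> D" by (auto simp: P_def)
  define X where "X = {z \<in> {0..1} \<times> P. f (snd z) - \<alpha> (fst z) = 0}"
  have XI: "(t, x) \<in> X \<longleftrightarrow> t \<in> {0..1} \<and> x \<in> D \<and> f x = \<alpha> t" for t x
    by (auto simp: X_def P_def)
  interpret light_open_over_interval X
  proof
    have "continuous_on ({0..1} \<times> P) (\<lambda>z. f (snd z) - \<alpha> (fst z))"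
      using \<open>P \<subseteq> D\<close>
      by (intro continuous_intros continuous_on_compose2[OF contf] continuous_on_compose2[OF cont\<alpha>]) auto
    moreover have "compact ({0..1::real} \<times> P)" using \<open>compact P\<close> by (intro compact_Times) auto
    ultimately have "closed X"
      unfolding X_def by (intro continuous_closed_preimage_constant) (auto intro: compact_imp_closed)
    moreover have "X = ({0..1} \<times> P) \<inter> X" by (auto simp: X_def)
    ultimately show "compact X" using \<open>compact ({0..1} \<times> P)\<close> by (metis compact_Int_closed)
    show "fst ` X \<subseteq> {0..1}" by (auto simp: X_def)
    show "finite {x. (t, x) \<in> X}" for t
    proof (cases "t \<in> {0..1}")
      case True
      then have "{x. (t, x) \<in> X} = {x \<in> D. f x \<in> {\<alpha> t}}" by (auto simp: XI)
      moreover have "compact {x \<in> D. f x \<in> {\<alpha> t}}" using True im\<alpha> by (intro proper) auto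
      moreover have "discrete {x \<in> D. f x = \<alpha> t}" using disc by (simp add: discrete_mapping_on_def)
      ultimately show ?thesis using discrete_compact_finite_iff[of "{x \<in> D. f x = \<alpha> t}"] by simp
    qed (simp add: XI)
    show "\<exists>\<eta>>0. \<forall>s\<in>{0..1}. \<bar>s - t\<bar> < \<eta> \<longrightarrow> (\<exists>y\<in>W. (s, y) \<in> X)"
      if tx: "(t, x) \<in> X" "open W" "x \<in> W" for t x W
    proof -
      have "open (f ` (W \<inter> D))" using opf \<open>open D\<close> tx(2) by (auto simp: open_mapping_on_def)
      moreover have "\<alpha> t \<in> f ` (W \<inter> D)" "t \<in> {0..1}" using tx by (auto simp: XI intro!: image_eqI[of _ f x])
      ultimately obtain e where e: "e > 0" "ball (\<alpha> t) e \<subseteq> f ` (W \<inter> D)"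
        by (metis open_contains_ball)
      obtain \<eta> where "\<eta> > 0" "\<forall>s\<in>{0..1}. dist s t < \<eta> \<longrightarrow> dist (\<alpha> s) (\<alpha> t) < e"
        using cont\<alpha> \<open>t \<in> {0..1}\<close> e(1) unfolding continuous_on_iff by blast
      moreover have "\<exists>y\<in>W. (s, y) \<in> X" if "s \<in> {0..1}" "dist (\<alpha> s) (\<alpha> t) < e" for s
      proof -
        have "\<alpha> s \<in> f ` (W \<inter> D)" using that e(2) by (auto simp: dist_commute)
        then show ?thesis using that by (auto simp: XI)
      qed
      ultimately show ?thesis by (auto simp: dist_real_def)
    qed
  qed
  have "(0, x0) \<in> X" using x0 by (simp add: XI \<alpha>_def)
  then obtain \<delta> where \<delta>: "continuous_on {0..1} \<delta>" "\<delta> 0 = x0" "\<forall>t\<in>{0..1}. (t, \<delta> t) \<in> X"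
    using section_through_point by blast
  define \<gamma> where "\<gamma> t = \<delta> ((t - a) / (b - a))" for t
  have inv: "(t - a) / (b - a) \<in> {0..1}" if "t \<in> {a..b}" for t
    using that \<open>a < b\<close> by (auto simp: divide_simps)
  show ?thesis
  proof
    show "continuous_on {a..b} \<gamma>"
      unfolding \<gamma>_def using inv \<open>a < b\<close>
      by (intro continuous_on_compose2[OF \<delta>(1)] continuous_intros) auto
    show "\<gamma> a = x0" using \<delta>(2) by (simp add: \<gamma>_def)
    show "\<gamma> ` {a..b} \<subseteq> D" using \<delta>(3) inv by (auto simp: \<gamma>_def XI)
    show "f (\<gamma> t) = \<beta> t" if "t \<in> {a..b}" for t
      using \<delta>(3) inv[OF that] \<open>a < b\<close> by (auto simp: \<gamma>_def XI \<alpha>_def)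
  qed
qed

section \<open>Powers of extended nonnegative numbers\<close>

lemma epowr_ennreal: "0 \<le> x \<Longrightarrow> epowr (ennreal x) p = ennreal (x powr p)"
  by (simp add: epowr_def)

lemma epowr_top [simp]: "epowr top p = top"
  by (simp add: epowr_def)

lemma borel_measurable_epowr [measurable]:
  assumes [measurable]: "f \<in> borel_measurable M"
  shows "(\<lambda>x. epowr (f x) p) \<in> borel_measurable M"
  unfolding epowr_def by measurable

section \<open>The Poincare inequality bounds diameters by energy\<close>

abbreviation energy :: "real \<Rightarrow> ('a::euclidean_space \<Rightarrow> ennreal) \<Rightarrow> 'a set \<Rightarrow> ennreal" where
  "energy p g A \<equiv> \<integral>\<^sup>+z\<in>A. epowr (g z) p \<partial>lebesgue"

lemma set_integrable_bounded_continuous: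
  fixes u :: "'a::euclidean_space \<Rightarrow> real"
  assumes "open B" "bounded B" "continuous_on B u" "\<And>x. x \<in> B \<Longrightarrow> \<bar>u x\<bar> \<le> M"
  shows "set_integrable lebesgue B u"
  unfolding set_integrable_def
proof (rule integrableI_bounded_set[where A = B and B = M])
  have "(\<lambda>x. indicator B x *\<^sub>R u x) \<in> borel_measurable borel"
    using assms by (intro borel_measurable_continuous_on_indicator) auto
  then show "(\<lambda>x. indicator B x *\<^sub>R u x) \<in> borel_measurable lebesgue"
    by (intro measurable_completion) simp
  have "B \<in> lmeasurable" using assms by (intro lmeasurable_open)
  then show "B \<in> sets lebesgue" "emeasure lebesgue B < \<infinity>" by (auto simp: fmeasurable_def)
  show "AE x in lebesgue. x \<in> B \<longrightarrow> norm (indicator B x *\<^sub>R u x) \<le> M"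
    using assms(4) by (intro AE_I2) auto
qed auto

lemma mean_value_deviation:
  fixes u :: "'a::euclidean_space \<Rightarrow> real"
  assumes B: "open B" "bounded B" "continuous_on B u" "\<And>x. x \<in> B \<Longrightarrow> \<bar>u x\<bar> \<le> M"
    and B': "open B'" "B' \<subseteq> B" "measure lebesgue B' > 0"
  shows "\<bar>mean_value B' u - a\<bar> \<le>
    measure lebesgue B / measure lebesgue B' * mean_value B (\<lambda>z. \<bar>u z - a\<bar>)"
proof -
  have "B' \<in> lmeasurable" using B B' by (intro lmeasurable_open) (auto intro: bounded_subset)
  have "B \<in> lmeasurable" using B by (intro lmeasurable_open)
  have mB: "measure lebesgue B > 0"
    using measure_mono_fmeasurable[OF B'(2) _ \<open>B \<in> lmeasurable\<close>] B' \<open>B' \<in> lmeasurable\<close>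
    by (auto simp: fmeasurable_def)
  have iB: "set_integrable lebesgue B (\<lambda>z. u z - a)"
    using B by (intro set_integrable_bounded_continuous[where M = "M + \<bar>a\<bar>"] continuous_intros)
      (auto intro!: order_trans[OF abs_triangle_ineq4] add_right_mono)
  have iB': "set_integrable lebesgue B' (\<lambda>z. u z - a)"
    using iB \<open>B' \<in> lmeasurable\<close> B'(2) by (intro set_integrable_subset[OF iB]) auto
  have iu': "set_integrable lebesgue B' u"
    using B B' by (intro set_integrable_bounded_continuous[where M = M])
      (auto intro: bounded_subset continuous_on_subset)
  have "(LINT z:B'|lebesgue. u z - a) = (LINT z:B'|lebesgue. u z) - a * measure lebesgue B'"
  proof -
    have "set_integrable lebesgue B' (\<lambda>z. a)"
      using \<open>B' \<in> lmeasurable\<close> unfolding set_integrable_def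
      by (intro integrable_scaleR_left integrable_indicator) (auto simp: fmeasurable_def)
    then have "(LINT z:B'|lebesgue. u z - a) = (LINT z:B'|lebesgue. u z) - (LINT z:B'|lebesgue. a)"
      using iu' by (intro set_integral_diff)
    moreover have "(LINT z:B'|lebesgue. a) = a * measure lebesgue B'"
      using \<open>B' \<in> lmeasurable\<close> by (simp add: set_lebesgue_integral_def fmeasurable_def)
    ultimately show ?thesis by simp
  qed
  then have "mean_value B' u - a = (LINT z:B'|lebesgue. u z - a) / measure lebesgue B'"
    using B'(3) by (simp add: mean_value_def field_simps)
  also have "\<bar>\<dots>\<bar> \<le> (LINT z:B'|lebesgue. \<bar>u z - a\<bar>) / measure lebesgue B'"
    using B'(3) set_integral_norm_bound[OF iB'] by (simp add: divide_right_mono)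
  also have "(LINT z:B'|lebesgue. \<bar>u z - a\<bar>) \<le> (LINT z:B|lebesgue. \<bar>u z - a\<bar>)"
    unfolding set_lebesgue_integral_def
    using set_integrable_abs[OF iB] set_integrable_abs[OF iB'] B'(2)
    by (intro integral_mono) (auto simp: set_integrable_def split: split_indicator)
  finally show ?thesis
    using mB B'(3) by (simp add: mean_value_def divide_right_mono)
qed

lemma mean_value_deviation_le:
  fixes u :: "'a::euclidean_space \<Rightarrow> real"
  assumes B: "open B" "bounded B" "continuous_on B u" "\<And>x. x \<in> B \<Longrightarrow> \<bar>u x\<bar> \<le> M"
    and mB: "measure lebesgue B > 0" and e: "\<And>x. x \<in> B \<Longrightarrow> \<bar>u x - a\<bar> \<le> e"
  shows "\<bar>mean_value B u - a\<bar> \<le> e"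
proof -
  have lm: "B \<in> lmeasurable" using B by (intro lmeasurable_open)
  have i: "set_integrable lebesgue B (\<lambda>z. \<bar>u z - a\<bar>)"
    using B e by (intro set_integrable_bounded_continuous[where M = e] continuous_intros) auto
  have "(LINT z:B|lebesgue. \<bar>u z - a\<bar>) \<le> (LINT z:B|lebesgue. e)"
    using i lm e unfolding set_lebesgue_integral_def set_integrable_def
    by (intro integral_mono) (auto simp: fmeasurable_def split: split_indicator)
  also have "\<dots> = e * measure lebesgue B"
    using lm by (simp add: set_lebesgue_integral_def fmeasurable_def)
  finally have "mean_value B (\<lambda>z. \<bar>u z - a\<bar>) \<le> e"
    using mB by (simp add: mean_value_def field_simps)
  then show ?thesis
    using mean_value_deviation[OF B B(1) order_refl mB, of a] mB by simp
qed

text \<open>Ahlfors regularity speaks of radii below the diameter only; larger radii are scaled down.\<close>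

lemma Ahlfors_regular_volume_lower:
  fixes G :: "'a::euclidean_space set"
  assumes "open G" "G \<noteq> {}" "bounded G" "Ahlfors_regular G" "Rm > 0"
  shows "\<exists>c>0. \<forall>x\<in>G. \<forall>r. 0 < r \<and> r \<le> Rm \<longrightarrow> c * r ^ DIM('a) \<le> measure lebesgue (ball x r \<inter> G)"
proof -
  obtain C where C: "C \<ge> 1" "\<And>x R. x \<in> G \<Longrightarrow> R > 0 \<Longrightarrow> R < diameter G \<Longrightarrow>
      R ^ DIM('a) / C \<le> measure lebesgue (ball x R \<inter> G)"
    using assms(3,4) unfolding Ahlfors_regular_def by blast
  have d: "diameter G > 0"
  proof -
    obtain x e where x: "e > 0" "cball x e \<subseteq> G" using assms by (metis ex_in_conv open_contains_cball)
    obtain b :: 'a where b: "b \<in> Basis" using nonempty_Basis by blast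
    have "x \<in> G" "x + e *\<^sub>R b \<in> G" using x b by (auto simp: subset_iff dist_norm)
    then have "dist x (x + e *\<^sub>R b) \<le> diameter G" using assms(3) by (intro diameter_bounded_bound)
    then show ?thesis using x(1) b by (simp add: dist_norm)
  qed
  define l where "l = min 1 (diameter G / (2 * Rm))"
  have l: "l > 0" "l \<le> 1" using d \<open>Rm > 0\<close> by (auto simp: l_def)
  have "l ^ DIM('a) / C * r ^ DIM('a) \<le> measure lebesgue (ball x r \<inter> G)"
    if "x \<in> G" "0 < r" "r \<le> Rm" for x r
  proof -
    have "l * r \<le> diameter G / (2 * Rm) * Rm"
      using that l d \<open>Rm > 0\<close> by (intro mult_mono) (auto simp: l_def)
    also have "\<dots> < diameter G" using d \<open>Rm > 0\<close> by simp
    finally have "(l * r) ^ DIM('a) / C \<le> measure lebesgue (ball x (l * r) \<inter> G)"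
      using that l by (intro C(2)) auto
    also have "\<dots> \<le> measure lebesgue (ball x r \<inter> G)"
    proof (rule measure_mono_fmeasurable)
      have "l * r \<le> r" using l that by (simp add: mult_left_le_one_le)
      then show "ball x (l * r) \<inter> G \<subseteq> ball x r \<inter> G" by auto
      show "ball x (l * r) \<inter> G \<in> sets lebesgue" using \<open>open G\<close> by auto
      show "ball x r \<inter> G \<in> lmeasurable" using \<open>open G\<close> by (intro lmeasurable_open) auto
    qed
    finally show ?thesis by (simp add: power_mult_distrib)
  qed
  then show ?thesis using l C(1) by (intro exI[of _ "l ^ DIM('a) / C"]) auto
qed

text \<open>Telescoping over the balls \<open>B(x,R/2^i)\<close>: if every one of them carried little energy, the
  averages of \<open>u\<close> would form a geometrically convergent sequence staying near its first term.
  The exponent \<open>(p + 1 - n) / p\<close> of the geometric series is positive because \<open>n - 1 < p\<close>.\<close>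

lemma large_energy_ball:
  fixes G :: "'a::euclidean_space set"
  assumes n: "real DIM('a) - 1 < p" and p: "0 < p"
    and G: "open G" "G \<noteq> {}" "bounded G" "Ahlfors_regular G" "Poincare_inequality p G" and "0 < R"
  shows "\<exists>K>0. \<exists>\<tau>>0. \<forall>u g x. continuous_on G u \<and> (\<forall>z\<in>G. \<bar>u z\<bar> \<le> 1) \<and> upper_gradient G u g \<and> x \<in> G \<and>
      1 / 3 \<le> \<bar>u x - mean_value (ball x R \<inter> G) u\<bar> \<longrightarrow>
      (\<exists>r. 0 < r \<and> r \<le> R \<and> ennreal r \<le> ennreal K * energy p g (ball x (\<tau> * r) \<inter> G))"
proof -
  let ?n = "DIM('a)"
  obtain Cp \<tau> where Cp: "Cp \<ge> 1" and \<tau>: "\<tau> > 0" and PI: "\<And>x r u \<rho>. x \<in> G \<Longrightarrow> r > 0 \<Longrightarrow>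
        continuous_on G u \<Longrightarrow> bounded (u ` G) \<Longrightarrow> upper_gradient G u \<rho> \<Longrightarrow>
        ennreal (mean_value (ball x r \<inter> G) (\<lambda>z. \<bar>u z - mean_value (ball x r \<inter> G) u\<bar>))
            \<le> ennreal (Cp * diameter (ball x r \<inter> G)) *
              epowr (energy p \<rho> (ball x (\<tau> * r) \<inter> G)
                 / emeasure lebesgue (ball x (\<tau> * r) \<inter> G)) (1 / p)"
    using G(5) unfolding Poincare_inequality_def Let_def by blast
  define Rm where "Rm = max 1 \<tau> * R"
  have Rm: "Rm > 0" "R \<le> Rm" "\<tau> * R \<le> Rm" using \<open>0 < R\<close> by (auto simp: Rm_def mult_right_mono)
  obtain c where c: "c > 0" "\<And>x r. x \<in> G \<Longrightarrow> 0 < r \<Longrightarrow> r \<le> Rm \<Longrightarrow>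
      c * r ^ ?n \<le> measure lebesgue (ball x r \<inter> G)"
    using Ahlfors_regular_volume_lower[OF G(1-4) Rm(1)] by blast
  define \<omega> where "\<omega> = measure lebesgue (ball (0::'a) 1)"
  have \<omega>: "\<omega> > 0" unfolding \<omega>_def using content_ball_pos[of 1 "0::'a"] by simp
  define \<theta> where "\<theta> = (p + 1 - ?n) / p"
  define q where "q = 2 powr (-\<theta>)"
  have \<theta>: "\<theta> > 0" using n p by (simp add: \<theta>_def)
  have q: "0 < q" "q < 1" unfolding q_def using \<theta> by (auto simp: powr_less_one)
  define F where "F = \<omega> * 2 ^ ?n / c"
  define H where "H = 2 * Cp * (1 / (c * \<tau> ^ ?n)) powr (1 / p)"
  \<comment> \<open>\<open>F\<close> bounds the volume ratio of consecutive balls and \<open>H\<close> collects the constants of the Poincare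
    inequality; \<open>S\<close> is the sum of the geometric series, and \<open>K\<close> reduces it to \<open>1 / 4 < 1 / 3\<close>.\<close>
  define S where "S = F * H * R powr \<theta> / (1 - q)"
  have F: "F > 0" using \<omega> c by (simp add: F_def)
  have H: "H > 0" using Cp c \<tau> by (simp add: H_def)
  have S: "S > 0" using F H q \<open>0 < R\<close> by (simp add: S_def)
  define K where "K = (4 * S) powr p"
  have K: "K > 0" using S by (simp add: K_def)
  have K1: "K powr (1 / p) = 4 * S" using S p by (simp add: K_def powr_powr)
  have "\<exists>r. 0 < r \<and> r \<le> R \<and> ennreal r \<le> ennreal K * energy p g (ball x (\<tau> * r) \<inter> G)"
    if u: "continuous_on G u" "\<forall>z\<in>G. \<bar>u z\<bar> \<le> 1" "upper_gradient G u g" "x \<in> G"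
      and dev: "1 / 3 \<le> \<bar>u x - mean_value (ball x R \<inter> G) u\<bar>" for u g x
  proof (rule ccontr)
    assume neg: "\<not> ?thesis"
    let ?J = "\<lambda>r. \<integral>\<^sup>+z\<in>ball x (\<tau> * r) \<inter> G. epowr (g z) p \<partial>lebesgue"
    define r where "r i = R / 2 ^ i" for i :: nat
    have r: "r i > 0" "r i \<le> R" for i
      using \<open>0 < R\<close> by (auto simp: r_def divide_le_eq mult_le_cancel_left1)
    define B where "B i = ball x (r i) \<inter> G" for i
    define a where "a i = mean_value (B i) u" for i
    define m where "m i = measure lebesgue (B i)" for i
    have B: "open (B i)" "bounded (B i)" "continuous_on (B i) u" "\<And>z. z \<in> B i \<Longrightarrow> \<bar>u z\<bar> \<le> 1" for i
      using G u by (auto simp: B_def intro: continuous_on_subset)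
    have m_lower: "c * r i ^ ?n \<le> m i" for i
      unfolding m_def B_def using r[of i] Rm by (intro c(2) u) auto
    have m_pos: "m i > 0" for i using m_lower[of i] c(1) r[of i] by (smt (verit) mult_pos_pos zero_less_power)
    have m_upper: "m i \<le> \<omega> * r i ^ ?n" for i
    proof -
      have "m i \<le> measure lebesgue (ball x (r i))"
        unfolding m_def using B(1) by (intro measure_mono_fmeasurable) (auto simp: B_def)
      also have "\<dots> = \<omega> * r i ^ ?n" unfolding \<omega>_def using r[of i] by (simp add: content_ball unit_ball_vol_def)
      finally show ?thesis .
    qed
    have osc: "mean_value (B i) (\<lambda>z. \<bar>u z - a i\<bar>) \<le> H * (r i powr \<theta> / (4 * S))" for i
    proof -
      have "ennreal K * ?J (r i) < ennreal (r i)" using neg r[of i] by (meson not_le)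
      then have "ennreal K * ?J (r i) < top" by (metis ennreal_less_top order_less_trans)
      then have "?J (r i) < top" using K by (auto simp: ennreal_mult_less_top)
      then obtain j where j: "?J (r i) = ennreal j" "0 \<le> j" by (cases "?J (r i)") auto
      have "ennreal (K * j) < ennreal (r i)"
        using \<open>ennreal K * ?J (r i) < ennreal (r i)\<close> j K by (simp add: ennreal_mult)
      then have "K * j < r i" using K j(2) by (subst (asm) ennreal_less_iff) auto
      then have jr: "j \<le> r i / K" using K by (simp add: field_simps)
      define v where "v = measure lebesgue (ball x (\<tau> * r i) \<inter> G)"
      have "\<tau> * r i \<le> Rm" using r[of i] \<tau> Rm(3) by (meson mult_left_mono less_imp_le order_trans)
      then have v: "c * (\<tau> * r i) ^ ?n \<le> v" unfolding v_def using r[of i] \<tau> by (intro c(2) u) auto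
      have pos: "c * (\<tau> * r i) ^ ?n > 0" using c \<tau> r[of i] by simp
      have "ball x (\<tau> * r i) \<inter> G \<in> lmeasurable" using G(1) by (intro lmeasurable_open) auto
      then have ev: "emeasure lebesgue (ball x (\<tau> * r i) \<inter> G) = ennreal v"
        by (simp add: v_def emeasure_eq_measure2)
      have "diameter (B i) \<le> 2 * r i"
      proof -
        have "diameter (B i) \<le> diameter (ball x (r i))" by (intro diameter_subset) (auto simp: B_def)
        then show ?thesis using r[of i] by simp
      qed
      then have d: "Cp * diameter (B i) \<le> Cp * (2 * r i)" using Cp by simp
      have jv: "j / v \<le> (r i / K) / (c * (\<tau> * r i) ^ ?n)"
        using jr v pos j(2) by (intro frac_le) auto
      have "ennreal (mean_value (B i) (\<lambda>z. \<bar>u z - a i\<bar>))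
          \<le> ennreal (Cp * diameter (B i)) * epowr (?J (r i) / ennreal v) (1 / p)"
        using PI[OF u(4) r(1) u(1) _ u(3), of i] u(2) unfolding a_def B_def ev
        by (auto simp: bounded_iff)
      also have "?J (r i) / ennreal v = ennreal (j / v)"
        using j v pos by (simp add: divide_ennreal)
      also have "epowr (ennreal (j / v)) (1 / p) = ennreal ((j / v) powr (1 / p))"
        using j v pos by (intro epowr_ennreal) auto
      also have "ennreal (Cp * diameter (B i)) * \<dots> \<le> ennreal (Cp * (2 * r i)) *
            ennreal (((r i / K) / (c * (\<tau> * r i) ^ ?n)) powr (1 / p))"
        using j v pos p
        by (intro mult_mono[OF ennreal_leI[OF d] ennreal_leI[OF powr_mono2[OF _ _ jv]]]) auto
      also have "\<dots> = ennreal (Cp * (2 * r i) * ((r i / K) / (c * (\<tau> * r i) ^ ?n)) powr (1 / p))"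
        using Cp r[of i] by (simp add: ennreal_mult)
      also have "Cp * (2 * r i) * ((r i / K) / (c * (\<tau> * r i) ^ ?n)) powr (1 / p) =
          H * (r i powr \<theta> / (4 * S))"
      proof -
        have "(r i / K) / (c * (\<tau> * r i) ^ ?n) = (1 / (c * \<tau> ^ ?n)) * (r i powr (1 - real ?n) / K)"
          using r[of i] by (simp add: power_mult_distrib powr_diff powr_realpow field_simps)
        also have "\<dots> powr (1 / p) = (1 / (c * \<tau> ^ ?n)) powr (1 / p) * (r i powr (1 - real ?n)) powr (1 / p) / K powr (1 / p)"
          using c \<tau> K by (simp add: powr_mult powr_divide)
        also have "(r i powr (1 - real ?n)) powr (1 / p) = r i powr (\<theta> - 1)"
          using p by (simp add: powr_powr \<theta>_def field_simps)
        also have "\<dots> = r i powr \<theta> / r i" using r[of i] by (simp add: powr_diff)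
        finally show ?thesis unfolding K1 H_def using r[of i] by (simp add: field_simps)
      qed
      finally show ?thesis
        by (rule ennreal_le_iff[THEN iffD1, rotated]) (use H S in \<open>auto intro!: mult_nonneg_nonneg\<close>)
    qed
    have step: "\<bar>a (Suc i) - a i\<bar> \<le> (1 - q) / 4 * q ^ i" for i
    proof -
      have "B (Suc i) \<subseteq> B i" using r[of i] by (auto simp: B_def r_def field_simps)
      then have "\<bar>a (Suc i) - a i\<bar> \<le> m i / m (Suc i) * mean_value (B i) (\<lambda>z. \<bar>u z - a i\<bar>)"
        using m_pos[of "Suc i"] unfolding a_def[of "Suc i"] m_def
        by (intro mean_value_deviation[OF B B(1)]) auto
      also have "\<dots> \<le> F * (H * (r i powr \<theta> / (4 * S)))"
      proof (rule mult_mono)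
        have "m i / m (Suc i) \<le> (\<omega> * r i ^ ?n) / (c * r (Suc i) ^ ?n)"
          using m_upper[of i] m_lower[of "Suc i"] c(1) r(1)[of i] r(1)[of "Suc i"] \<omega>
          by (intro frac_le) (auto intro!: mult_nonneg_nonneg)
        also have "\<dots> = F" using r[of i] c \<open>0 < R\<close> by (simp add: F_def r_def field_simps power_mult_distrib)
        finally show "m i / m (Suc i) \<le> F" .
        show "0 \<le> mean_value (B i) (\<lambda>z. \<bar>u z - a i\<bar>)"
          unfolding mean_value_def set_lebesgue_integral_def
          by (intro divide_nonneg_nonneg integral_nonneg_AE) auto
      qed (use F osc in auto)
      also have "r i powr \<theta> = R powr \<theta> * q ^ i"
      proof -
        have "(2 ^ i) powr \<theta> = (2 powr \<theta> :: real) ^ i"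
        proof -
          have "(2 ^ i) powr \<theta> = (2 powr real i :: real) powr \<theta>" by (subst powr_realpow) auto
          also have "\<dots> = (2 powr \<theta>) powr real i" unfolding powr_powr by (simp only: mult.commute)
          also have "\<dots> = (2 powr \<theta>) ^ i" by (rule powr_realpow) simp
          finally show ?thesis .
        qed
        moreover have "q ^ i = 1 / (2 powr \<theta>) ^ i"
          unfolding q_def powr_minus by (simp add: power_inverse divide_inverse)
        moreover have "r i powr \<theta> = R powr \<theta> / (2 ^ i) powr \<theta>"
          unfolding r_def by (rule powr_divide)
        ultimately show ?thesis by simp
      qed
      also have "F * (H * (R powr \<theta> * q ^ i / (4 * S))) = (1 - q) / 4 * q ^ i"
        unfolding S_def using F H q \<open>0 < R\<close> by (simp add: field_simps)
      finally show ?thesis .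
    qed
    have near: "\<bar>a i - a 0\<bar> \<le> (1 - q ^ i) / 4" for i
    proof (induction i)
      case (Suc i)
      have "\<bar>a (Suc i) - a 0\<bar> \<le> \<bar>a (Suc i) - a i\<bar> + \<bar>a i - a 0\<bar>" by simp
      also have "\<dots> \<le> (1 - q) / 4 * q ^ i + (1 - q ^ i) / 4" by (intro add_mono Suc step)
      also have "\<dots> = (1 - q ^ Suc i) / 4" by (simp add: field_simps)
      finally show ?case .
    qed simp
    \<comment> \<open>The averages converge to \<open>u x\<close>; an error of \<open>1 / 24\<close> suffices, as \<open>1 / 4 + 1 / 24 < 1 / 3\<close>.\<close>
    obtain d where d: "d > 0" "\<And>z. z \<in> G \<Longrightarrow> dist z x < d \<Longrightarrow> dist (u z) (u x) < 1 / 24"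
      using u(1,4) unfolding continuous_on_iff by (metis divide_pos_pos zero_less_numeral zero_less_one)
    obtain i where i: "(1 / 2 :: real) ^ i < d / R"
      using real_arch_pow_inv[of "d / R" "1/2"] d \<open>0 < R\<close> by auto
    have "r i < d" using i \<open>0 < R\<close> by (simp add: r_def field_simps power_divide)
    then have "\<bar>u z - u x\<bar> \<le> 1 / 24" if "z \<in> B i" for z
    proof -
      have "z \<in> G" "dist z x < d" using that \<open>r i < d\<close> by (auto simp: B_def dist_commute)
      from d(2)[OF this] show ?thesis by (simp add: dist_real_def)
    qed
    then have "\<bar>a i - u x\<bar> \<le> 1 / 24"
      unfolding a_def using m_pos[of i] by (intro mean_value_deviation_le[OF B]) (auto simp: m_def)
    moreover have "\<bar>a i - a 0\<bar> \<le> 1 / 4" using near[of i] q by (smt (verit) zero_le_power divide_right_mono)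
    moreover have "1 / 3 \<le> \<bar>u x - a 0\<bar>" using dev by (simp add: a_def B_def r_def)
    ultimately show False by linarith
  qed
  then show ?thesis using K \<tau> by blast
qed

text \<open>Vitali's lemma selects disjoint balls, over which the energies add up, whose enlargements still
  cover \<open>A\<close>; the images of these enlargements under the distance from an end of a
  diameter of the connected set \<open>A\<close> cover an interval of length \<open>diameter A\<close>.\<close>

lemma diameter_le_energy:
  fixes A :: "'a::euclidean_space set"
  assumes A: "compact A" "connected A" "A \<noteq> {}" and "0 < \<tau>" "0 < K"
    and h: "h \<in> borel_measurable lebesgue"
    and r: "\<And>x. x \<in> A \<Longrightarrow> 0 < r x \<and> r x \<le> R \<and> ennreal (r x) \<le> ennreal K * (\<integral>\<^sup>+z\<in>ball x (\<tau> * r x). h z \<partial>lebesgue)"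
  shows "ennreal (diameter A) \<le> ennreal (10 * \<tau> * K) * (\<integral>\<^sup>+z. h z \<partial>lebesgue)"
proof -
  have bounds: "0 < \<tau> * r x \<and> \<tau> * r x \<le> \<tau> * R" if "x \<in> A" for x
    using r[OF that] \<open>0 < \<tau>\<close> by simp
  have "A \<subseteq> (\<Union>x\<in>A. ball x (\<tau> * r x))"
  proof
    fix x assume "x \<in> A"
    then show "x \<in> (\<Union>x\<in>A. ball x (\<tau> * r x))" using bounds[of x] by (intro UN_I[of x]) auto
  qed
  then obtain C where C: "countable C" "C \<subseteq> A"
     "pairwise (\<lambda>i j. disjnt (ball i (\<tau> * r i)) (ball j (\<tau> * r j))) C"
     "A \<subseteq> (\<Union>i\<in>C. ball i (5 * (\<tau> * r i)))"
    by (rule Vitali_covering_lemma_balls[of A "\<lambda>x. x" "\<lambda>x. \<tau> * r x" A "\<tau> * R"])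
      (rule bounds, assumption, rule that)
  obtain a b where ab: "a \<in> A" "b \<in> A" "dist a b = diameter A"
    using diameter_compact_attained[OF A(1) A(3)] by blast
  define N where "N = to_nat_on C ` C"
  define x where "x n = from_nat_into C n" for n
  have x: "x n \<in> C" if "n \<in> N" for n using that C(1) by (auto simp: N_def x_def)
  have xC: "\<exists>n\<in>N. x n = y" if "y \<in> C" for y using that C(1) by (auto simp: N_def x_def)
  have x_inj: "x m \<noteq> x n" if "m \<in> N" "n \<in> N" "m \<noteq> n" for m n
    using that C(1) by (auto simp: N_def x_def)
  define I where "I n = (if n \<in> N then {dist a (x n) - 5 * (\<tau> * r (x n))..dist a (x n) + 5 * (\<tau> * r (x n))} else {})" for n
  define D where "D n = (if n \<in> N then ball (x n) (\<tau> * r (x n)) else {})" for n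
  define \<nu> where "\<nu> = density lebesgue h"
  have disj: "disjoint_family D"
  proof (unfold disjoint_family_on_def, intro ballI impI)
    fix m n :: nat assume "m \<noteq> n"
    show "D m \<inter> D n = {}"
    proof (cases "m \<in> N \<and> n \<in> N")
      case True
      then have "disjnt (D m) (D n)"
        using x_inj[of m n] x \<open>m \<noteq> n\<close> C(3) unfolding pairwise_def by (simp add: D_def)
      then show ?thesis by (simp add: disjnt_def)
    qed (auto simp: D_def)
  qed
  have "connected ((\<lambda>z. dist a z) ` A)"
    using A(2) by (intro connected_continuous_image continuous_intros)
  then have "{0..diameter A} \<subseteq> (\<lambda>z. dist a z) ` A"
    using ab by (intro connected_contains_Icc) (auto intro!: image_eqI[of _ _ a] image_eqI[of _ _ b])
  also have "\<dots> \<subseteq> (\<Union>n. I n)"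
  proof
    fix y assume "y \<in> (\<lambda>z. dist a z) ` A"
    then obtain z where z: "z \<in> A" "y = dist a z" by auto
    then obtain c where "c \<in> C" "dist c z < 5 * (\<tau> * r c)" using C(4) by auto
    moreover then obtain n where "n \<in> N" "x n = c" using xC by auto
    moreover have "\<bar>dist a z - dist a c\<bar> \<le> dist c z"
      using dist_triangle[of a z c] dist_triangle[of a c z] by (simp add: dist_commute abs_le_iff)
    ultimately have "y \<in> I n" using z(2) by (auto simp: I_def)
    then show "y \<in> (\<Union>n. I n)" by blast
  qed
  finally have "emeasure lborel {0..diameter A} \<le> emeasure lborel (\<Union>n. I n)"
    by (intro emeasure_mono) (auto simp: I_def)
  moreover have "0 \<le> diameter A" using ab(3) by (metis zero_le_dist)
  ultimately have "ennreal (diameter A) \<le> emeasure lborel (\<Union>n. I n)" by simp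
  also have "\<dots> \<le> (\<Sum>n. emeasure lborel (I n))"
    by (intro emeasure_subadditive_countably) (auto simp: I_def)
  also have "\<dots> \<le> (\<Sum>n. ennreal (10 * \<tau> * K) * emeasure \<nu> (D n))"
  proof (intro suminf_le allI)
    fix n
    show "emeasure lborel (I n) \<le> ennreal (10 * \<tau> * K) * emeasure \<nu> (D n)"
    proof (cases "n \<in> N")
      case True
      then have xA: "x n \<in> A" using x C(2) by blast
      have "emeasure lborel (I n) = ennreal (10 * \<tau> * r (x n))"
        using True r[OF xA] \<open>0 < \<tau>\<close> by (simp add: I_def)
      also have "\<dots> = ennreal (10 * \<tau>) * ennreal (r (x n))"
        using \<open>0 < \<tau>\<close> r[OF xA] by (intro ennreal_mult) auto
      also have "\<dots> \<le> ennreal (10 * \<tau>) * (ennreal K * (\<integral>\<^sup>+z\<in>ball (x n) (\<tau> * r (x n)). h z \<partial>lebesgue))"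
        using r[OF xA] by (intro mult_left_mono) auto
      also have "\<dots> = ennreal (10 * \<tau> * K) * (\<integral>\<^sup>+z\<in>ball (x n) (\<tau> * r (x n)). h z \<partial>lebesgue)"
        using \<open>0 < \<tau>\<close> \<open>0 < K\<close> by (subst ennreal_mult[of "10 * \<tau>" K]) (auto simp: mult.assoc)
      also have "(\<integral>\<^sup>+z\<in>ball (x n) (\<tau> * r (x n)). h z \<partial>lebesgue) = emeasure \<nu> (D n)"
        using True h by (simp add: \<nu>_def D_def emeasure_density)
      finally show ?thesis .
    qed (simp add: I_def)
  qed auto
  also have "\<dots> = ennreal (10 * \<tau> * K) * (\<Sum>n. emeasure \<nu> (D n))" by (rule ennreal_suminf_cmult)
  also have "(\<Sum>n. emeasure \<nu> (D n)) = emeasure \<nu> (\<Union>n. D n)"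
  proof (rule suminf_emeasure[OF _ disj])
    show "range D \<subseteq> sets \<nu>" by (auto simp: D_def \<nu>_def)
  qed
  also have "\<dots> \<le> emeasure \<nu> UNIV" by (intro emeasure_mono) (auto simp: \<nu>_def)
  also have "\<dots> = (\<integral>\<^sup>+z. h z \<partial>lebesgue)" using h by (simp add: \<nu>_def emeasure_density)
  finally show ?thesis by (simp add: mult_left_mono)
qed

lemma upper_gradient_measurable:
  assumes "upper_gradient G u g" "open G"
  shows "(\<lambda>z. epowr (g z) p * indicator G z) \<in> borel_measurable lebesgue"
proof -
  have "g \<in> borel_measurable (restrict_space borel G)" using assms by (simp add: upper_gradient_def)
  then have "(\<lambda>z. epowr (g z) p) \<in> borel_measurable (restrict_space borel G)" by measurable
  then have "(\<lambda>z. epowr (g z) p * indicator G z) \<in> borel_measurable borel"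
    using \<open>open G\<close> by (subst (asm) borel_measurable_restrict_space_iff_ennreal) auto
  then show ?thesis by (intro measurable_completion) simp
qed

text \<open>The average of \<open>u\<close> over \<open>G\<close> is at distance at least \<open>1/3\<close> from \<open>0\<close> or from all values not below
  \<open>2/3\<close>, so on all of \<open>E\<close> or on all of \<open>F\<close> the function deviates from its average.\<close>

theorem capacity_lower_bound:
  fixes G :: "'a::euclidean_space set"
  assumes n: "real DIM('a) - 1 < p" and p: "0 < p"
    and G: "open G" "G \<noteq> {}" "bounded G" "Ahlfors_regular G" "Poincare_inequality p G"
  shows "\<exists>M>0. \<forall>u g E F. continuous_on G u \<and> (\<forall>z\<in>G. 0 \<le> u z \<and> u z \<le> 1) \<and> upper_gradient G u g \<and>
      compact E \<and> connected E \<and> E \<noteq> {} \<and> E \<subseteq> G \<and> (\<forall>z\<in>E. u z = 0) \<and>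
      compact F \<and> connected F \<and> F \<noteq> {} \<and> F \<subseteq> G \<and> (\<forall>z\<in>F. 2 / 3 \<le> u z) \<longrightarrow>
      ennreal (min (diameter E) (diameter F)) \<le> ennreal M * energy p g G"
proof -
  define R where "R = diameter G + 1"
  have "R > 0" using diameter_ge_0[OF G(3)] by (simp add: R_def)
  have ball_R: "ball x R \<inter> G = G" if "x \<in> G" for x
    using diameter_bounded_bound[OF G(3) that] by (force simp: R_def)
  obtain K \<tau> where K: "K > 0" "\<tau> > 0" and KI: "\<forall>u g x. continuous_on G u \<and> (\<forall>z\<in>G. \<bar>u z\<bar> \<le> 1) \<and> upper_gradient G u g \<and> x \<in> G \<and>
      1 / 3 \<le> \<bar>u x - mean_value (ball x R \<inter> G) u\<bar> \<longrightarrow>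
      (\<exists>r. 0 < r \<and> r \<le> R \<and> ennreal r \<le> ennreal K * energy p g (ball x (\<tau> * r) \<inter> G))"
    using large_energy_ball[OF n p G \<open>R > 0\<close>] by blast
  have main: "ennreal (diameter A) \<le> ennreal (10 * \<tau> * K) * energy p g G"
    if u: "continuous_on G u" "\<forall>z\<in>G. 0 \<le> u z \<and> u z \<le> 1" "upper_gradient G u g"
      and A: "compact A" "connected A" "A \<noteq> {}" "A \<subseteq> G" "\<And>x. x \<in> A \<Longrightarrow> 1 / 3 \<le> \<bar>u x - mean_value G u\<bar>"
    for u g A
  proof -
    have "\<forall>x\<in>A. \<exists>r. 0 < r \<and> r \<le> R \<and>
        ennreal r \<le> ennreal K * energy p g (ball x (\<tau> * r) \<inter> G)"
    proof
      fix x assume x: "x \<in> A"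
      have "\<forall>z\<in>G. \<bar>u z\<bar> \<le> 1" using u(2) by auto
      moreover have "x \<in> G" using x A(4) by blast
      moreover have "1 / 3 \<le> \<bar>u x - mean_value (ball x R \<inter> G) u\<bar>"
        using A(5)[OF x] ball_R[OF \<open>x \<in> G\<close>] by simp
      ultimately show "\<exists>r. 0 < r \<and> r \<le> R \<and>
          ennreal r \<le> ennreal K * energy p g (ball x (\<tau> * r) \<inter> G)"
        using KI u by blast
    qed
    from bchoice[OF this] obtain r where r: "\<And>x. x \<in> A \<Longrightarrow> 0 < r x \<and> r x \<le> R \<and>
        ennreal (r x) \<le> ennreal K * energy p g (ball x (\<tau> * r x) \<inter> G)"
      by blast
    have eq: "energy p g (ball x s \<inter> G)
        = (\<integral>\<^sup>+z\<in>ball x s. (epowr (g z) p * indicator G z) \<partial>lebesgue)" for x s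
      by (intro nn_integral_cong) (auto split: split_indicator)
    show ?thesis
      using r unfolding eq
      by (intro diameter_le_energy[OF A(1-3) K(2,1) upper_gradient_measurable[OF u(3) G(1)]])
  qed
  have "ennreal (min (diameter E) (diameter F)) \<le> ennreal (10 * \<tau> * K) * energy p g G"
    if u: "continuous_on G u" "\<forall>z\<in>G. 0 \<le> u z \<and> u z \<le> 1" "upper_gradient G u g"
      and E: "compact E" "connected E" "E \<noteq> {}" "E \<subseteq> G" "\<forall>z\<in>E. u z = 0"
      and F: "compact F" "connected F" "F \<noteq> {}" "F \<subseteq> G" "\<forall>z\<in>F. 2 / 3 \<le> u z" for u g E F
  proof (cases "mean_value G u \<ge> 1 / 3")
    case True
    then have "ennreal (diameter E) \<le> ennreal (10 * \<tau> * K) * energy p g G"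
      using E(5) by (intro main[OF u E(1-4)]) auto
    then show ?thesis by (meson ennreal_leI min.cobounded1 order_trans)
  next
    case False
    then have "ennreal (diameter F) \<le> ennreal (10 * \<tau> * K) * energy p g G"
      using F(5) by (intro main[OF u F(1-4)]) force
    then show ?thesis by (meson ennreal_leI min.cobounded2 order_trans)
  qed
  then show ?thesis using K by (intro exI[of _ "10 * \<tau> * K"]) auto
qed

section \<open>The distance function of a density\<close>

text \<open>This integral takes the place of the line integral for curves of speed at most one. Such curves can
  be concatenated and reversed freely, and arc length parametrizations are among them.\<close>

definition cost :: "('a::euclidean_space \<Rightarrow> ennreal) \<Rightarrow> real \<Rightarrow> (real \<Rightarrow> 'a) \<Rightarrow> ennreal" where
  "cost g l \<beta> = (\<integral>\<^sup>+t\<in>{0..l}. g (\<beta> t) \<partial>lborel)"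

definition paths_of_speed_le_1 :: "'a::euclidean_space set \<Rightarrow> 'a set \<Rightarrow> 'a \<Rightarrow> (real \<times> (real \<Rightarrow> 'a)) set" where
  "paths_of_speed_le_1 G E x = {(l, \<beta>). 0 \<le> l \<and> 1-lipschitz_on {0..l} \<beta> \<and> \<beta> ` {0..l} \<subseteq> G \<and> \<beta> 0 \<in> E \<and> \<beta> l = x}"

lemma cost_concat:
  assumes g: "g \<in> borel_measurable borel" and \<beta>: "1-lipschitz_on {0..l} \<beta>" and \<sigma>: "1-lipschitz_on {0..L} \<sigma>"
    and "0 \<le> l" "0 \<le> L" "\<beta> l = \<sigma> 0"
  defines "\<zeta> \<equiv> \<lambda>t. if t \<le> l then \<beta> t else \<sigma> (t - l)"
  shows "1-lipschitz_on {0..l + L} \<zeta>" and "cost g (l + L) \<zeta> \<le> cost g l \<beta> + cost g L \<sigma>"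
proof -
  have shift: "1-lipschitz_on {l..l + L} (\<lambda>t. \<sigma> (t - l))"
  proof (rule lipschitz_onI)
    fix x y assume xy: "x \<in> {l..l + L}" "y \<in> {l..l + L}"
    then have "dist (\<sigma> (x - l)) (\<sigma> (y - l)) \<le> 1 * dist (x - l) (y - l)"
      by (intro lipschitz_onD[OF \<sigma>]) auto
    then show "dist (\<sigma> (x - l)) (\<sigma> (y - l)) \<le> 1 * dist x y" by (simp add: dist_real_def)
  qed simp
  show "1-lipschitz_on {0..l + L} \<zeta>"
    unfolding \<zeta>_def using assms by (intro lipschitz_on_concat \<beta> shift) simp
  have m1: "(\<lambda>t. g (\<beta> t) * indicator {0..l} t) \<in> borel_measurable borel"
    using \<beta> g by (intro borel_measurable_along_curve lipschitz_on_continuous_on)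
  have m2: "(\<lambda>t. g (\<sigma> t) * indicator {0..L} t) \<in> borel_measurable borel"
    using \<sigma> g by (intro borel_measurable_along_curve lipschitz_on_continuous_on)
  have "cost g (l + L) \<zeta> \<le> (\<integral>\<^sup>+t. g (\<beta> t) * indicator {0..l} t + g (\<sigma> (- l + 1 * t)) * indicator {0..L} (- l + 1 * t) \<partial>lborel)"
    unfolding cost_def by (intro nn_integral_mono) (auto simp: \<zeta>_def split: split_indicator)
  also have "\<dots> = cost g l \<beta> + (\<integral>\<^sup>+t. g (\<sigma> (- l + 1 * t)) * indicator {0..L} (- l + 1 * t) \<partial>lborel)"
    unfolding cost_def
    by (intro nn_integral_add) (use m1 in simp, rule measurable_compose[OF _ m2[folded measurable_lborel1]], simp)
  also have "(\<integral>\<^sup>+t. g (\<sigma> (- l + 1 * t)) * indicator {0..L} (- l + 1 * t) \<partial>lborel) = cost g L \<sigma>"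
    unfolding cost_def using nn_integral_real_affine[OF m2, of 1 "-l"] by simp
  finally show "cost g (l + L) \<zeta> \<le> cost g l \<beta> + cost g L \<sigma>" .
qed

lemma cost_reverse:
  assumes g: "g \<in> borel_measurable borel" and \<sigma>: "1-lipschitz_on {0..L} \<sigma>"
  shows "1-lipschitz_on {0..L} (\<lambda>t. \<sigma> (L - t))" and "cost g L (\<lambda>t. \<sigma> (L - t)) = cost g L \<sigma>"
proof -
  show "1-lipschitz_on {0..L} (\<lambda>t. \<sigma> (L - t))"
  proof (rule lipschitz_onI)
    fix x y assume xy: "x \<in> {0..L}" "y \<in> {0..L}"
    then have "dist (\<sigma> (L - x)) (\<sigma> (L - y)) \<le> 1 * dist (L - x) (L - y)"
      by (intro lipschitz_onD[OF \<sigma>]) auto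
    then show "dist (\<sigma> (L - x)) (\<sigma> (L - y)) \<le> 1 * dist x y" by (simp add: dist_real_def abs_minus_commute)
  qed simp
  have m: "(\<lambda>t. g (\<sigma> t) * indicator {0..L} t) \<in> borel_measurable borel"
    using \<sigma> g by (intro borel_measurable_along_curve lipschitz_on_continuous_on)
  have "cost g L \<sigma> = (\<integral>\<^sup>+t. g (\<sigma> (L + (-1) * t)) * indicator {0..L} (L + (-1) * t) \<partial>lborel)"
    unfolding cost_def using nn_integral_real_affine[OF m, of "-1" L] by simp
  also have "\<dots> = cost g L (\<lambda>t. \<sigma> (L - t))"
    unfolding cost_def by (intro nn_integral_cong) (auto split: split_indicator)
  finally show "cost g L (\<lambda>t. \<sigma> (L - t)) = cost g L \<sigma>" by simp
qed

text \<open>The distance from \<open>E\<close> in the metric with density \<open>g\<close>, truncated at \<open>1\<close>.\<close>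

definition density_distance :: "'a::euclidean_space set \<Rightarrow> 'a set \<Rightarrow> ('a \<Rightarrow> ennreal) \<Rightarrow> 'a \<Rightarrow> ennreal" where
  "density_distance G E g x = min 1 (INF (l, \<beta>)\<in>paths_of_speed_le_1 G E x. cost g l \<beta>)"

lemma density_distance_step:
  assumes g: "g \<in> borel_measurable borel" and \<sigma>: "1-lipschitz_on {0..L} \<sigma>" "0 \<le> L" "\<sigma> ` {0..L} \<subseteq> G"
  shows "density_distance G E g (\<sigma> L) \<le> density_distance G E g (\<sigma> 0) + cost g L \<sigma>"
proof (cases "cost g L \<sigma> = top")
  case False
  have le1: "density_distance G E g y \<le> 1" for y by (simp add: density_distance_def)
  have "density_distance G E g (\<sigma> L) \<le> cost g L \<sigma> + cost g l \<beta>" if "(l, \<beta>) \<in> paths_of_speed_le_1 G E (\<sigma> 0)" for l \<beta>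
  proof -
    have \<beta>: "0 \<le> l" "1-lipschitz_on {0..l} \<beta>" "\<beta> ` {0..l} \<subseteq> G" "\<beta> 0 \<in> E" "\<beta> l = \<sigma> 0"
      using that by (auto simp: paths_of_speed_le_1_def)
    define \<zeta> where "\<zeta> = (\<lambda>t. if t \<le> l then \<beta> t else \<sigma> (t - l))"
    note c = cost_concat[OF g \<beta>(2) \<sigma>(1) \<beta>(1) \<sigma>(2) \<beta>(5), folded \<zeta>_def]
    have "\<zeta> t \<in> G" if "t \<in> {0..l + L}" for t
    proof (cases "t \<le> l")
      case True then show ?thesis using that \<beta>(3) by (auto simp: \<zeta>_def)
    next
      case False then show ?thesis using that \<sigma>(3) by (auto simp: \<zeta>_def)
    qed
    moreover have "\<zeta> 0 \<in> E" using \<beta> by (simp add: \<zeta>_def)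
    moreover have "\<zeta> (l + L) = \<sigma> L" using \<beta>(5) \<sigma>(2) by (cases "L = 0") (auto simp: \<zeta>_def)
    ultimately have "(l + L, \<zeta>) \<in> paths_of_speed_le_1 G E (\<sigma> L)"
      using c(1) \<beta>(1) \<sigma>(2) by (auto simp: paths_of_speed_le_1_def)
    then have "(INF (l, \<beta>)\<in>paths_of_speed_le_1 G E (\<sigma> L). cost g l \<beta>) \<le> cost g (l + L) \<zeta>"
      by (rule INF_lower2) simp
    then have "density_distance G E g (\<sigma> L) \<le> cost g (l + L) \<zeta>"
      unfolding density_distance_def by (rule min.coboundedI2)
    also have "\<dots> \<le> cost g L \<sigma> + cost g l \<beta>" using c(2) by (simp add: add.commute)
    finally show ?thesis .
  qed
  then have "density_distance G E g (\<sigma> L) - cost g L \<sigma> \<le> (INF (l, \<beta>)\<in>paths_of_speed_le_1 G E (\<sigma> 0). cost g l \<beta>)"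
    using False by (intro INF_greatest) (auto simp: ennreal_minus_le_iff)
  moreover have "density_distance G E g (\<sigma> L) - cost g L \<sigma> \<le> 1"
    using le1[of "\<sigma> L"] by (meson diff_le_self_ennreal order_trans)
  ultimately have "density_distance G E g (\<sigma> L) - cost g L \<sigma> \<le> density_distance G E g (\<sigma> 0)"
    by (simp add: density_distance_def)
  then show ?thesis using False by (simp add: ennreal_minus_le_iff add.commute)
qed simp

text \<open>The triangle inequality along \<open>1\<close>-Lipschitz curves gives both analytic properties of \<open>u\<close>: applied to arc length
  parametrizations it is the upper gradient property, applied to short segments it is continuity.\<close>

theorem potential_with_upper_gradient:
  fixes G E F :: "'a::euclidean_space set"
  assumes "open G" and g: "g \<in> borel_measurable borel"
    and bounded: "\<And>x. x \<in> G \<Longrightarrow> \<exists>r>0. \<exists>b\<ge>0. ball x r \<subseteq> G \<and> (\<forall>y\<in>ball x r. g y \<le> ennreal b)"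
    and "E \<subseteq> G" and c: "0 \<le> c" "c \<le> 1"
    and long: "\<And>l \<beta>. 0 \<le> l \<Longrightarrow> 1-lipschitz_on {0..l} \<beta> \<Longrightarrow> \<beta> ` {0..l} \<subseteq> G \<Longrightarrow> \<beta> 0 \<in> E \<Longrightarrow> \<beta> l \<in> F
      \<Longrightarrow> ennreal c \<le> cost g l \<beta>"
  shows "\<exists>u. continuous_on G u \<and> (\<forall>z\<in>G. 0 \<le> u z \<and> u z \<le> 1) \<and> upper_gradient G u g \<and>
    (\<forall>z\<in>E. u z = 0) \<and> (\<forall>z\<in>F. c \<le> u z)"
proof -
  define V where "V = density_distance G E g"
  define u where "u x = enn2real (V x)" for x
  have V1: "V x \<le> 1" for x by (simp add: V_def density_distance_def)
  have Vu: "V x = ennreal (u x)" for x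
  proof -
    have "V x < top" using V1[of x] by (metis ennreal_one_less_top order_le_less_trans)
    then show ?thesis by (simp add: u_def)
  qed
  have u0: "0 \<le> u x" for x by (simp add: u_def)
  have u1: "u x \<le> 1" for x using V1[of x] u0[of x] unfolding Vu by (simp flip: ennreal_1)
  have step: "ennreal \<bar>u (\<sigma> 0) - u (\<sigma> L)\<bar> \<le> cost g L \<sigma>"
    if \<sigma>: "1-lipschitz_on {0..L} \<sigma>" "0 \<le> L" "\<sigma> ` {0..L} \<subseteq> G" for L \<sigma>
  proof (cases "cost g L \<sigma> = top")
    case False
    then obtain k where k: "cost g L \<sigma> = ennreal k" "0 \<le> k" by (cases "cost g L \<sigma>") auto
    have rev_im: "(\<lambda>t. \<sigma> (L - t)) ` {0..L} \<subseteq> G" using \<sigma>(3) by auto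
    have "V (\<sigma> L) \<le> V (\<sigma> 0) + cost g L \<sigma>"
      unfolding V_def by (rule density_distance_step[OF g \<sigma>])
    then have 1: "u (\<sigma> L) \<le> u (\<sigma> 0) + k"
      unfolding Vu k(1) using u0 k(2) by (simp flip: ennreal_plus)
    have "V (\<sigma> 0) \<le> V (\<sigma> L) + cost g L \<sigma>"
      unfolding V_def
      using density_distance_step[OF g cost_reverse(1)[OF g \<sigma>(1)] \<sigma>(2) rev_im, of E] cost_reverse(2)[OF g \<sigma>(1)]
      by simp
    then have 2: "u (\<sigma> 0) \<le> u (\<sigma> L) + k"
      unfolding Vu k(1) using u0 k(2) by (simp flip: ennreal_plus)
    show ?thesis unfolding k(1) using 1 2 by (intro ennreal_leI) auto
  qed simp
  have "upper_gradient G u g"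
    unfolding upper_gradient_def
  proof (intro conjI allI impI)
    show "g \<in> borel_measurable (restrict_space borel G)" using g by (rule measurable_restrict_space1)
    fix a b \<gamma>
    assume "a \<le> b \<and> continuous_on {a..b} \<gamma> \<and> \<gamma> ` {a..b} \<subseteq> G \<and> curve_length a b \<gamma> < \<infinity>"
    then have *: "a \<le> b" "continuous_on {a..b} \<gamma>" "\<gamma> ` {a..b} \<subseteq> G" "curve_length a b \<gamma> < \<infinity>" by auto
    note f = *(1,2,4)
    define L where "L = length_upto a \<gamma> b"
    have "0 \<le> L" by (simp add: L_def length_upto_def)
    have "arclength_param a b \<gamma> ` {0..L} \<subseteq> G"
      using arclength_param_image[OF f] *(3) unfolding L_def by fastforce
    then have "ennreal \<bar>u (arclength_param a b \<gamma> 0) - u (arclength_param a b \<gamma> L)\<bar> \<le> cost g L (arclength_param a b \<gamma>)"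
      using arclength_param_lipschitz[OF f] \<open>0 \<le> L\<close> unfolding L_def by (intro step)
    also have "cost g L (arclength_param a b \<gamma>) = segment_integral a b \<gamma> g"
      by (simp add: cost_def segment_integral_def L_def length_upto_def)
    also have "\<dots> \<le> curve_integral ({a..b}, \<gamma>) g"
      using *(1) by (rule segment_integral_le_curve_integral) simp
    finally show "ennreal \<bar>u (\<gamma> a) - u (\<gamma> b)\<bar> \<le> curve_integral ({a..b}, \<gamma>) g"
      using arclength_param_ends[OF f] by (simp add: L_def)
  qed
  moreover have "continuous_on G u"
    unfolding continuous_on_iff
  proof (intro ballI allI impI)
    fix x and e :: real assume "x \<in> G" "e > 0"
    obtain r b where rb: "r > 0" "b \<ge> 0" "ball x r \<subseteq> G" "\<forall>y\<in>ball x r. g y \<le> ennreal b"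
      using bounded[OF \<open>x \<in> G\<close>] by blast
    have "dist (u y) (u x) \<le> b * dist y x" if y: "dist y x < r" for y
    proof -
      define L where "L = dist y x"
      define \<sigma> where "\<sigma> t = x + t *\<^sub>R sgn (y - x)" for t
      have sgn1: "norm (sgn (y - x)) \<le> 1" by (simp add: norm_sgn)
      have lip: "1-lipschitz_on {0..L} \<sigma>"
      proof (rule lipschitz_onI)
        fix s t
        have "dist (\<sigma> s) (\<sigma> t) = norm ((s - t) *\<^sub>R sgn (y - x))"
          by (simp add: \<sigma>_def dist_norm algebra_simps)
        also have "\<dots> \<le> \<bar>s - t\<bar> * 1" unfolding norm_scaleR by (intro mult_left_mono sgn1) simp
        finally show "dist (\<sigma> s) (\<sigma> t) \<le> 1 * dist s t" by (simp add: dist_real_def)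
      qed simp
      have in_ball: "\<sigma> t \<in> ball x r" if t: "t \<in> {0..L}" for t
      proof -
        have "dist x (\<sigma> t) = \<bar>t\<bar> * norm (sgn (y - x))" by (simp add: \<sigma>_def dist_norm)
        also have "\<dots> \<le> \<bar>t\<bar> * 1" by (intro mult_left_mono sgn1) simp
        finally show ?thesis using t y by (simp add: L_def)
      qed
      have ends: "\<sigma> 0 = x" "\<sigma> L = y"
        by (cases "y = x"; simp add: \<sigma>_def L_def dist_norm sgn_div_norm)+
      have "ennreal \<bar>u (\<sigma> 0) - u (\<sigma> L)\<bar> \<le> cost g L \<sigma>"
        using in_ball rb(3) lip by (intro step) (auto simp: L_def)
      also have "\<dots> \<le> (\<integral>\<^sup>+t\<in>{0..L}. ennreal b \<partial>lborel)"
        unfolding cost_def using in_ball rb(4) by (intro nn_integral_mono) (auto split: split_indicator)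
      also have "\<dots> = ennreal (b * L)"
        using rb(2) by (simp add: nn_integral_cmult_indicator L_def ennreal_mult)
      finally have "\<bar>u x - u y\<bar> \<le> b * L"
        unfolding ends using rb(2) by (subst (asm) ennreal_le_iff) (auto simp: L_def)
      then show ?thesis by (simp add: dist_real_def L_def abs_minus_commute)
    qed
    moreover have "b * dist y x < e" if "dist y x < e / (b + 1)" for y
    proof -
      have "b * dist y x \<le> (b + 1) * dist y x" by (intro mult_right_mono) auto
      also have "\<dots> < e" using that rb(2) by (simp add: field_simps)
      finally show ?thesis .
    qed
    ultimately show "\<exists>d>0. \<forall>y\<in>G. dist y x < d \<longrightarrow> dist (u y) (u x) < e"
      using rb \<open>e > 0\<close> by (intro exI[of _ "min r (e / (b + 1))"]) (force intro: le_less_trans)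
  qed
  moreover have "u z = 0" if "z \<in> E" for z
  proof -
    have "(0, \<lambda>_. z) \<in> paths_of_speed_le_1 G E z"
      using that \<open>E \<subseteq> G\<close> by (auto simp: paths_of_speed_le_1_def lipschitz_on_def)
    then have "(INF (l, \<beta>)\<in>paths_of_speed_le_1 G E z. cost g l \<beta>) \<le> cost g 0 (\<lambda>_. z)"
      by (rule INF_lower2) simp
    also have "cost g 0 (\<lambda>_. z) = 0"
      unfolding cost_def by (rule nn_integral_null_set) (simp add: finite_imp_null_set_lborel)
    finally show ?thesis by (simp add: u_def V_def density_distance_def)
  qed
  moreover have "c \<le> u z" if "z \<in> F" for z
  proof -
    have "ennreal c \<le> (INF (l, \<beta>)\<in>paths_of_speed_le_1 G E z. cost g l \<beta>)"
      using that by (intro INF_greatest) (auto simp: paths_of_speed_le_1_def intro!: long)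
    then have "ennreal c \<le> V z" using c by (simp add: V_def density_distance_def)
    then show ?thesis unfolding Vu using u0 by simp
  qed
  ultimately show ?thesis using u0 u1 by blast
qed

section \<open>Smoothing a density\<close>

lemma ball_sets_borel [measurable]: "ball x r \<in> sets borel" by simp

lemma le_epowr_plus_1:
  assumes "1 \<le> p"
  shows "v \<le> epowr v p + 1"
proof (cases v)
  case (real x)
  have "x \<le> x powr p + 1"
  proof (cases "x \<le> 1")
    case False
    then have "x powr 1 \<le> x powr p" using assms by (intro powr_mono) auto
    then show ?thesis using False by simp
  qed (simp add: add_increasing)
  then show ?thesis using real by (simp add: epowr_ennreal ennreal_leI flip: ennreal_1 ennreal_plus)
qed simp

text \<open>Jensen's inequality for the power \<open>p\<close>, obtained by integrating the tangent line bound at the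
  mean value \<open>a\<close>; that bound is Young's inequality.\<close>

lemma powr_mean_le:
  fixes h :: "'a::euclidean_space \<Rightarrow> ennreal"
  assumes p: "1 < p" and h: "h \<in> borel_measurable borel" and B: "B \<in> sets borel" and "0 < w"
    and w: "emeasure lborel B = ennreal w"
  shows "epowr ((\<integral>\<^sup>+z\<in>B. h z \<partial>lborel) / ennreal w) p \<le> (\<integral>\<^sup>+z\<in>B. epowr (h z) p \<partial>lborel) / ennreal w"
proof (cases "(\<integral>\<^sup>+z\<in>B. epowr (h z) p \<partial>lborel) = top")
  case True
  then show ?thesis using \<open>0 < w\<close> by (simp add: ennreal_top_divide)
next
  case False
  let ?X = "\<integral>\<^sup>+z\<in>B. epowr (h z) p \<partial>lborel"
  have int1: "(\<integral>\<^sup>+z\<in>B. (c * h z) \<partial>lborel) = c * (\<integral>\<^sup>+z\<in>B. h z \<partial>lborel)" for c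
    using h B by (simp add: mult.assoc nn_integral_cmult)
  have int2: "(\<integral>\<^sup>+z\<in>B. (epowr (h z) p + c) \<partial>lborel) = ?X + c * ennreal w" for c
    using h B w by (simp add: distrib_right nn_integral_add nn_integral_cmult_indicator)
  have "h z \<le> epowr (h z) p + 1" for z using p by (intro le_epowr_plus_1) simp
  then have "(\<integral>\<^sup>+z\<in>B. h z \<partial>lborel) \<le> (\<integral>\<^sup>+z\<in>B. (epowr (h z) p + 1) \<partial>lborel)"
    by (intro nn_integral_mono mult_right_mono) auto
  also have "\<dots> < top" unfolding int2 using False by (simp add: less_top[symmetric])
  finally obtain y where y: "(\<integral>\<^sup>+z\<in>B. h z \<partial>lborel) = ennreal y" "0 \<le> y"
    by (cases "\<integral>\<^sup>+z\<in>B. h z \<partial>lborel") auto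
  obtain x where x: "?X = ennreal x" "0 \<le> x" using False by (cases ?X) auto
  define a where "a = y / w"
  have a: "0 \<le> a" using y \<open>0 < w\<close> by (simp add: a_def)
  have young: "p * a powr (p - 1) * t \<le> t powr p + (p - 1) * a powr p" if "0 \<le> t" for t
  proof (cases "a = 0")
    case False
    then have "0 < a" using a by simp
    have "t * a powr (p - 1) \<le> t powr p / p + (a powr (p - 1)) powr (p / (p - 1)) / (p / (p - 1))"
      using p that by (intro Youngs_inequality) (auto simp: field_simps)
    also have "(a powr (p - 1)) powr (p / (p - 1)) = a powr p" using p by (simp add: powr_powr)
    finally have "p * (t * a powr (p - 1)) \<le> p * (t powr p / p + a powr p / (p / (p - 1)))"
      using p by (intro mult_left_mono) auto
    also have "\<dots> = t powr p + (p - 1) * a powr p" using p by (simp add: field_simps)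
    finally show ?thesis by (simp add: mult_ac)
  qed simp
  have "ennreal (p * a powr (p - 1)) * h z \<le> epowr (h z) p + ennreal ((p - 1) * a powr p)" for z
  proof (cases "h z")
    case (real t)
    have "ennreal (p * a powr (p - 1)) * h z = ennreal (p * a powr (p - 1) * t)"
      unfolding real(2) using p real(1) by (intro ennreal_mult[symmetric]) auto
    also have "\<dots> \<le> ennreal (t powr p + (p - 1) * a powr p)" by (intro ennreal_leI young real)
    also have "\<dots> = epowr (h z) p + ennreal ((p - 1) * a powr p)"
      unfolding real(2) using p real(1) by (simp add: epowr_ennreal)
    finally show ?thesis .
  qed simp
  then have "(\<integral>\<^sup>+z\<in>B. (ennreal (p * a powr (p - 1)) * h z) \<partial>lborel)
     \<le> (\<integral>\<^sup>+z\<in>B. (epowr (h z) p + ennreal ((p - 1) * a powr p)) \<partial>lborel)"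
    by (intro nn_integral_mono mult_right_mono) auto
  then have "ennreal (p * a powr (p - 1) * y) \<le> ennreal (x + (p - 1) * a powr p * w)"
    unfolding int1 int2 x y using p y x \<open>0 < w\<close>
    by (simp add: ennreal_mult[symmetric] ennreal_plus[symmetric] del: ennreal_plus)
  then have "p * a powr (p - 1) * y \<le> x + (p - 1) * a powr p * w"
    using p x \<open>0 < w\<close> by (subst (asm) ennreal_le_iff) auto
  moreover have "a powr (p - 1) * y = a powr p * w"
  proof (cases "a = 0")
    case False
    then have "a powr p = a powr (p - 1) * a" using a by (simp add: powr_diff)
    then show ?thesis using \<open>0 < w\<close> by (simp add: a_def)
  qed (use p \<open>0 < w\<close> in \<open>simp add: a_def\<close>)
  ultimately have "a powr p * w \<le> x" by (simp add: algebra_simps)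
  then have "a powr p \<le> x / w" using \<open>0 < w\<close> by (simp add: field_simps)
  then have "ennreal (a powr p) \<le> ennreal (x / w)" by (rule ennreal_leI)
  then show ?thesis
    unfolding x(1) y(1) using a x y \<open>0 < w\<close> by (simp add: divide_ennreal epowr_ennreal a_def)
qed

lemma nn_integral_ball_affine:
  fixes h :: "'a::euclidean_space \<Rightarrow> ennreal"
  assumes h: "h \<in> borel_measurable borel" and "0 < s"
  shows "(\<integral>\<^sup>+y\<in>ball x s. h y \<partial>lborel) = ennreal (s ^ DIM('a)) * (\<integral>\<^sup>+z\<in>ball 0 1. h (x + s *\<^sub>R z) \<partial>lborel)"
proof -
  have [measurable]: "h \<in> borel_measurable borel" by fact
  have "(\<integral>\<^sup>+y\<in>ball x s. h y \<partial>lborel)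
    = (\<integral>\<^sup>+y. h y * indicator (ball x s) y \<partial>density (distr lborel borel (\<lambda>z. x + s *\<^sub>R z)) (\<lambda>_. \<bar>s\<bar> ^ DIM('a)))"
    by (subst lborel_affine[of s x, symmetric]) (use \<open>0 < s\<close> in auto)
  also have "\<dots> = (\<integral>\<^sup>+z. ennreal (s ^ DIM('a)) * (h (x + s *\<^sub>R z) * indicator (ball x s) (x + s *\<^sub>R z)) \<partial>lborel)"
    using \<open>0 < s\<close> by (simp add: nn_integral_density nn_integral_distr)
  also have "\<dots> = (\<integral>\<^sup>+z. ennreal (s ^ DIM('a)) * (h (x + s *\<^sub>R z) * indicator (ball 0 1) z) \<partial>lborel)"
    using \<open>0 < s\<close> by (intro nn_integral_cong) (auto simp: dist_norm split: split_indicator)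
  also have "\<dots> = ennreal (s ^ DIM('a)) * (\<integral>\<^sup>+z\<in>ball 0 1. h (x + s *\<^sub>R z) \<partial>lborel)"
    by (intro nn_integral_cmult) measurable
  finally show ?thesis .
qed

text \<open>The smoothing radius at \<open>x\<close> shrinks towards the boundary of \<open>G\<close> and is a \<open>1/2\<close>-Lipschitz
  function of \<open>x\<close>; hence radii at points of one smoothing ball are comparable.\<close>

definition smoothing_radius :: "'a::euclidean_space set \<Rightarrow> real \<Rightarrow> 'a \<Rightarrow> real" where
  "smoothing_radius G \<kappa> x = min \<kappa> (infdist x (- G)) / 2"

definition smoothed :: "'a::euclidean_space set \<Rightarrow> real \<Rightarrow> ('a \<Rightarrow> ennreal) \<Rightarrow> 'a \<Rightarrow> ennreal" where
  "smoothed G \<kappa> \<rho> x = (\<integral>\<^sup>+z\<in>ball 0 1. \<rho> (x + smoothing_radius G \<kappa> x *\<^sub>R z) \<partial>lborel)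
     / ennreal (measure lborel (ball (0::'a) 1))"

locale smoothing =
  fixes G :: "'a::euclidean_space set" and \<kappa> \<omega> :: real
  assumes volume: "\<omega> = measure lborel (ball (0::'a) 1)"
    and G: "open G" "G \<noteq> UNIV" and \<kappa>: "0 < \<kappa>"
begin

abbreviation "\<psi> \<equiv> smoothing_radius G \<kappa>"

lemma \<omega>: "0 < \<omega>" "emeasure lborel (ball (0::'a) 1) = ennreal \<omega>"
proof -
  show "0 < \<omega>" using content_ball_pos[of 1 "0::'a"] by (simp add: volume)
  have "emeasure lborel (ball (0::'a) 1) < \<infinity>" by (intro emeasure_bounded_finite) auto
  then show "emeasure lborel (ball (0::'a) 1) = ennreal \<omega>" by (simp add: volume emeasure_eq_ennreal_measure)
qed

lemma times_volume: "ennreal \<omega> * (i / ennreal \<omega>) = i"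
  using \<omega>(1) by (cases i) (simp_all add: divide_ennreal ennreal_top_divide ennreal_mult_top flip: ennreal_mult)

lemma radius_lipschitz: "\<bar>\<psi> x - \<psi> y\<bar> \<le> dist x y / 2"
  using infdist_triangle_abs[of x "- G" y] by (auto simp: smoothing_radius_def min_def abs_if)

lemma radius_pos: "x \<in> G \<Longrightarrow> 0 < \<psi> x"
  using infdist_pos_not_in_closed[of "- G" x] G \<kappa> by (auto simp: smoothing_radius_def)

lemma radius_nonneg: "0 \<le> \<psi> x"
  using \<kappa> infdist_nonneg[of x "- G"] by (simp add: smoothing_radius_def)

lemma radius_small: "\<psi> x < \<kappa>"
  using \<kappa> by (auto simp: smoothing_radius_def min_def)

lemma radius_ball: "x \<in> G \<Longrightarrow> dist x y \<le> \<psi> x \<Longrightarrow> y \<in> G"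
proof (rule ccontr)
  assume "x \<in> G" "dist x y \<le> \<psi> x" "y \<notin> G"
  then have "infdist x (- G) \<le> \<psi> x" by (meson ComplI infdist_le order_trans)
  moreover have "\<psi> x \<le> infdist x (- G) / 2" by (simp add: smoothing_radius_def)
  ultimately show False using radius_pos[OF \<open>x \<in> G\<close>] by linarith
qed

lemma continuous_radius: "continuous_on UNIV \<psi>"
  unfolding smoothing_radius_def by (intro continuous_intros) auto

lemma borel_measurable_radius [measurable]: "\<psi> \<in> borel_measurable borel"
  using continuous_radius by (rule borel_measurable_continuous_onI)

lemma borel_measurable_smoothed:
  assumes [measurable]: "\<rho> \<in> borel_measurable borel"
  shows "smoothed G \<kappa> \<rho> \<in> borel_measurable borel"
  unfolding smoothed_def by measurable

lemma smoothed_eq: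
  assumes "\<rho> \<in> borel_measurable borel" "x \<in> G"
  shows "smoothed G \<kappa> \<rho> x = (\<integral>\<^sup>+y\<in>ball x (\<psi> x). \<rho> y \<partial>lborel) / ennreal (\<omega> * \<psi> x ^ DIM('a))"
proof -
  have pos: "0 < \<psi> x ^ DIM('a)" using radius_pos[OF assms(2)] by simp
  have cancel: "i / ennreal \<omega> = ennreal (\<psi> x ^ DIM('a)) * i / ennreal (\<omega> * \<psi> x ^ DIM('a))" for i
  proof (cases i)
    case (real r)
    then show ?thesis using pos radius_pos[OF assms(2)] \<omega>(1)
      by (simp add: divide_ennreal flip: ennreal_mult)
  next
    case top
    then show ?thesis using pos radius_pos[OF assms(2)] \<omega>(1)
      by (simp add: ennreal_mult_top ennreal_top_divide)
  qed
  show ?thesis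
    unfolding smoothed_def volume[symmetric] nn_integral_ball_affine[OF assms(1) radius_pos[OF assms(2)]]
    by (rule cancel)
qed

lemma epowr_smoothed_le:
  assumes "1 < p" and [measurable]: "\<rho> \<in> borel_measurable borel"
  shows "epowr (smoothed G \<kappa> \<rho> x) p \<le> smoothed G \<kappa> (\<lambda>y. epowr (\<rho> y) p) x"
  unfolding smoothed_def volume[symmetric] using \<omega> by (intro powr_mean_le[OF \<open>1 < p\<close>]) auto

lemma smoothed_locally_bounded:
  assumes \<rho>: "\<rho> \<in> borel_measurable borel" and fin: "(\<integral>\<^sup>+y\<in>G. \<rho> y \<partial>lborel) < top" and "x \<in> G"
  shows "\<exists>r>0. \<exists>b\<ge>0. ball x r \<subseteq> G \<and> (\<forall>y\<in>ball x r. smoothed G \<kappa> \<rho> y \<le> ennreal b)"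
proof -
  obtain i where i: "(\<integral>\<^sup>+y\<in>G. \<rho> y \<partial>lborel) = ennreal i" "0 \<le> i"
    using fin by (cases "\<integral>\<^sup>+y\<in>G. \<rho> y \<partial>lborel") auto
  define b where "b = i / (\<omega> * (\<psi> x / 2) ^ DIM('a))"
  have "smoothed G \<kappa> \<rho> y \<le> ennreal b" if y: "y \<in> ball x (\<psi> x)" for y
  proof -
    have yG: "y \<in> G" using y \<open>x \<in> G\<close> by (intro radius_ball[of x y]) auto
    have half: "\<psi> x / 2 \<le> \<psi> y"
    proof -
      have "\<psi> x - \<psi> y \<le> dist x y / 2" using radius_lipschitz[of x y] by linarith
      moreover have "dist x y < \<psi> x" using y by simp
      ultimately show ?thesis by linarith
    qed
    have "(\<integral>\<^sup>+z\<in>ball y (\<psi> y). \<rho> z \<partial>lborel) \<le> (\<integral>\<^sup>+z\<in>G. \<rho> z \<partial>lborel)"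
      using radius_ball[OF yG] by (intro nn_integral_mono) (auto split: split_indicator)
    then have "smoothed G \<kappa> \<rho> y \<le> ennreal i / ennreal (\<omega> * \<psi> y ^ DIM('a))"
      unfolding smoothed_eq[OF \<rho> yG] i(1) by (rule divide_right_mono_ennreal)
    also have "\<dots> = ennreal (i / (\<omega> * \<psi> y ^ DIM('a)))"
      using i(2) \<omega>(1) radius_pos[OF yG] by (intro divide_ennreal) auto
    also have "\<dots> \<le> ennreal b"
      unfolding b_def using i(2) \<omega>(1) radius_pos[OF \<open>x \<in> G\<close>] half
      by (intro ennreal_leI divide_left_mono mult_left_mono power_mono mult_pos_pos) auto
    finally show ?thesis .
  qed
  moreover have "0 \<le> b" unfolding b_def using i \<omega> radius_pos[OF \<open>x \<in> G\<close>] by simp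
  moreover have "ball x (\<psi> x) \<subseteq> G" using radius_ball[OF \<open>x \<in> G\<close>] by auto
  ultimately show ?thesis using radius_pos[OF \<open>x \<in> G\<close>] by blast
qed

text \<open>Tonelli's theorem: a point \<open>y\<close> is averaged over only at points \<open>x\<close> within \<open>2 * \<psi> y\<close>, with a
  weight of at most \<open>(3/2)^n\<close> over the volume of the ball of radius \<open>\<psi> y\<close>.\<close>

lemma nn_integral_smoothed_le:
  assumes h[measurable]: "h \<in> borel_measurable borel"
  shows "(\<integral>\<^sup>+x\<in>G. smoothed G \<kappa> h x \<partial>lborel) \<le> ennreal (3 ^ DIM('a)) * (\<integral>\<^sup>+y. h y \<partial>lborel)"
proof -
  let ?n = "DIM('a)"
  have [measurable]: "G \<in> sets borel" using G by simp
  define k where "k y = ennreal ((3 / 2) ^ ?n / (\<omega> * \<psi> y ^ ?n))" for y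
  have [measurable]: "k \<in> borel_measurable borel" unfolding k_def by measurable
  have "(\<integral>\<^sup>+x\<in>G. smoothed G \<kappa> h x \<partial>lborel)
     \<le> (\<integral>\<^sup>+x. (\<integral>\<^sup>+y. h y * indicator G y * k y * (if dist y x < 2 * \<psi> y then 1 else 0) \<partial>lborel) \<partial>lborel)"
  proof (rule nn_integral_mono)
    fix x :: 'a
    show "smoothed G \<kappa> h x * indicator G x \<le> (\<integral>\<^sup>+y. h y * indicator G y * k y * (if dist y x < 2 * \<psi> y then 1 else 0) \<partial>lborel)"
    proof (cases "x \<in> G")
      case True
      have px: "0 < \<psi> x" using True by (rule radius_pos)
      have "smoothed G \<kappa> h x * indicator G x = (\<integral>\<^sup>+y. h y * indicator (ball x (\<psi> x)) y / ennreal (\<omega> * \<psi> x ^ ?n) \<partial>lborel)"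
        unfolding smoothed_eq[OF h True] using True by (simp add: nn_integral_divide)
      also have "\<dots> \<le> (\<integral>\<^sup>+y. h y * indicator G y * k y * (if dist y x < 2 * \<psi> y then 1 else 0) \<partial>lborel)"
      proof (rule nn_integral_mono)
        fix y :: 'a
        show "h y * indicator (ball x (\<psi> x)) y / ennreal (\<omega> * \<psi> x ^ ?n)
           \<le> h y * indicator G y * k y * (if dist y x < 2 * \<psi> y then 1 else 0)"
        proof (cases "y \<in> ball x (\<psi> x)")
          case y: True
          then have d: "dist y x < \<psi> x" by (simp add: dist_commute)
          have yG: "y \<in> G" using radius_ball[OF True, of y] y by simp
          have "\<psi> y \<le> 3 / 2 * \<psi> x" "\<psi> x < 2 * \<psi> y"
            using radius_lipschitz[of y x] d by linarith+
          then have close: "2 / 3 * \<psi> y \<le> \<psi> x" "dist y x < 2 * \<psi> y" using d by linarith+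
          have "(2 / 3 * \<psi> y) ^ ?n \<le> \<psi> x ^ ?n" using close radius_nonneg[of y] by (intro power_mono) auto
          then have "1 / (\<omega> * \<psi> x ^ ?n) \<le> 1 / (\<omega> * (2 / 3 * \<psi> y) ^ ?n)"
            using \<omega>(1) px radius_pos[OF yG] by (intro divide_left_mono mult_left_mono mult_pos_pos) auto
          also have "\<dots> = (3 / 2) ^ ?n / (\<omega> * \<psi> y ^ ?n)"
            by (simp add: power_mult_distrib power_divide field_simps)
          finally have "ennreal (1 / (\<omega> * \<psi> x ^ ?n)) \<le> k y" unfolding k_def by (rule ennreal_leI)
          moreover have "inverse (ennreal (\<omega> * \<psi> x ^ ?n)) = ennreal (1 / (\<omega> * \<psi> x ^ ?n))"
            using \<omega>(1) px by (subst inverse_ennreal) (auto simp: inverse_eq_divide)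
          ultimately have "h y * inverse (ennreal (\<omega> * \<psi> x ^ ?n)) \<le> h y * k y"
            by (intro mult_left_mono) auto
          then show ?thesis using y yG close by (simp add: divide_ennreal_def)
        qed simp
      qed
      finally show ?thesis .
    qed simp
  qed
  also have "\<dots> = (\<integral>\<^sup>+y. (\<integral>\<^sup>+x. h y * indicator G y * k y * (if dist y x < 2 * \<psi> y then 1 else 0) \<partial>lborel) \<partial>lborel)"
    by (rule lborel_pair.Fubini') measurable
  also have "\<dots> \<le> (\<integral>\<^sup>+y. ennreal (3 ^ ?n) * h y \<partial>lborel)"
  proof (rule nn_integral_mono)
    fix y :: 'a
    show "(\<integral>\<^sup>+x. h y * indicator G y * k y * (if dist y x < 2 * \<psi> y then 1 else 0) \<partial>lborel) \<le> ennreal (3 ^ ?n) * h y"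
    proof (cases "y \<in> G")
      case True
      have py: "0 < \<psi> y" using True by (rule radius_pos)
      have "(\<integral>\<^sup>+x. h y * indicator G y * k y * (if dist y x < 2 * \<psi> y then 1 else 0) \<partial>lborel)
        = (\<integral>\<^sup>+x. h y * k y * indicator (ball y (2 * \<psi> y)) x \<partial>lborel)"
        using True by (intro nn_integral_cong) (auto split: split_indicator)
      also have "\<dots> = h y * k y * emeasure lborel (ball y (2 * \<psi> y))"
        by (rule nn_integral_cmult_indicator) simp
      also have "emeasure lborel (ball y (2 * \<psi> y)) = ennreal (\<omega> * (2 * \<psi> y) ^ ?n)"
        using py by (simp add: emeasure_ball content_ball volume)
      also have "h y * k y * ennreal (\<omega> * (2 * \<psi> y) ^ ?n) = h y * (k y * ennreal (\<omega> * (2 * \<psi> y) ^ ?n))"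
        by (simp add: mult.assoc)
      also have "k y * ennreal (\<omega> * (2 * \<psi> y) ^ ?n) = ennreal ((3 / 2) ^ ?n / (\<omega> * \<psi> y ^ ?n) * (\<omega> * (2 * \<psi> y) ^ ?n))"
        unfolding k_def using py \<omega>(1) by (intro ennreal_mult[symmetric]) auto
      also have "(3 / 2) ^ ?n / (\<omega> * \<psi> y ^ ?n) * (\<omega> * (2 * \<psi> y) ^ ?n) = 3 ^ ?n"
        using py \<omega>(1) by (simp add: power_mult_distrib power_divide)
      finally show ?thesis by (simp add: mult.commute)
    qed simp
  qed
  also have "\<dots> = ennreal (3 ^ ?n) * (\<integral>\<^sup>+y. h y \<partial>lborel)" by (rule nn_integral_cmult) measurable
  finally show ?thesis .
qed

text \<open>For each \<open>z\<close> in the unit ball the displaced curve \<open>\<beta> + \<psi>(\<beta>) z\<close> is \<open>3/2\<close>-Lipschitz, so the integral of \<open>\<rho>\<close>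
  along it is at most \<open>3/2\<close> times the integral in the parameter of \<open>\<beta>\<close>. Averaging over \<open>z\<close> turns the latter
  into the integral of the smoothed density.\<close>

lemma smoothed_along_curve:
  assumes \<rho>[measurable]: "\<rho> \<in> borel_measurable borel" and "0 \<le> l"
    and \<beta>: "1-lipschitz_on {0..l} \<beta>"
    and disp: "\<And>z. norm z < 1 \<Longrightarrow> (3 / 2)-lipschitz_on {0..l} (\<lambda>t. \<beta> t + \<psi> (\<beta> t) *\<^sub>R z)
      \<Longrightarrow> 1 \<le> curve_integral ({0..l}, \<lambda>t. \<beta> t + \<psi> (\<beta> t) *\<^sub>R z) \<rho>"
  shows "ennreal (2 / 3) \<le> (\<integral>\<^sup>+t\<in>{0..l}. smoothed G \<kappa> \<rho> (\<beta> t) \<partial>lborel)"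
proof -
  define \<beta>' where "\<beta>' t = \<beta> (max 0 (min l t))" for t
  have "continuous_on UNIV \<beta>'"
    unfolding \<beta>'_def using \<open>0 \<le> l\<close>
    by (intro continuous_on_compose2[OF lipschitz_on_continuous_on[OF \<beta>]] continuous_intros) auto
  then have [measurable]: "\<beta>' \<in> borel_measurable borel" by (rule borel_measurable_continuous_onI)
  have \<beta>': "\<beta>' t = \<beta> t" if "t \<in> {0..l}" for t using that by (simp add: \<beta>'_def)
  have bound: "1 \<le> ennreal (3 / 2) * (\<integral>\<^sup>+t\<in>{0..l}. \<rho> (\<beta>' t + \<psi> (\<beta>' t) *\<^sub>R z) \<partial>lborel)" if z: "norm z < 1" for z
  proof -
    have lip: "(3 / 2)-lipschitz_on {0..l} (\<lambda>t. \<beta> t + \<psi> (\<beta> t) *\<^sub>R z)"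
    proof (rule lipschitz_onI)
      fix s t assume st: "s \<in> {0..l}" "t \<in> {0..l}"
      have b: "dist (\<beta> s) (\<beta> t) \<le> dist s t" using lipschitz_onD[OF \<beta> st] by simp
      have "dist (\<beta> s + \<psi> (\<beta> s) *\<^sub>R z) (\<beta> t + \<psi> (\<beta> t) *\<^sub>R z)
         = norm ((\<beta> s - \<beta> t) + (\<psi> (\<beta> s) - \<psi> (\<beta> t)) *\<^sub>R z)"
        by (simp add: dist_norm algebra_simps)
      also have "\<dots> \<le> dist (\<beta> s) (\<beta> t) + \<bar>\<psi> (\<beta> s) - \<psi> (\<beta> t)\<bar> * norm z"
        by (metis dist_norm norm_scaleR norm_triangle_ineq)
      also have "\<bar>\<psi> (\<beta> s) - \<psi> (\<beta> t)\<bar> * norm z \<le> (dist (\<beta> s) (\<beta> t) / 2) * 1"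
        using z by (intro mult_mono radius_lipschitz) auto
      finally show "dist (\<beta> s + \<psi> (\<beta> s) *\<^sub>R z) (\<beta> t + \<psi> (\<beta> t) *\<^sub>R z) \<le> 3 / 2 * dist s t"
        using b by simp
    qed simp
    have "1 \<le> curve_integral ({0..l}, \<lambda>t. \<beta> t + \<psi> (\<beta> t) *\<^sub>R z) \<rho>" by (rule disp[OF z lip])
    also have "\<dots> \<le> ennreal (3 / 2) * (\<integral>\<^sup>+t\<in>{0..l}. \<rho> (\<beta> t + \<psi> (\<beta> t) *\<^sub>R z) \<partial>lborel)"
      by (rule curve_integral_le_lipschitz[OF lip \<rho>])
    also have "(\<integral>\<^sup>+t\<in>{0..l}. \<rho> (\<beta> t + \<psi> (\<beta> t) *\<^sub>R z) \<partial>lborel)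
       = (\<integral>\<^sup>+t\<in>{0..l}. \<rho> (\<beta>' t + \<psi> (\<beta>' t) *\<^sub>R z) \<partial>lborel)"
      by (intro nn_integral_cong) (auto simp: \<beta>' split: split_indicator)
    finally show ?thesis .
  qed
  let ?k = "\<lambda>t z. \<rho> (\<beta>' t + \<psi> (\<beta>' t) *\<^sub>R z) * indicator {0..l} t * indicator (ball 0 1) z"
  have "ennreal \<omega> = (\<integral>\<^sup>+z. indicator (ball (0::'a) 1) z \<partial>lborel)" by (simp add: \<omega>(2))
  also have "\<dots> \<le> (\<integral>\<^sup>+z. ennreal (3 / 2) * (\<integral>\<^sup>+t. ?k t z \<partial>lborel) \<partial>lborel)"
    using bound by (intro nn_integral_mono) (auto split: split_indicator)
  also have "\<dots> = ennreal (3 / 2) * (\<integral>\<^sup>+z. (\<integral>\<^sup>+t. ?k t z \<partial>lborel) \<partial>lborel)"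
    by (rule nn_integral_cmult) measurable
  also have "(\<integral>\<^sup>+z. (\<integral>\<^sup>+t. ?k t z \<partial>lborel) \<partial>lborel) = (\<integral>\<^sup>+t. (\<integral>\<^sup>+z. ?k t z \<partial>lborel) \<partial>lborel)"
    by (rule lborel_pair.Fubini') measurable
  also have "\<dots> = (\<integral>\<^sup>+t. ennreal \<omega> * (smoothed G \<kappa> \<rho> (\<beta>' t) * indicator {0..l} t) \<partial>lborel)"
  proof (rule nn_integral_cong)
    fix t :: real
    have "ennreal \<omega> * smoothed G \<kappa> \<rho> (\<beta>' t) = (\<integral>\<^sup>+z\<in>ball 0 1. \<rho> (\<beta>' t + \<psi> (\<beta>' t) *\<^sub>R z) \<partial>lborel)"
      unfolding smoothed_def volume[symmetric] by (rule times_volume)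
    then show "(\<integral>\<^sup>+z. ?k t z \<partial>lborel) = ennreal \<omega> * (smoothed G \<kappa> \<rho> (\<beta>' t) * indicator {0..l} t)"
      by (simp split: split_indicator)
  qed
  also have "\<dots> = ennreal \<omega> * (\<integral>\<^sup>+t\<in>{0..l}. smoothed G \<kappa> \<rho> (\<beta>' t) \<partial>lborel)"
  proof -
    have [measurable]: "smoothed G \<kappa> \<rho> \<in> borel_measurable borel" using \<rho> by (rule borel_measurable_smoothed)
    show ?thesis by (rule nn_integral_cmult) measurable
  qed
  also have "(\<integral>\<^sup>+t\<in>{0..l}. smoothed G \<kappa> \<rho> (\<beta>' t) \<partial>lborel) = (\<integral>\<^sup>+t\<in>{0..l}. smoothed G \<kappa> \<rho> (\<beta> t) \<partial>lborel)"
    by (intro nn_integral_cong) (auto simp: \<beta>' split: split_indicator)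
  finally have *: "ennreal \<omega> \<le> ennreal (3 / 2) * (ennreal \<omega> * (\<integral>\<^sup>+t\<in>{0..l}. smoothed G \<kappa> \<rho> (\<beta> t) \<partial>lborel))" .
  show ?thesis
  proof (cases "(\<integral>\<^sup>+t\<in>{0..l}. smoothed G \<kappa> \<rho> (\<beta> t) \<partial>lborel)")
    case (real c)
    have "ennreal (3 / 2 * (\<omega> * c)) = ennreal (3 / 2) * ennreal (\<omega> * c)"
      using real(1) \<omega>(1) by (intro ennreal_mult) auto
    also have "ennreal (\<omega> * c) = ennreal \<omega> * ennreal c"
      using real(1) \<omega>(1) by (intro ennreal_mult) auto
    finally have "ennreal \<omega> \<le> ennreal (3 / 2 * (\<omega> * c))" using * unfolding real(2) by simp
    then have "\<omega> \<le> 3 / 2 * (\<omega> * c)" using real(1) \<omega>(1) by (subst (asm) ennreal_le_iff) auto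
    then have "\<omega> * 1 \<le> \<omega> * (3 / 2 * c)" by simp
    then have "2 / 3 \<le> c" using \<omega>(1) by (subst (asm) mult_le_cancel_left_pos) auto
    then show ?thesis unfolding real(2) by (rule ennreal_leI)
  qed simp
qed

end

section \<open>Diameters and admissible densities\<close>

text \<open>A density \<open>\<rho>\<close> that is admissible for the curves from \<open>U\<close> to \<open>V\<close> is smoothed at so small a scale that
  curves from \<open>E\<close> to \<open>F\<close>, once displaced, still lead from \<open>U\<close> to \<open>V\<close>. The smoothed density is locally
  bounded, so it is an upper gradient of a continuous potential to which the capacity bound applies.\<close>

theorem min_diameter_le_energy:
  fixes G :: "'a::euclidean_space set"
  assumes n: "real DIM('a) - 1 < p" and p: "1 < p"
    and G: "open G" "G \<noteq> {}" "bounded G" "Ahlfors_regular G" "Poincare_inequality p G"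
  shows "\<exists>M>0. \<forall>E F U V \<rho>. compact E \<and> connected E \<and> E \<noteq> {} \<and> E \<subseteq> G \<and>
      compact F \<and> connected F \<and> F \<noteq> {} \<and> F \<subseteq> G \<and> open U \<and> open V \<and> E \<subseteq> U \<and> F \<subseteq> V \<and>
      \<rho> \<in> borel_measurable borel \<and>
      (\<forall>l L \<beta>. 0 \<le> l \<and> L-lipschitz_on {0..l} \<beta> \<and> \<beta> ` {0..l} \<subseteq> G \<and> \<beta> 0 \<in> U \<and> \<beta> l \<in> V \<longrightarrow>
         1 \<le> curve_integral ({0..l}, \<beta>) \<rho>) \<longrightarrow>
      ennreal (min (diameter E) (diameter F)) \<le> ennreal M * (\<integral>\<^sup>+z. epowr (\<rho> z) p \<partial>lborel)"
proof -
  obtain M where M: "M > 0" and cap: "\<forall>u g E F. continuous_on G u \<and> (\<forall>z\<in>G. 0 \<le> u z \<and> u z \<le> 1) \<and> upper_gradient G u g \<and>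
      compact E \<and> connected E \<and> E \<noteq> {} \<and> E \<subseteq> G \<and> (\<forall>z\<in>E. u z = 0) \<and>
      compact F \<and> connected F \<and> F \<noteq> {} \<and> F \<subseteq> G \<and> (\<forall>z\<in>F. 2 / 3 \<le> u z) \<longrightarrow>
      ennreal (min (diameter E) (diameter F)) \<le> ennreal M * energy p g G"
    using capacity_lower_bound[OF n _ G] p by auto
  have main: "ennreal (min (diameter E) (diameter F)) \<le> ennreal (M * 3 ^ DIM('a)) * (\<integral>\<^sup>+z. epowr (\<rho> z) p \<partial>lborel)"
    if E: "compact E" "connected E" "E \<noteq> {}" "E \<subseteq> G" and F: "compact F" "connected F" "F \<noteq> {}" "F \<subseteq> G"
      and UV: "open U" "open V" "E \<subseteq> U" "F \<subseteq> V" and \<rho>[measurable]: "\<rho> \<in> borel_measurable borel"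
      and adm: "\<forall>l L \<beta>. 0 \<le> l \<and> L-lipschitz_on {0..l} \<beta> \<and> \<beta> ` {0..l} \<subseteq> G \<and> \<beta> 0 \<in> U \<and> \<beta> l \<in> V \<longrightarrow>
         1 \<le> curve_integral ({0..l}, \<beta>) \<rho>" for E F U V \<rho>
  proof (cases "(\<integral>\<^sup>+z. epowr (\<rho> z) p \<partial>lborel) = top")
    case True
    then show ?thesis using M by (simp add: ennreal_mult_top)
  next
    case False
    obtain \<kappa>1 where \<kappa>1: "\<kappa>1 > 0" "(\<Union>x\<in>E. ball x \<kappa>1) \<subseteq> U"
      using compact_subset_open_imp_ball_epsilon_subset[OF E(1) UV(1,3)] by metis
    obtain \<kappa>2 where \<kappa>2: "\<kappa>2 > 0" "(\<Union>x\<in>F. ball x \<kappa>2) \<subseteq> V"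
      using compact_subset_open_imp_ball_epsilon_subset[OF F(1) UV(2,4)] by metis
    define \<kappa> where "\<kappa> = min \<kappa>1 \<kappa>2"
    have "G \<noteq> UNIV" using G(3) not_bounded_UNIV by blast
    then interpret sm: smoothing G \<kappa> "measure lborel (ball (0::'a) 1)"
      using G(1) \<kappa>1 \<kappa>2 by unfold_locales (auto simp: \<kappa>_def)
    let ?g = "smoothed G \<kappa> \<rho>"
    have g: "?g \<in> borel_measurable borel" using \<rho> by (rule sm.borel_measurable_smoothed)
    have "(\<integral>\<^sup>+y\<in>G. \<rho> y \<partial>lborel) \<le> (\<integral>\<^sup>+y. epowr (\<rho> y) p + indicator G y \<partial>lborel)"
      using p le_epowr_plus_1[of p] by (intro nn_integral_mono) (auto split: split_indicator)
    also have "\<dots> = (\<integral>\<^sup>+y. epowr (\<rho> y) p \<partial>lborel) + emeasure lborel G"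
      using G(1) by (subst nn_integral_add) auto
    also have "\<dots> < top"
      using False emeasure_bounded_finite[OF G(3)] by (simp add: less_top)
    finally have fin: "(\<integral>\<^sup>+y\<in>G. \<rho> y \<partial>lborel) < top" .
    have long: "ennreal (2 / 3) \<le> cost ?g l \<beta>"
      if \<beta>: "0 \<le> l" "1-lipschitz_on {0..l} \<beta>" "\<beta> ` {0..l} \<subseteq> G" "\<beta> 0 \<in> E" "\<beta> l \<in> F" for l \<beta>
      unfolding cost_def
    proof (rule sm.smoothed_along_curve[OF \<rho> \<beta>(1,2)])
      fix z :: 'a
      assume z: "norm z < 1" and lip: "(3 / 2)-lipschitz_on {0..l} (\<lambda>t. \<beta> t + smoothing_radius G \<kappa> (\<beta> t) *\<^sub>R z)"
      have disp: "dist (\<beta> t) (\<beta> t + smoothing_radius G \<kappa> (\<beta> t) *\<^sub>R z) \<le> smoothing_radius G \<kappa> (\<beta> t)" for t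
        using z sm.radius_nonneg[of "\<beta> t"] by (simp add: dist_norm mult_left_le)
      have "\<beta> t + smoothing_radius G \<kappa> (\<beta> t) *\<^sub>R z \<in> G" if "t \<in> {0..l}" for t
      proof (rule sm.radius_ball)
        show "\<beta> t \<in> G" using \<beta>(3) that by blast
      qed (rule disp)
      moreover have near: "\<beta> t + smoothing_radius G \<kappa> (\<beta> t) *\<^sub>R z \<in> ball (\<beta> t) \<kappa>" for t
        using disp[of t] sm.radius_small[of "\<beta> t"] by simp
      moreover have "\<beta> 0 + smoothing_radius G \<kappa> (\<beta> 0) *\<^sub>R z \<in> U"
      proof -
        have "\<beta> 0 + smoothing_radius G \<kappa> (\<beta> 0) *\<^sub>R z \<in> ball (\<beta> 0) \<kappa>1" using near[of 0] by (simp add: \<kappa>_def)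
        then show ?thesis using \<kappa>1(2) \<beta>(4) by blast
      qed
      moreover have "\<beta> l + smoothing_radius G \<kappa> (\<beta> l) *\<^sub>R z \<in> V"
      proof -
        have "\<beta> l + smoothing_radius G \<kappa> (\<beta> l) *\<^sub>R z \<in> ball (\<beta> l) \<kappa>2" using near[of l] by (simp add: \<kappa>_def)
        then show ?thesis using \<kappa>2(2) \<beta>(5) by blast
      qed
      ultimately show "1 \<le> curve_integral ({0..l}, \<lambda>t. \<beta> t + smoothing_radius G \<kappa> (\<beta> t) *\<^sub>R z) \<rho>"
        using \<beta>(1) lip by (intro adm[rule_format] conjI) auto
    qed
    have "\<exists>u. continuous_on G u \<and> (\<forall>z\<in>G. 0 \<le> u z \<and> u z \<le> 1) \<and> upper_gradient G u ?g \<and>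
        (\<forall>z\<in>E. u z = 0) \<and> (\<forall>z\<in>F. 2 / 3 \<le> u z)"
      using sm.smoothed_locally_bounded[OF \<rho> fin]
      by (intro potential_with_upper_gradient G(1) g E(4) long) auto
    then have "ennreal (min (diameter E) (diameter F)) \<le> ennreal M * energy p ?g G"
      using cap E F by blast
    also have "energy p ?g G = (\<integral>\<^sup>+z\<in>G. epowr (?g z) p \<partial>lborel)"
      by (rule nn_integral_completion)
    also have "\<dots> \<le> (\<integral>\<^sup>+z\<in>G. smoothed G \<kappa> (\<lambda>y. epowr (\<rho> y) p) z \<partial>lborel)"
      by (intro nn_integral_mono mult_right_mono sm.epowr_smoothed_le p \<rho>) auto
    also have "\<dots> \<le> ennreal (3 ^ DIM('a)) * (\<integral>\<^sup>+y. epowr (\<rho> y) p \<partial>lborel)"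
      by (rule sm.nn_integral_smoothed_le) measurable
    finally show ?thesis using M by (simp add: ennreal_mult mult.assoc mult_left_mono)
  qed
  show ?thesis
  proof (intro exI[of _ "M * 3 ^ DIM('a)"] conjI allI impI, goal_cases)
    case 1
    then show ?case using M by simp
  next
    case (2 E F U V \<rho>)
    then show ?case by (elim conjE) (rule main; assumption)
  qed
qed

section \<open>The integral over a ring\<close>

text \<open>For \<open>p = n\<close> the summands are \<open>1\<close> and their number is of order \<open>L\<close>; for \<open>p < n\<close> the series
  converges, while the exponent \<open>p - n + 1\<close> is positive.\<close>

lemma sum_powers_le_log:
  assumes n: "real n - 1 < p" "p \<le> real n"
  shows "\<exists>A>0. \<forall>L\<ge>1. \<forall>N. real N \<le> L / ln 2 + 1 \<longrightarrow> (\<Sum>k<N. (2 powr (p - n)) ^ k) \<le> A * L powr (p - n + 1)"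
proof (cases "p = real n")
  case True
  have "(\<Sum>k<N. (2 powr (p - n)) ^ k) \<le> 3 * L powr (p - n + 1)" if "L \<ge> 1" "real N \<le> L / ln 2 + 1" for L N
  proof -
    have "L / ln 2 \<le> L / (1 / 2)"
      using that(1) ln2_ge_two_thirds by (intro divide_left_mono) auto
    then have "real N \<le> 3 * L" using that by simp
    then show ?thesis using True that(1) by simp
  qed
  then show ?thesis by (intro exI[of _ 3]) auto
next
  case False
  define s where "s = (2::real) powr (p - n)"
  have s: "0 < s" "s < 1" unfolding s_def using False n by (auto simp: powr_less_one)
  have "(\<Sum>k<N. s ^ k) \<le> 1 / (1 - s) * L powr (p - n + 1)" if "L \<ge> 1" for L :: real and N
  proof -
    have "(\<Sum>k<N. s ^ k) = (1 - s ^ N) / (1 - s)" using s by (simp add: sum_gp_strict)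
    also have "\<dots> \<le> 1 / (1 - s)" using s by (intro divide_right_mono) auto
    also have "\<dots> \<le> 1 / (1 - s) * L powr (p - n + 1)"
      using mult_left_mono[of 1 "L powr (p - n + 1)" "1 / (1 - s)"]
        s(2) that n ge_one_powr_ge_zero[of L "p - n + 1"] by simp
    finally show ?thesis .
  qed
  then show ?thesis using s unfolding s_def[symmetric] by (intro exI[of _ "1 / (1 - s)"]) auto
qed

text \<open>The ring is cut into dyadic rings. On the \<open>k\<close>-th one \<open>|x - x0|\<close> is comparable to \<open>r2 / 2^k\<close>, and
  its \<open>Q\<close>-mass is at most of order \<open>(r2 / 2^k)^n\<close>.\<close>

theorem ring_integral_le_log:
  fixes p B :: real
  assumes n: "real DIM('a::euclidean_space) - 1 < p" "p \<le> real DIM('a)" and "0 < p" "0 < B"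
  shows "\<exists>A>0. \<forall>Q (x0::'a) r1 r2. Q \<in> borel_measurable lebesgue \<and> 0 < r1 \<and> r1 < r2 \<and> r2 \<le> 1 \<and> 1 \<le> ln (r2 / r1) \<and>
     (\<forall>r. 0 < r \<and> r \<le> r2 \<longrightarrow> (\<integral>\<^sup>+x\<in>ball x0 r. Q x \<partial>lebesgue) \<le> ennreal (B * r ^ DIM('a))) \<longrightarrow>
     (\<integral>\<^sup>+ x\<in>{x. r1 < norm (x - x0) \<and> norm (x - x0) < r2}.
         Q x * epowr (ennreal (1 / (norm (x - x0) * ln (r2 / r1)))) p \<partial>lebesgue)
       \<le> ennreal (A / ln (r2 / r1) ^ (DIM('a) - 1))"
proof -
  let ?n = "DIM('a)"
  obtain A0 where A0: "A0 > 0" "\<And>L N. L \<ge> 1 \<Longrightarrow> real N \<le> L / ln 2 + 1 \<Longrightarrow>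
      (\<Sum>k<N. (2 powr (p - ?n)) ^ k) \<le> A0 * L powr (p - ?n + 1)"
    using sum_powers_le_log[OF n] by blast
  define A where "A = B * 2 powr p * A0"
  have "(\<integral>\<^sup>+ x\<in>{x. r1 < norm (x - x0) \<and> norm (x - x0) < r2}.
         Q x * epowr (ennreal (1 / (norm (x - x0) * ln (r2 / r1)))) p \<partial>lebesgue)
       \<le> ennreal (A / ln (r2 / r1) ^ (?n - 1))"
    if Q[measurable]: "Q \<in> borel_measurable lebesgue" and r: "0 < r1" "r1 < r2" "r2 \<le> 1" "1 \<le> ln (r2 / r1)"
      and mass: "\<And>r. 0 < r \<Longrightarrow> r \<le> r2 \<Longrightarrow> (\<integral>\<^sup>+x\<in>ball x0 r. Q x \<partial>lebesgue) \<le> ennreal (B * r ^ ?n)"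
    for Q and x0 :: 'a and r1 r2 :: real
  proof -
    define L where "L = ln (r2 / r1)"
    have L: "L \<ge> 1" using r by (simp add: L_def)
    define N where "N = nat \<lceil>log 2 (r2 / r1)\<rceil>"
    have log_pos: "0 \<le> log 2 (r2 / r1)" using r by simp
    have N: "log 2 (r2 / r1) \<le> N" "N \<le> log 2 (r2 / r1) + 1"
      unfolding N_def using log_pos by linarith+
    then have N_L: "real N \<le> L / ln 2 + 1" by (simp add: log_def L_def)
    have "r2 / r1 = 2 powr log 2 (r2 / r1)" using r by simp
    also have "\<dots> \<le> 2 powr N" using N by (intro powr_mono) auto
    also have "\<dots> = 2 ^ N" by (simp add: powr_realpow)
    finally have N_r: "r2 / 2 ^ N \<le> r1" using r by (simp add: field_simps)
    define c where "c k = (2 ^ Suc k / (r2 * L)) powr p" for k :: nat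
    have pointwise: "Q x * epowr (ennreal (1 / (norm (x - x0) * L))) p * indicator {x. r1 < norm (x - x0) \<and> norm (x - x0) < r2} x
       \<le> (\<Sum>k<N. ennreal (c k) * (Q x * indicator (ball x0 (r2 / 2 ^ k)) x))" for x
    proof (cases "r1 < norm (x - x0) \<and> norm (x - x0) < r2")
      case True
      define t where "t = norm (x - x0)"
      have t: "r1 < t" "t < r2" using True by (auto simp: t_def)
      define j where "j = (LEAST j::nat. r2 / 2 ^ j \<le> t)"
      have "r2 / 2 ^ N \<le> t" using N_r t by simp
      then have j: "r2 / 2 ^ j \<le> t" "j \<le> N" unfolding j_def by (auto intro: LeastI Least_le)
      have "j \<noteq> 0" using j(1) t by (intro notI) simp
      then obtain k where k: "j = Suc k" by (cases j) auto
      have "\<not> r2 / 2 ^ k \<le> t" using not_less_Least[of k "\<lambda>j. r2 / 2 ^ j \<le> t"] k by (simp add: j_def)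
      then have xk: "indicator (ball x0 (r2 / 2 ^ k)) x = (1::ennreal)"
        by (simp add: t_def dist_norm norm_minus_commute)
      have kN: "k < N" using j(2) k by simp
      have "1 / (t * L) \<le> 1 / (r2 / 2 ^ Suc k * L)"
        using j(1) k r L t by (intro divide_left_mono mult_right_mono mult_pos_pos) auto
      then have "(1 / (t * L)) powr p \<le> c k"
        unfolding c_def using t r L \<open>0 < p\<close> by (intro powr_mono2) (auto simp: field_simps)
      then have "epowr (ennreal (1 / (t * L))) p \<le> ennreal (c k)"
        using t r L by (subst epowr_ennreal) (auto intro: ennreal_leI)
      then have "Q x * epowr (ennreal (1 / (t * L))) p \<le> ennreal (c k) * (Q x * indicator (ball x0 (r2 / 2 ^ k)) x)"
      proof -
        assume "epowr (ennreal (1 / (t * L))) p \<le> ennreal (c k)"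
        then have "Q x * epowr (ennreal (1 / (t * L))) p \<le> Q x * ennreal (c k)" by (rule mult_left_mono) simp
        then show ?thesis unfolding xk by (simp add: mult.commute)
      qed
      also have "\<dots> \<le> (\<Sum>k<N. ennreal (c k) * (Q x * indicator (ball x0 (r2 / 2 ^ k)) x))"
        using kN by (intro member_le_sum) auto
      finally show ?thesis using True by (simp add: t_def)
    qed simp
    have "(\<integral>\<^sup>+ x\<in>{x. r1 < norm (x - x0) \<and> norm (x - x0) < r2}.
         Q x * epowr (ennreal (1 / (norm (x - x0) * L))) p \<partial>lebesgue)
      \<le> (\<integral>\<^sup>+x. (\<Sum>k<N. ennreal (c k) * (Q x * indicator (ball x0 (r2 / 2 ^ k)) x)) \<partial>lebesgue)"
      by (intro nn_integral_mono pointwise)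
    also have "\<dots> = (\<Sum>k<N. ennreal (c k) * (\<integral>\<^sup>+x\<in>ball x0 (r2 / 2 ^ k). Q x \<partial>lebesgue))"
      by (subst nn_integral_sum) (auto intro!: sum.cong nn_integral_cmult borel_measurable_times_ennreal borel_measurable_indicator)
    also have "\<dots> \<le> (\<Sum>k<N. ennreal (c k) * ennreal (B * (r2 / 2 ^ k) ^ ?n))"
    proof (intro sum_mono mult_left_mono mass)
      fix k
      show "0 < r2 / 2 ^ k" using r by simp
      have "(1::real) \<le> 2 ^ k" by simp
      then show "r2 / 2 ^ k \<le> r2" using r by (simp add: divide_le_eq mult_le_cancel_left1)
    qed auto
    also have "\<dots> = (\<Sum>k<N. ennreal (c k * (B * (r2 / 2 ^ k) ^ ?n)))"
      using \<open>0 < B\<close> r by (intro sum.cong ennreal_mult[symmetric]) (auto simp: c_def)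
    also have "\<dots> = ennreal (\<Sum>k<N. c k * (B * (r2 / 2 ^ k) ^ ?n))"
      using \<open>0 < B\<close> r by (intro sum_ennreal) (auto simp: c_def)
    also have "\<dots> \<le> ennreal (A / L ^ (?n - 1))"
    proof (rule ennreal_leI)
      have summand: "c k * (B * (r2 / 2 ^ k) ^ ?n) = (B * 2 powr p * r2 powr (?n - p) * L powr (-p)) * (2 powr (p - ?n)) ^ k" for k
      proof -
        define X where "X = (2 powr real k) powr p"
        define Y where "Y = (2 powr real k) powr real ?n"
        have "c k = (2 powr p * X) / (r2 powr p * L powr p)"
          unfolding c_def X_def using r L by (simp add: powr_divide powr_mult powr_realpow)
        moreover have "(r2 / 2 ^ k) ^ ?n = r2 powr ?n / Y"
        proof -
          have "(r2 / 2 ^ k) ^ ?n = r2 ^ ?n / (2 ^ k) ^ ?n" by (rule power_divide)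
          also have "r2 ^ ?n = r2 powr ?n" using r by (simp add: powr_realpow)
          also have "(2 ^ k) ^ ?n = Y" unfolding Y_def by (simp add: powr_realpow)
          finally show ?thesis .
        qed
        moreover have "(2 powr (p - ?n)) ^ k = X / Y"
        proof -
          have "(2 powr (p - ?n)) ^ k = (2 powr (p - ?n)) powr real k" by (simp add: powr_realpow)
          also have "\<dots> = (2 powr real k) powr (p - ?n)" unfolding powr_powr by (simp only: mult.commute)
          also have "\<dots> = X / Y" unfolding X_def Y_def by (rule powr_diff)
          finally show ?thesis .
        qed
        moreover have "r2 powr (?n - p) = r2 powr ?n / r2 powr p" by (rule powr_diff)
        moreover have "L powr (-p) = inverse (L powr p)" by (rule powr_minus)
        ultimately show ?thesis
          by (simp add: divide_inverse inverse_mult_distrib mult_ac)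
      qed
      have "(\<Sum>k<N. c k * (B * (r2 / 2 ^ k) ^ ?n))
         = (B * 2 powr p * r2 powr (?n - p) * L powr (-p)) * (\<Sum>k<N. (2 powr (p - ?n)) ^ k)"
        unfolding summand by (simp add: sum_distrib_left)
      also have "\<dots> \<le> (B * 2 powr p * 1 * L powr (-p)) * (A0 * L powr (p - ?n + 1))"
      proof (rule mult_mono)
        have "r2 powr (?n - p) \<le> 1" using r n by (intro powr_le1) auto
        then show "B * 2 powr p * r2 powr (?n - p) * L powr (-p) \<le> B * 2 powr p * 1 * L powr (-p)"
          using \<open>0 < B\<close> by (intro mult_right_mono mult_left_mono) auto
        show "(\<Sum>k<N. (2 powr (p - ?n)) ^ k) \<le> A0 * L powr (p - ?n + 1)" by (rule A0(2)[OF L N_L])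
      qed (use \<open>0 < B\<close> in \<open>auto intro!: sum_nonneg\<close>)
      also have "\<dots> = A * (L powr (-p) * L powr (p - ?n + 1))" by (simp add: A_def)
      also have "L powr (-p) * L powr (p - ?n + 1) = L powr (- real (?n - 1))"
        by (simp add: powr_add[symmetric] of_nat_diff DIM_ge_Suc0 algebra_simps)
      also have "\<dots> = 1 / L ^ (?n - 1)"
      proof -
        have "L powr real (?n - 1) = L ^ (?n - 1)" using L by (intro powr_realpow) simp
        then show ?thesis unfolding powr_minus by (simp only: inverse_eq_divide)
      qed
      finally show "(\<Sum>k<N. c k * (B * (r2 / 2 ^ k) ^ ?n)) \<le> A / L ^ (?n - 1)" by simp
    qed
    finally show ?thesis by (simp add: L_def)
  qed
  moreover have "A > 0" using A0 \<open>0 < B\<close> by (simp add: A_def)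
  ultimately show ?thesis by blast
qed

lemma nn_integral_reciprocal_log:
  assumes "0 < r1" "r1 < r2"
  shows "(\<integral>\<^sup>+ r\<in>{r1<..<r2}. ennreal (1 / (r * ln (r2 / r1))) \<partial>lebesgue) = 1"
proof -
  define L where "L = ln (r2 / r1)"
  have L: "L > 0" using assms by (simp add: L_def)
  have "(\<integral>\<^sup>+ r\<in>{r1<..<r2}. ennreal (1 / (r * L)) \<partial>lebesgue) = (\<integral>\<^sup>+ r\<in>{r1<..<r2}. ennreal (1 / (r * L)) \<partial>lborel)"
    by (rule nn_integral_completion)
  also have "\<dots> = (\<integral>\<^sup>+ r\<in>{r1..r2}. ennreal (1 / (r * L)) \<partial>lborel)"
  proof (rule nn_integral_cong_AE)
    have "AE r in lborel. r \<noteq> r1" "AE r in lborel. r \<noteq> r2" by (rule AE_lborel_singleton)+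
    then show "AE r in lborel. ennreal (1 / (r * L)) * indicator {r1<..<r2} r = ennreal (1 / (r * L)) * indicator {r1..r2} r"
      by eventually_elim (auto split: split_indicator)
  qed
  also have "\<dots> = ennreal (ln r2 / L - ln r1 / L)"
    using assms L by (intro nn_integral_FTC_Icc) (auto intro!: derivative_eq_intros simp: field_simps)
  also have "ln r2 / L - ln r1 / L = 1"
    using assms L by (simp add: L_def ln_div diff_divide_distrib[symmetric])
  finally show ?thesis by (simp add: L_def)
qed

section \<open>Closed maps are proper\<close>

lemma in_ext_boundary_if_limit:
  assumes "\<And>k. X k \<in> D" "limitin ext_space (\<lambda>k. Some (X k)) w sequentially" "w \<notin> Some ` D"
  shows "w \<in> ext_boundary D"
proof -
  have w: "w \<in> topspace ext_space" using assms(2) by (rule limitin_topspace)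
  have "\<exists>y. y \<in> Some ` D \<and> y \<in> T" if T: "w \<in> T" "openin ext_space T" for T
  proof -
    have "\<forall>\<^sub>F k in sequentially. Some (X k) \<in> T" using assms(2) T by (simp add: limitin_def)
    then obtain k where "Some (X k) \<in> T" by (auto simp: eventually_sequentially)
    then show ?thesis using assms(1) by blast
  qed
  then have "w \<in> ext_space closure_of (Some ` D)" using w by (simp add: in_closure_of)
  moreover have "w \<notin> ext_space interior_of (Some ` D)"
    using interior_of_subset[of ext_space "Some ` D"] assms(3) by blast
  ultimately show ?thesis by (simp add: ext_boundary_def frontier_of_def)
qed

lemma not_in_ext_boundary_open:
  assumes "open D" "x \<in> D"
  shows "Some x \<notin> ext_boundary D"
proof -
  have "openin ext_space (Some ` D)" using assms(1) by (simp add: open_openin[symmetric])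
  then have "ext_space interior_of (Some ` D) = Some ` D" by (rule interior_of_openin)
  then show ?thesis using assms(2) by (auto simp: ext_boundary_def frontier_of_def)
qed

lemma limitin_ext_space_Some:
  assumes "X \<longlonglongrightarrow> x"
  shows "limitin ext_space (\<lambda>k. Some (X k)) (Some x) sequentially"
proof -
  have "limitin euclidean X x sequentially" using assms by simp
  then have "limitin ext_space (Some \<circ> X) (Some x) sequentially"
    by (rule continuous_map_limit[OF continuous_map_Some])
  then show ?thesis by (simp add: comp_def)
qed

lemma limitin_ext_space_None:
  fixes X :: "nat \<Rightarrow> 'a::euclidean_space"
  assumes "\<And>k. real k \<le> norm (X k)"
  shows "limitin ext_space (\<lambda>k. Some (X k)) None sequentially"
  unfolding limitin_def
proof (intro conjI allI impI)
  show "None \<in> topspace (ext_space :: 'a option topology)" by simp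
  fix U :: "'a option set" assume "openin ext_space U \<and> None \<in> U"
  then obtain C :: "'a set" where C: "compact C" "U = insert None (Some ` (UNIV - C))"
    by (auto simp: openin_Alexandroff_compactification)
  obtain b where b: "\<And>x. x \<in> C \<Longrightarrow> norm x \<le> b" using compact_imp_bounded[OF C(1)] by (auto simp: bounded_iff)
  obtain m :: nat where m: "b < real m" using reals_Archimedean2 by blast
  have "Some (X k) \<in> U" if "m \<le> k" for k
  proof -
    have "b < norm (X k)" using m that assms[of k] by (meson less_le_trans of_nat_le_iff)
    then have "X k \<notin> C" using b[of "X k"] by auto
    then show ?thesis by (simp add: C(2))
  qed
  then show "\<forall>\<^sub>F k in sequentially. Some (X k) \<in> U" by (auto simp: eventually_sequentially)
qed

text \<open>A sequence in the preimage of a compact set cannot approach the boundary of \<open>D\<close>, the point at infinity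
  included: along a subsequence its images would converge to an interior point of \<open>D'\<close>.\<close>

lemma closed_mapping_imp_proper:
  fixes f :: "'a::euclidean_space \<Rightarrow> 'a"
  assumes "open D" "open D'" and contf: "continuous_on D f" and cl: "closed_mapping_on D D' f"
    and K: "compact K" "K \<subseteq> D'"
  shows "compact {x \<in> D. f x \<in> K}"
proof -
  let ?S = "{x \<in> D. f x \<in> K}"
  have no: False if X: "\<And>k. X k \<in> ?S" and lim: "limitin ext_space (\<lambda>k. Some (X k)) w sequentially"
    and w: "w \<notin> Some ` D" for X w
  proof -
    have fX: "f (X k) \<in> K" for k using X by blast
    have "\<exists>y\<in>K. \<exists>r. strict_mono r \<and> ((\<lambda>k. f (X k)) \<circ> r) \<longlonglongrightarrow> y"
      by (rule K(1)[unfolded compact_def, rule_format, of "\<lambda>k. f (X k)"]) (rule fX)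
    then obtain y and r :: "nat \<Rightarrow> nat" where y: "y \<in> K" "strict_mono r" "((\<lambda>k. f (X k)) \<circ> r) \<longlonglongrightarrow> y"
      by blast
    have "limitin ext_space ((\<lambda>k. Some (X k)) \<circ> r) w sequentially"
      using y(2) lim by (rule limitin_subsequence)
    then have 1: "limitin ext_space (\<lambda>k. Some (X (r k))) w sequentially" by (simp add: comp_def)
    have 2: "limitin ext_space (\<lambda>k. Some (f (X (r k)))) (Some y) sequentially"
      using limitin_ext_space_Some[OF y(3)] by (simp add: comp_def)
    have "w \<in> ext_boundary D" using X by (intro in_ext_boundary_if_limit[OF _ lim w]) auto
    then have "Some y \<in> cluster_set D f (ext_boundary D)"
      unfolding cluster_set_def using 1 2 X by (intro CollectI bexI[of _ w] exI[of _ "\<lambda>k. X (r k)"]) auto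
    then have "Some y \<in> ext_boundary D'" using cl unfolding closed_mapping_on_def by blast
    then show False using not_in_ext_boundary_open[OF \<open>open D'\<close>] y(1) K(2) by blast
  qed
  have "bounded ?S"
  proof (rule ccontr)
    assume unb: "\<not> bounded ?S"
    have "\<exists>x. x \<in> ?S \<and> real k \<le> norm x" for k
    proof (rule ccontr)
      assume "\<not> ?thesis"
      then have "\<forall>x\<in>?S. norm x \<le> real k" by (meson le_cases)
      then show False using unb unfolding bounded_iff by blast
    qed
    then obtain X where X: "\<And>k. X k \<in> ?S" "\<And>k. real k \<le> norm (X k)" by metis
    show False by (rule no[OF X(1) limitin_ext_space_None[OF X(2)]]) simp
  qed
  moreover have "closed ?S"
    unfolding closed_sequential_limits
  proof (intro allI impI)
    fix X l assume "(\<forall>k. X k \<in> ?S) \<and> X \<longlonglongrightarrow> l"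
    then have X: "\<And>k. X k \<in> ?S" and lim: "X \<longlonglongrightarrow> l" by auto
    have lD: "l \<in> D"
    proof (rule ccontr)
      assume "l \<notin> D"
      then have "Some l \<notin> Some ` D" by auto
      then show False by (rule no[OF X limitin_ext_space_Some[OF lim]])
    qed
    have "(\<lambda>k. f (X k)) \<longlonglongrightarrow> f l"
      using contf lD lim X by (intro continuous_on_tendsto_compose[OF contf]) auto
    moreover have "\<forall>k. f (X k) \<in> K" using X by blast
    ultimately have "f l \<in> K" using compact_imp_closed[OF K(1)] by (metis closed_sequentially)
    then show "l \<in> ?S" using lD by simp
  qed
  ultimately show ?thesis by (simp add: compact_eq_bounded_closed)
qed

lemma open_complement_image:
  fixes f :: "'a::euclidean_space \<Rightarrow> 'a"
  assumes "open D'" and contf: "continuous_on D f"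
    and proper: "\<And>K. compact K \<Longrightarrow> K \<subseteq> D' \<Longrightarrow> compact {x \<in> D. f x \<in> K}"
    and "compact A"
  shows "open (D' - f ` (A \<inter> D))"
proof (rule openI)
  fix y assume y: "y \<in> D' - f ` (A \<inter> D)"
  then obtain e where e: "e > 0" "cball y e \<subseteq> D'" using \<open>open D'\<close> by (meson DiffD1 open_contains_cball)
  let ?S = "{x \<in> D. f x \<in> cball y e} \<inter> A"
  have "compact ?S" using e \<open>compact A\<close> by (intro compact_Int proper) auto
  then have "compact (f ` ?S)" using contf by (intro compact_continuous_image) (auto intro: continuous_on_subset)
  then have "open (ball y e - f ` ?S)" by (intro open_Diff compact_imp_closed) auto
  moreover have "y \<in> ball y e - f ` ?S" using y e by auto
  moreover have "ball y e - f ` ?S \<subseteq> D' - f ` (A \<inter> D)" using e by auto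
  ultimately show "\<exists>d>0. ball y d \<subseteq> D' - f ` (A \<inter> D)" by (meson open_contains_ball subset_trans)
qed

lemma chordal_dist_le: "chordal_dist (Some x) (Some y) \<le> norm (x - y)"
proof -
  have "1 * 1 \<le> sqrt (1 + (norm x)\<^sup>2) * sqrt (1 + (norm y)\<^sup>2)" by (intro mult_mono) auto
  then show ?thesis by (simp add: divide_le_eq mult_le_cancel_left1)
qed

lemma chordal_setdist_le:
  assumes "x \<in> E" "y \<in> F"
  shows "chordal_setdist E F \<le> chordal_dist x y"
  unfolding chordal_setdist_def
proof -
  have "0 \<le> chordal_dist a b" for a b :: "'a option" by (cases "(a, b)" rule: chordal_dist.cases) auto
  then have "bdd_below ((\<lambda>(x, y). chordal_dist x y) ` (E \<times> F))" by (intro bdd_belowI[of _ 0]) auto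
  then show "(INF (x, y)\<in>E \<times> F. chordal_dist x y) \<le> chordal_dist x y"
    using assms cINF_lower[of "\<lambda>(x, y). chordal_dist x y" "E \<times> F" "(x, y)"] by auto
qed

section \<open>Curves crossing a ring\<close>

text \<open>The lift of a curve from \<open>f (B(x0,r1))\<close> to a point outside the image of the closed ball of radius
  \<open>r2\<close> has to cross the ring, and the image of the crossing part is a part of the curve.\<close>

lemma curve_integral_ge_1_by_lifting:
  fixes f :: "'a::euclidean_space \<Rightarrow> 'a"
  assumes "open D" and contf: "continuous_on D f" and opf: "open_mapping_on D f"
    and disc: "discrete_mapping_on D f" and im: "f ` D = D'"
    and proper: "\<And>K. compact K \<Longrightarrow> K \<subseteq> D' \<Longrightarrow> compact {x \<in> D. f x \<in> K}"
    and r: "r1 < r2"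
    and adm: "\<rho> \<in> admissible (image_curves D f (joining_curves (sphere x0 r1) (sphere x0 r2) D))"
    and \<beta>: "0 \<le> l" "M-lipschitz_on {0..l} \<beta>" "\<beta> ` {0..l} \<subseteq> D'"
    and start: "\<beta> 0 \<in> f ` (ball x0 r1 \<inter> D)" and stop: "\<beta> l \<in> D' - f ` (cball x0 r2 \<inter> D)"
  shows "1 \<le> curve_integral ({0..l}, \<beta>) \<rho>"
proof -
  obtain x1 where x1: "x1 \<in> ball x0 r1" "x1 \<in> D" "f x1 = \<beta> 0" using start by auto
  have "\<beta> 0 \<in> f ` (cball x0 r2 \<inter> D)" using x1 r by (auto intro!: image_eqI[of _ f x1])
  then have "l \<noteq> 0" using stop by auto
  then have "0 < l" using \<beta>(1) by simp
  have cont\<beta>: "continuous_on {0..l} \<beta>" using \<beta>(2) by (rule lipschitz_on_continuous_on)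
  have proper': "\<And>K. compact K \<Longrightarrow> K \<subseteq> f ` D \<Longrightarrow> compact {x \<in> D. f x \<in> K}" using proper im by simp
  have im\<beta>: "\<beta> ` {0..l} \<subseteq> f ` D" using \<beta>(3) im by simp
  obtain \<gamma> where \<gamma>: "continuous_on {0..l} \<gamma>" "\<gamma> 0 = x1" "\<gamma> ` {0..l} \<subseteq> D"
    "\<And>t. t \<in> {0..l} \<Longrightarrow> f (\<gamma> t) = \<beta> t"
    using path_lifting[OF \<open>open D\<close> contf opf disc proper' \<open>0 < l\<close> cont\<beta> im\<beta> x1(2,3)] by blast
  define \<phi> where "\<phi> t = dist x0 (\<gamma> t)" for t
  have cont\<phi>: "continuous_on {0..l} \<phi>" unfolding \<phi>_def by (intro continuous_intros \<gamma>(1))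
  have \<phi>0: "\<phi> 0 < r1" using x1 \<gamma>(2) by (simp add: \<phi>_def)
  have \<phi>l: "r2 < \<phi> l"
  proof (rule ccontr)
    assume "\<not> r2 < \<phi> l"
    then have "\<gamma> l \<in> cball x0 r2 \<inter> D" using \<gamma>(3) \<beta>(1) by (auto simp: \<phi>_def)
    then have "f (\<gamma> l) \<in> f ` (cball x0 r2 \<inter> D)" by blast
    then show False using stop \<gamma>(4)[of l] \<beta>(1) by simp
  qed
  have "\<exists>s. 0 \<le> s \<and> s \<le> l \<and> \<phi> s = r1"
    using \<phi>0 \<phi>l r \<beta>(1) cont\<phi> by (intro IVT') auto
  then obtain s where s: "0 \<le> s" "s \<le> l" "\<phi> s = r1" by blast
  have "\<exists>t. s \<le> t \<and> t \<le> l \<and> \<phi> t = r2"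
    using s \<phi>l r by (intro IVT') (auto intro: continuous_on_subset[OF cont\<phi>])
  then obtain t where t: "s \<le> t" "t \<le> l" "\<phi> t = r2" by blast
  have "s < t" using s t r by (cases "s = t") auto
  have sub: "{s..t} \<subseteq> {0..l}" using s t by auto
  have "({s..t}, \<gamma>) \<in> joining_curves (sphere x0 r1) (sphere x0 r2) D"
    unfolding joining_curves_def
    using \<open>s < t\<close> s t sub \<gamma>(3) continuous_on_subset[OF \<gamma>(1) sub]
    by (intro CollectI exI[of _ s] exI[of _ t] exI[of _ \<gamma>]) (auto simp: \<phi>_def)
  moreover have "{u \<in> {s..t}. \<gamma> u \<in> D} = {s..t}" using sub \<gamma>(3) by blast
  ultimately have mem: "({s..t}, f \<circ> \<gamma>) \<in> image_curves D f (joining_curves (sphere x0 r1) (sphere x0 r2) D)"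
    unfolding image_curves_def by (intro image_eqI[of _ _ "({s..t}, \<gamma>)"]) auto
  have eq: "(f \<circ> \<gamma>) u = \<beta> u" if "u \<in> {s..t}" for u using \<gamma>(4) sub that by auto
  have fin: "curve_length a b \<beta> < \<infinity>" if "a \<le> b" "{a..b} \<subseteq> {s..t}" for a b
  proof -
    have "curve_length a b \<beta> \<le> ennreal (M * (b - a))"
      using that sub by (intro curve_length_lipschitz lipschitz_on_subset[OF \<beta>(2)]) auto
    then show ?thesis by (rule le_less_trans) simp
  qed
  have "locally_rectifiable ({s..t}, f \<circ> \<gamma>)"
    unfolding locally_rectifiable.simps
  proof (intro allI impI, elim conjE)
    fix a b :: real assume ab: "a \<le> b" "{a..b} \<subseteq> {s..t}"
    have "curve_length a b (f \<circ> \<gamma>) = curve_length a b \<beta>"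
      using ab by (intro curve_length_cong eq) auto
    then show "curve_length a b (f \<circ> \<gamma>) < \<infinity>" using fin[OF ab] by simp
  qed
  then have "1 \<le> curve_integral ({s..t}, f \<circ> \<gamma>) \<rho>" using adm mem unfolding admissible_def by blast
  also have "\<dots> \<le> curve_integral ({0..l}, \<beta>) \<rho>"
    unfolding curve_integral.simps(1)[of "{s..t}"]
  proof (rule SUP_least, clarify)
    fix a b :: real assume ab: "a \<le> b" "{a..b} \<subseteq> {s..t}"
    have "continuous_on {a..b} \<beta>" using cont\<beta> ab sub by (blast intro: continuous_on_subset)
    then have "segment_integral a b \<beta> \<rho> = segment_integral a b (f \<circ> \<gamma>) \<rho>"
      using ab fin[OF ab] eq by (intro segment_integral_cong) auto
    moreover have "segment_integral a b \<beta> \<rho> \<le> curve_integral ({0..l}, \<beta>) \<rho>"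
      using ab sub by (intro segment_integral_le_curve_integral) blast+
    ultimately show "segment_integral a b (f \<circ> \<gamma>) \<rho> \<le> curve_integral ({0..l}, \<beta>) \<rho>" by simp
  qed
  finally show ?thesis .
qed

section \<open>Logarithmic modulus of continuity at a boundary point\<close>

theorem mainTheorem2:
  fixes D' :: "'a::euclidean_space set" and p C :: real
  assumes "2 \<le> DIM('a)"
    and "real DIM('a) - 1 < p" and "p \<le> real DIM('a)"
    and "is_domain D'" and "bounded D'"
    and "Ahlfors_regular D'" and "Poincare_inequality p D'"
    and "0 < C"
  shows "\<exists>Ct>0. \<forall>(D :: 'a set) (x0 :: 'a) (\<delta> :: real) (Q :: 'a \<Rightarrow> ennreal) (r0 :: real).
    is_domain D \<longrightarrow> Some x0 \<in> ext_boundary D \<longrightarrow> 0 < \<delta> \<longrightarrow> 0 < r0 \<longrightarrow>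
    Q \<in> borel_measurable lebesgue \<longrightarrow> (\<forall>x. x \<notin> D \<longrightarrow> Q x = 0) \<longrightarrow>
    (\<exists>r0'>0. \<forall>r. 0 < r \<and> r < r0' \<longrightarrow> connected (ball x0 r \<inter> D)) \<longrightarrow>
    Limsup (at_right 0)
      (\<lambda>\<epsilon>. (\<integral>\<^sup>+ x\<in>ball x0 \<epsilon> \<inter> D. Q x \<partial>lebesgue)
             / ennreal (measure lebesgue (ball (0::'a) 1) * \<epsilon> ^ DIM('a))) \<le> ennreal C \<longrightarrow>
    (\<exists>\<epsilon>0. 0 < \<epsilon>0 \<and> \<epsilon>0 < 1 \<and>
      (\<forall>f \<in> ring_family p x0 r0 Q \<delta> D D'.
        \<forall>x \<in> ball x0 (\<epsilon>0\<^sup>2) \<inter> D. \<forall>y \<in> ball x0 (\<epsilon>0\<^sup>2) \<inter> D.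
          norm (f x - f y) \<le>
            Ct * max (1 / (ln (\<epsilon>0 / norm (x - x0))) ^ (DIM('a) - 1))
                     (1 / (ln (\<epsilon>0 / norm (y - x0))) ^ (DIM('a) - 1))))"
proof -
  let ?n = "DIM('a)"
  define \<omega> where "\<omega> = measure lebesgue (ball (0::'a) 1)"
  have \<omega>: "\<omega> > 0" unfolding \<omega>_def using content_ball_pos[of 1 "0::'a"] by simp
  have p1: "1 < p" using assms(1,2) by linarith
  have D': "open D'" "D' \<noteq> {}" using assms(4) by (auto simp: is_domain_def)
  obtain M where M: "M > 0" and energy: "\<forall>E F U V \<rho>. compact E \<and> connected E \<and> E \<noteq> {} \<and> E \<subseteq> D' \<and>
      compact F \<and> connected F \<and> F \<noteq> {} \<and> F \<subseteq> D' \<and> open U \<and> open V \<and> E \<subseteq> U \<and> F \<subseteq> V \<and>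
      \<rho> \<in> borel_measurable borel \<and>
      (\<forall>l L \<beta>. 0 \<le> l \<and> L-lipschitz_on {0..l} \<beta> \<and> \<beta> ` {0..l} \<subseteq> D' \<and> \<beta> 0 \<in> U \<and> \<beta> l \<in> V \<longrightarrow>
         1 \<le> curve_integral ({0..l}, \<beta>) \<rho>) \<longrightarrow>
      ennreal (min (diameter E) (diameter F)) \<le> ennreal M * (\<integral>\<^sup>+z. epowr (\<rho> z) p \<partial>lborel)"
    using min_diameter_le_energy[OF assms(2) p1 D' assms(5-7)] by blast
  have pos: "0 < p" "0 < 2 * C * \<omega>" using p1 \<omega> assms(8) by auto
  obtain A where A: "A > 0" and ring: "\<forall>Q (x0::'a) r1 r2. Q \<in> borel_measurable lebesgue \<and> 0 < r1 \<and> r1 < r2 \<and> r2 \<le> 1 \<and> 1 \<le> ln (r2 / r1) \<and>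
     (\<forall>r. 0 < r \<and> r \<le> r2 \<longrightarrow> (\<integral>\<^sup>+x\<in>ball x0 r. Q x \<partial>lebesgue) \<le> ennreal (2 * C * \<omega> * r ^ ?n)) \<longrightarrow>
     (\<integral>\<^sup>+ x\<in>{x. r1 < norm (x - x0) \<and> norm (x - x0) < r2}.
         Q x * epowr (ennreal (1 / (norm (x - x0) * ln (r2 / r1)))) p \<partial>lebesgue)
       \<le> ennreal (A / ln (r2 / r1) ^ (?n - 1))"
    using ring_integral_le_log[OF assms(2,3) pos] by blast
  have "\<exists>\<epsilon>0. 0 < \<epsilon>0 \<and> \<epsilon>0 < 1 \<and>
      (\<forall>f \<in> ring_family p x0 r0 Q \<delta> D D'.
        \<forall>x \<in> ball x0 (\<epsilon>0\<^sup>2) \<inter> D. \<forall>y \<in> ball x0 (\<epsilon>0\<^sup>2) \<inter> D.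
          norm (f x - f y) \<le> (M * A * 2 ^ (?n - 1)) *
            max (1 / (ln (\<epsilon>0 / norm (x - x0))) ^ (?n - 1)) (1 / (ln (\<epsilon>0 / norm (y - x0))) ^ (?n - 1)))"
    if D: "is_domain D" and bd: "Some x0 \<in> ext_boundary D" and \<delta>: "0 < \<delta>" and r0: "0 < r0"
      and Q: "Q \<in> borel_measurable lebesgue" and Q0: "\<forall>x. x \<notin> D \<longrightarrow> Q x = 0"
      and conn: "\<exists>r0'>0. \<forall>r. 0 < r \<and> r < r0' \<longrightarrow> connected (ball x0 r \<inter> D)"
      and ls: "Limsup (at_right 0)
      (\<lambda>\<epsilon>. (\<integral>\<^sup>+ x\<in>ball x0 \<epsilon> \<inter> D. Q x \<partial>lebesgue)
             / ennreal (measure lebesgue (ball (0::'a) 1) * \<epsilon> ^ ?n)) \<le> ennreal C"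
    for D :: "'a set" and x0 \<delta> Q r0
  proof -
    have "open D" using D by (simp add: is_domain_def)
    have x0D: "x0 \<notin> D" using not_in_ext_boundary_open[OF \<open>open D\<close>] bd by blast
    obtain r0' where r0': "r0' > 0" "\<And>r. 0 < r \<Longrightarrow> r < r0' \<Longrightarrow> connected (ball x0 r \<inter> D)" using conn by blast
    have "ennreal C < ennreal (2 * C)" using assms(8) by (intro ennreal_lessI) auto
    then have "\<forall>\<^sub>F \<epsilon> in at_right 0. (\<integral>\<^sup>+ x\<in>ball x0 \<epsilon> \<inter> D. Q x \<partial>lebesgue) / ennreal (\<omega> * \<epsilon> ^ ?n) < ennreal (2 * C)"
      using ls unfolding \<omega>_def by (intro Limsup_lessD) (rule le_less_trans)
    then obtain e1 where e1: "e1 > 0" "\<And>\<epsilon>. 0 < \<epsilon> \<Longrightarrow> \<epsilon> < e1 \<Longrightarrow>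
        (\<integral>\<^sup>+ x\<in>ball x0 \<epsilon> \<inter> D. Q x \<partial>lebesgue) / ennreal (\<omega> * \<epsilon> ^ ?n) < ennreal (2 * C)"
      unfolding eventually_at_right_field by auto
    have mass: "(\<integral>\<^sup>+x\<in>ball x0 r. Q x \<partial>lebesgue) \<le> ennreal (2 * C * \<omega> * r ^ ?n)" if r: "0 < r" "r < e1" for r
    proof -
      have "(\<integral>\<^sup>+x\<in>ball x0 r. Q x \<partial>lebesgue) = (\<integral>\<^sup>+ x\<in>ball x0 r \<inter> D. Q x \<partial>lebesgue)"
        using Q0 by (intro nn_integral_cong) (auto split: split_indicator)
      also have "\<dots> \<le> ennreal (2 * C * (\<omega> * r ^ ?n))"
      proof (cases "\<integral>\<^sup>+ x\<in>ball x0 r \<inter> D. Q x \<partial>lebesgue")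
        case (real v)
        have a: "\<omega> * r ^ ?n > 0" using \<omega> r by simp
        have "ennreal (v / (\<omega> * r ^ ?n)) < ennreal (2 * C)"
          using e1(2)[OF r] real a by (simp add: divide_ennreal)
        then have "v / (\<omega> * r ^ ?n) < 2 * C" using real(1) a by (subst (asm) ennreal_less_iff) auto
        then have "v \<le> 2 * C * (\<omega> * r ^ ?n)" using a by (simp only: pos_divide_less_eq less_imp_le)
        then show ?thesis unfolding real(2) by (rule ennreal_leI)
      next
        case top
        then show ?thesis using e1(2)[OF r] by (simp add: ennreal_top_divide)
      qed
      finally show ?thesis by (simp add: mult.assoc)
    qed
    \<comment> \<open>With \<open>h\<close> as below, \<open>1 + h < L\<close> will hold for the logarithm \<open>L\<close> of the ratio of the radii: then the
      modulus bound is less than \<open>\<delta> / M\<close>, so that the continuum in the image of the curve is the smaller one.\<close>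
    define h where "h = M * A / \<delta>"
    have h: "h > 0" using M A \<delta> by (simp add: h_def)
    define \<epsilon>0 where "\<epsilon>0 = min (exp (- (2 * (1 + h)))) (min (min r0 r0') (min \<delta> e1) / 2)"
    have \<epsilon>0: "0 < \<epsilon>0" "\<epsilon>0 < r0" "\<epsilon>0 < r0'" "\<epsilon>0 < \<delta>" "\<epsilon>0 < e1"
      using r0 r0'(1) \<delta> e1(1) by (auto simp: \<epsilon>0_def min_def)
    have "\<epsilon>0 \<le> exp (- (2 * (1 + h)))" by (simp add: \<epsilon>0_def)
    then have ln\<epsilon>: "ln \<epsilon>0 \<le> - (2 * (1 + h))" using \<epsilon>0(1) by (metis ln_exp ln_le_cancel_iff exp_gt_zero)
    also have "- (2 * (1 + h)) < 0" using h by simp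
    finally have "ln \<epsilon>0 < 0" .
    then have "\<epsilon>0 < 1" using \<epsilon>0(1) by (simp add: ln_less_zero_iff)
    have "norm (f x - f y) \<le> (M * A * 2 ^ (?n - 1)) *
            max (1 / (ln (\<epsilon>0 / norm (x - x0))) ^ (?n - 1)) (1 / (ln (\<epsilon>0 / norm (y - x0))) ^ (?n - 1))"
      if f: "f \<in> ring_family p x0 r0 Q \<delta> D D'" and x: "x \<in> ball x0 (\<epsilon>0\<^sup>2) \<inter> D" and y: "y \<in> ball x0 (\<epsilon>0\<^sup>2) \<inter> D"
      for f x y
    proof -
      have contf: "continuous_on D f" and im: "f ` D = D'" and opf: "open_mapping_on D f"
        and disc: "discrete_mapping_on D f" and cl: "closed_mapping_on D D' f" and rQ: "ring_Q_mapping p x0 r0 Q D f"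
        using f by (auto simp: ring_family_def)
      obtain K where K: "compact K" "connected K" "K \<noteq> {}" "K \<subseteq> D'" "\<delta> \<le> diameter K"
        "\<delta> \<le> chordal_setdist (Some ` {x \<in> D. f x \<in> K}) (ext_boundary D)"
        using f by (auto simp: ring_family_def)
      have proper: "compact {x \<in> D. f x \<in> K'}" if "compact K'" "K' \<subseteq> D'" for K'
        by (rule closed_mapping_imp_proper[OF \<open>open D\<close> D'(1) contf cl that])
      define m where "m = max (norm (x - x0)) (norm (y - x0))"
      have "x \<noteq> x0" using x x0D by auto
      then have m: "0 < m" "m < \<epsilon>0\<^sup>2"
        using x y by (auto simp: m_def dist_norm norm_minus_commute less_max_iff_disj)
      have "\<epsilon>0\<^sup>2 < \<epsilon>0" using \<epsilon>0(1) \<open>\<epsilon>0 < 1\<close> by (simp add: power2_eq_square)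
      then have "m < \<epsilon>0" using m by simp
      \<comment> \<open>With the geometric mean of \<open>m\<close> and \<open>\<epsilon>0\<close> the ball contains both points, since \<open>m < r\<close>, and the
        logarithm of the ratio to \<open>\<epsilon>0\<close> is only halved.\<close>
      define r where "r = sqrt (\<epsilon>0 * m)"
      have r: "m < r" "r < \<epsilon>0" "0 < r"
      proof -
        show "m < r" unfolding r_def using m \<open>m < \<epsilon>0\<close>
          by (intro real_less_rsqrt) (simp add: power2_eq_square)
        show "r < \<epsilon>0" unfolding r_def using m \<open>m < \<epsilon>0\<close> \<epsilon>0(1)
          by (intro real_less_lsqrt) (auto simp: power2_eq_square)
        then show "0 < r" using \<open>m < r\<close> m by simp
      qed
      define L where "L = ln (\<epsilon>0 / r)"
      have L_half: "ln (\<epsilon>0 / m) = 2 * L"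
      proof -
        have "ln r = (ln \<epsilon>0 + ln m) / 2" unfolding r_def using \<epsilon>0(1) m by (simp add: ln_sqrt ln_mult)
        then show ?thesis unfolding L_def using \<epsilon>0(1) m r by (simp add: ln_div)
      qed
      have L: "1 + h < L"
      proof -
        have "ln m < ln (\<epsilon>0\<^sup>2)" using m \<epsilon>0(1) by simp
        also have "\<dots> = 2 * ln \<epsilon>0" using \<epsilon>0(1) by (simp add: ln_realpow)
        finally have "- ln \<epsilon>0 < ln \<epsilon>0 - ln m" by simp
        also have "\<dots> = 2 * L" using L_half \<epsilon>0(1) m by (simp add: ln_div)
        finally show ?thesis using ln\<epsilon> by simp
      qed
      then have L1: "1 \<le> L" using h by simp
      define B where "B = ball x0 r \<inter> D"
      have "open B" "connected B" "B \<subseteq> D"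
        using \<open>open D\<close> r \<epsilon>0(3) r0'(2)[of r] by (auto simp: B_def)
      moreover have xy: "x \<in> B" "y \<in> B" using x y r(1) by (auto simp: B_def m_def dist_norm norm_minus_commute)
      ultimately obtain g where g: "path g" "path_image g \<subseteq> B" "pathstart g = x" "pathfinish g = y"
        using connected_open_path_connected[of B] unfolding path_connected_def by blast
      define E where "E = f ` path_image g"
      have contE: "continuous_on (path_image g) f"
        using contf g(2) \<open>B \<subseteq> D\<close> by (blast intro: continuous_on_subset)
      have E: "compact E" "connected E" "E \<noteq> {}" "E \<subseteq> D'"
        unfolding E_def using contE compact_path_image[OF g(1)] connected_path_image[OF g(1)] g(2) \<open>B \<subseteq> D\<close> im
        by (auto intro: compact_continuous_image connected_continuous_image)
      have fxy: "f x \<in> E" "f y \<in> E" unfolding E_def using g(3,4) by auto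
      define U where "U = f ` B"
      have U: "open U" "E \<subseteq> U"
        using opf \<open>open B\<close> \<open>B \<subseteq> D\<close> g(2) by (auto simp: U_def E_def open_mapping_on_def)
      define V where "V = D' - f ` (cball x0 \<epsilon>0 \<inter> D)"
      have "open V" unfolding V_def
        by (rule open_complement_image[OF D'(1) contf]) (rule proper, assumption+, rule compact_cball)
      have "K \<subseteq> V"
      proof
        fix z assume "z \<in> K"
        have "\<epsilon>0 < norm (w - x0)" if "w \<in> D" "f w \<in> K" for w
        proof -
          have "\<delta> \<le> chordal_setdist (Some ` {x \<in> D. f x \<in> K}) (ext_boundary D)" by (rule K(6))
          also have "\<dots> \<le> chordal_dist (Some w) (Some x0)"
            using that bd by (intro chordal_setdist_le) auto
          also have "\<dots> \<le> norm (w - x0)" by (rule chordal_dist_le)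
          finally show ?thesis using \<epsilon>0(4) by simp
        qed
        then have "z \<notin> f ` (cball x0 \<epsilon>0 \<inter> D)" using \<open>z \<in> K\<close> by (force simp: dist_norm norm_minus_commute)
        then show "z \<in> V" using K(4) \<open>z \<in> K\<close> by (auto simp: V_def)
      qed
      define \<Gamma> where "\<Gamma> = image_curves D f (joining_curves (sphere x0 r) (sphere x0 \<epsilon>0) D)"
      define \<eta> where "\<eta> t = ennreal (1 / (t * L))" for t
      have "\<eta> \<in> borel_measurable borel" unfolding \<eta>_def by measurable
      then have "\<eta> \<in> borel_measurable lebesgue" by (intro measurable_completion) simp
      then have \<eta>m: "\<eta> \<in> borel_measurable (lebesgue_on {r<..<\<epsilon>0})" by (rule measurable_restrict_space1)
      have "(\<integral>\<^sup>+ t\<in>{r<..<\<epsilon>0}. \<eta> t \<partial>lebesgue) = 1"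
        unfolding \<eta>_def L_def using r by (intro nn_integral_reciprocal_log) auto
      then have "modulus p \<Gamma> \<le> (\<integral>\<^sup>+ z\<in>{z. r < norm (z - x0) \<and> norm (z - x0) < \<epsilon>0}.
          Q z * epowr (\<eta> (norm (z - x0))) p \<partial>lebesgue)"
        using rQ r \<epsilon>0(2) \<eta>m unfolding ring_Q_mapping_def \<Gamma>_def by auto
      also have "\<dots> \<le> ennreal (A / L ^ (?n - 1))"
        unfolding \<eta>_def L_def
        using Q r \<open>\<epsilon>0 < 1\<close> L1 mass \<epsilon>0(5) unfolding L_def by (intro ring[rule_format]) auto
      finally have mod: "modulus p \<Gamma> \<le> ennreal (A / L ^ (?n - 1))" .
      have lower: "ennreal (min (diameter E) (diameter K)) \<le> ennreal M * (\<integral>\<^sup>+z. epowr (\<rho> z) p \<partial>lborel)"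
        if \<rho>: "\<rho> \<in> admissible \<Gamma>" for \<rho>
      proof -
        have meas: "\<rho> \<in> borel_measurable borel" using \<rho> by (simp add: admissible_def)
        have lift: "\<forall>l L \<beta>. 0 \<le> l \<and> L-lipschitz_on {0..l} \<beta> \<and> \<beta> ` {0..l} \<subseteq> D' \<and> \<beta> 0 \<in> U \<and> \<beta> l \<in> V \<longrightarrow>
           1 \<le> curve_integral ({0..l}, \<beta>) \<rho>"
          unfolding U_def V_def B_def
          by (intro allI impI, elim conjE)
            (rule curve_integral_ge_1_by_lifting[OF \<open>open D\<close> contf opf disc im proper r(2) \<rho>[unfolded \<Gamma>_def]])
        show ?thesis
          by (rule energy[THEN spec[of _ E], THEN spec[of _ K], THEN spec[of _ U], THEN spec[of _ V],
                THEN spec[of _ \<rho>], THEN mp])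
            (intro conjI E K(1-4) U \<open>open V\<close> \<open>K \<subseteq> V\<close> meas lift)
      qed
      have "ennreal (min (diameter E) (diameter K) / M) \<le> modulus p \<Gamma>"
        unfolding modulus_def
      proof (rule INF_greatest)
        fix \<rho> assume "\<rho> \<in> admissible \<Gamma>"
        from lower[OF this] show "ennreal (min (diameter E) (diameter K) / M) \<le> (\<integral>\<^sup>+z. epowr (\<rho> z) p \<partial>lborel)"
        proof (cases "\<integral>\<^sup>+z. epowr (\<rho> z) p \<partial>lborel")
          case (real i)
          have "ennreal (min (diameter E) (diameter K)) \<le> ennreal (M * i)"
            using lower[OF \<open>\<rho> \<in> admissible \<Gamma>\<close>] M real by (simp add: ennreal_mult)
          then have "min (diameter E) (diameter K) \<le> M * i"
            using M real(1) by (subst (asm) ennreal_le_iff) auto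
          then show ?thesis unfolding real(2) using M by (intro ennreal_leI) (simp add: field_simps)
        qed simp
      qed
      then have "ennreal (min (diameter E) (diameter K) / M) \<le> ennreal (A / L ^ (?n - 1))" using mod by (rule order_trans)
      then have "min (diameter E) (diameter K) / M \<le> A / L ^ (?n - 1)"
        using A L1 by (subst (asm) ennreal_le_iff) auto
      then have upper: "min (diameter E) (diameter K) \<le> M * A / L ^ (?n - 1)"
        using M by (simp add: field_simps)
      have "L \<le> L ^ (?n - 1)" using L1 assms(1) by (intro self_le_power) auto
      then have "M * A / L ^ (?n - 1) \<le> M * A / L" using M A L1 by (intro divide_left_mono) auto
      also have "\<dots> < \<delta>"
      proof -
        have "h < L" using L by simp
        then show ?thesis using \<delta> L1 by (simp add: h_def field_simps)
      qed
      finally have "diameter E \<le> M * A / L ^ (?n - 1)" using upper K(5) by linarith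
      moreover have "norm (f x - f y) \<le> diameter E"
        using diameter_bounded_bound[OF compact_imp_bounded[OF E(1)] fxy] by (simp add: dist_norm)
      ultimately have "norm (f x - f y) \<le> M * A / L ^ (?n - 1)" by simp
      also have "\<dots> = (M * A * 2 ^ (?n - 1)) * (1 / (2 * L) ^ (?n - 1))" by (simp add: power_mult_distrib)
      also have "\<dots> \<le> (M * A * 2 ^ (?n - 1)) *
            max (1 / (ln (\<epsilon>0 / norm (x - x0))) ^ (?n - 1)) (1 / (ln (\<epsilon>0 / norm (y - x0))) ^ (?n - 1))"
        using M A unfolding L_half[symmetric] m_def
        by (intro mult_left_mono) (auto simp: max_def)
      finally show ?thesis .
    qed
    then show ?thesis using \<epsilon>0(1) \<open>\<epsilon>0 < 1\<close> by (intro exI[of _ \<epsilon>0]) blast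
  qed
  moreover have "M * A * 2 ^ (?n - 1) > 0" using M A by simp
  ultimately show ?thesis by blast
qed

end
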